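(* Assume Hypothesis (H) below. Let $t_1,\dots,t_d\ge 0$, $T=\sum_{k=1}^d t_k$, and let $(n_k,f^{(k)})_{k\ge1}$ be a sequence with $n_k\to\infty$, $f^{(k)}\in\mathcal K$, $\rho(f^{(k)})\to1$; write $n=n_k$, $\rho=\rho(f^{(k)})$ and evaluate all $f$-dependent quantities at $f=f^{(k)}$. For a vector $m_n$ specified below, put $$\Phi_{n,j}=E\Big(\exp\Big\{-\sum_{l=1}^d \tfrac{t_l\,Y_{n,l}}{m_{n,l}}\Big\}\,\Big|\,N=n,\ Z_0=e_j\Big).$$ Then for every $j\in\{1,\dots,d\}$, as $k\to\infty$: (1) if $\rho\neq1$ for all $k$, $n|1-\rho|\to-\ln r$ with $r\in(0,1)$, and $m_n=\frac{2Q(1-\rho_\mu^n)^2h(\theta_n)}{(1-\rho_\mu)^2}v$, then with $D=d(T,r)$, $\Phi_{n,j}\to\frac{(1-r)^2r^{D}D^2}{r(1-r^{D})^2}$; (2) if $n|1-\rho|\to0$ and $m_n=\frac{Qn^2}{3}v$, then $\Phi_{n,j}\to\frac{3T}{\sinh^2\sqrt{3T}}$; (3) if $\rho\ne1$ for all $k$, $n|1-\rho|\to\infty$ and $m_n=\frac{2Qn}{1-\rho_\mu}v$, then $\Phi_{n,j}\to e^{-T}$.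
   Context: Fix $d\ge1$, $X=\mathbb Z_{\ge0}^d$, $C=[0,1]^d$; $s^\alpha=\prod_i s_i^{\alpha_i}$; vector inequalities and the product $sw$ are componentwise; $\mathbf 1,\mathbf 0,e_k$ as usual. A $d$-type Galton–Watson process $(Z_n)_{n\ge0}$ in $X$ has offspring p.g.f. $f=(f_1,\dots,f_d)'$, $f_k(s)=\sum_{i\in X}p_k(i)s^i$. $Y_n=\sum_{l=0}^nZ_l$ is the total progeny and $N=\min\{n:Z_n=\mathbf 0\}$ the extinction time. $M(s)=(\partial f_k(s)/\partial s_l)_{k,l}$, $M=M(\mathbf 1)$, $b^k_{lm}$ and $c^k_{lmj}$ the second and third partial derivatives of $f_k$ at $\mathbf 1$. For fixed $a,b,c>0$, $U\in\mathbb N$, $\mathcal K=\mathcal K(a,b,c,U)$ is the class of such $f$ with $[M^U]_{kl}\ge a$ for all $k,l$, $\sum_{k,l,m}b^k_{lm}\ge b$, $\sum_{k,l,m,j}c^k_{lmj}\le c$. $\rho=\rho(f)$ is the Perron root of $M$, $u,v$ the right and left eigenvectors normalized by $\sum_ku_k=1$, $\sum_ku_kv_k=1$; $Q=\frac12\sum_kv_k\sum_{l,m}b^k_{lm}u_lu_m$. $\mu$ is the extinction probability vector, $\rho_\mu$ the Perron root of $M(\mu)$, $\theta_n=n\ln\rho_\mu$. Define $h(x)=\frac{x(1+e^x)-2(1-e^x)}{(e^x-1)^3}$ and $d(y,x)=\sqrt{1+\frac{2y}{(1-x)^2h(\ln x)}}$. Hypothesis (H): for $f\in\mathcal K$, $s\in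 C$ let $h_0(s)=\mathbf 0$, $h_n(s)=sf(h_{n-1}(s))$, $h^*(s)=\lim_nh_n(s)$ (the unique solution in $C$ of $h=sf(h)$), and $v_{h^*}$ the left Perron eigenvector of $M(h^*(s))$, normalized with the right one $u_{h^*}$ by $\sum_ku_{h^*,k}=1$, $\sum_ku_{h^*,k}v_{h^*,k}=1$. (H): for every sequence $(n_k,f^{(k)},s^{(k)})$ with $n_k\to\infty$, $f^{(k)}\in\mathcal K$, $\rho(f^{(k)})\to1$, $s^{(k)}\in C$, $s^{(k)}\to\mathbf 1$, $v_{h^*}'(h^*(s^{(k)})-h_{n_k}(s^{(k)}))\to0$. *)

theory Defs
  imports "HOL-Probability.Probability"
begin

text \<open>Types are indexed by a finite type 'd (so d = CARD('d) \<ge> 1).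
  Population vectors are 'd \<Rightarrow> nat, real vectors 'd \<Rightarrow> real,
  matrices 'd \<Rightarrow> 'd \<Rightarrow> real.  A d-type offspring law is
  p :: 'd \<Rightarrow> ('d \<Rightarrow> nat) pmf, p k being the law of the offspring vector
  of a type-k particle (p_k(i) = pmf (p k) i); it determines the p.g.f. f.\<close>

type_synonym 'd offspring = "'d \<Rightarrow> ('d \<Rightarrow> nat) pmf"

definition unit_vec :: "'d \<Rightarrow> 'd \<Rightarrow> nat" where
  "unit_vec j = (\<lambda>l. if l = j then 1 else 0)"

definition cube :: "('d::finite \<Rightarrow> real) set" where
  "cube = {s. \<forall>l. 0 \<le> s l \<and> s l \<le> 1}"

definition pgf :: "('d::finite) offspring \<Rightarrow> ('d \<Rightarrow> real) \<Rightarrow> 'd \<Rightarrow> real" where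
  "pgf p s k = measure_pmf.expectation (p k) (\<lambda>\<xi>. \<Prod>l\<in>UNIV. s l ^ \<xi> l)"

text \<open>M(s)_{kl} = partial f_k / partial s_l (s) = sum_i p_k(i) i_l s^(i - e_l)\<close>
definition dpgf :: "('d::finite) offspring \<Rightarrow> ('d \<Rightarrow> real) \<Rightarrow> 'd \<Rightarrow> 'd \<Rightarrow> real" where
  "dpgf p s k l = measure_pmf.expectation (p k)
     (\<lambda>\<xi>. real (\<xi> l) * (\<Prod>m\<in>UNIV. s m ^ (\<xi> m - unit_vec l m)))"

definition mean_mat :: "('d::finite) offspring \<Rightarrow> 'd \<Rightarrow> 'd \<Rightarrow> real" where
  "mean_mat p = dpgf p (\<lambda>_. 1)"

text \<open>Second and third partial derivatives of f_k at 1 (factorial moments, possibly infinite).\<close>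
definition fmom2 :: "('d::finite) offspring \<Rightarrow> 'd \<Rightarrow> 'd \<Rightarrow> 'd \<Rightarrow> ennreal" where
  "fmom2 p k l m = (\<integral>\<^sup>+ \<xi>. of_nat (\<xi> l * (\<xi> m - unit_vec l m)) \<partial>measure_pmf (p k))"

definition fmom3 :: "('d::finite) offspring \<Rightarrow> 'd \<Rightarrow> 'd \<Rightarrow> 'd \<Rightarrow> 'd \<Rightarrow> ennreal" where
  "fmom3 p k l m j = (\<integral>\<^sup>+ \<xi>. of_nat (\<xi> l * (\<xi> m - unit_vec l m) * (\<xi> j - unit_vec l j - unit_vec m j))
        \<partial>measure_pmf (p k))"

definition bcoef :: "('d::finite) offspring \<Rightarrow> 'd \<Rightarrow> 'd \<Rightarrow> 'd \<Rightarrow> real" where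
  "bcoef p k l m = enn2real (fmom2 p k l m)"

definition mat_mult :: "('d::finite \<Rightarrow> 'd \<Rightarrow> real) \<Rightarrow> ('d \<Rightarrow> 'd \<Rightarrow> real) \<Rightarrow> 'd \<Rightarrow> 'd \<Rightarrow> real" where
  "mat_mult A B = (\<lambda>i j. \<Sum>l\<in>UNIV. A i l * B l j)"

fun mat_pow :: "('d::finite \<Rightarrow> 'd \<Rightarrow> real) \<Rightarrow> nat \<Rightarrow> 'd \<Rightarrow> 'd \<Rightarrow> real" where
  "mat_pow A 0 = (\<lambda>i j. if i = j then 1 else 0)"
| "mat_pow A (Suc n) = mat_mult (mat_pow A n) A"

definition in_K :: "real \<Rightarrow> real \<Rightarrow> real \<Rightarrow> nat \<Rightarrow> ('d::finite) offspring \<Rightarrow> bool" where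
  "in_K a b c U p \<longleftrightarrow>
     (\<forall>k l. mat_pow (mean_mat p) U k l \<ge> a) \<and>
     (\<Sum>k\<in>UNIV. \<Sum>l\<in>UNIV. \<Sum>m\<in>UNIV. fmom2 p k l m) \<ge> ennreal b \<and>
     (\<Sum>k\<in>UNIV. \<Sum>l\<in>UNIV. \<Sum>m\<in>UNIV. \<Sum>j\<in>UNIV. fmom3 p k l m j) \<le> ennreal c"

text \<open>Perron root of a nonnegative matrix = its spectral radius.\<close>
definition perron_root :: "('d::finite \<Rightarrow> 'd \<Rightarrow> real) \<Rightarrow> real" where
  "perron_root A = Max {cmod z | z. \<exists>x :: 'd \<Rightarrow> complex. (\<exists>i. x i \<noteq> 0) \<and>
       (\<forall>i. (\<Sum>j\<in>UNIV. complex_of_real (A i j) * x j) = z * x i)}"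

definition right_pvec :: "('d::finite \<Rightarrow> 'd \<Rightarrow> real) \<Rightarrow> 'd \<Rightarrow> real" where
  "right_pvec A = (THE u. (\<forall>i. 0 \<le> u i) \<and>
       (\<forall>i. (\<Sum>j\<in>UNIV. A i j * u j) = perron_root A * u i) \<and> (\<Sum>i\<in>UNIV. u i) = 1)"

definition left_pvec :: "('d::finite \<Rightarrow> 'd \<Rightarrow> real) \<Rightarrow> 'd \<Rightarrow> real" where
  "left_pvec A = (THE v. (\<forall>i. 0 \<le> v i) \<and>
       (\<forall>j. (\<Sum>i\<in>UNIV. v i * A i j) = perron_root A * v j) \<and>
       (\<Sum>i\<in>UNIV. right_pvec A i * v i) = 1)"

definition rho :: "('d::finite) offspring \<Rightarrow> real" where
  "rho p = perron_root (mean_mat p)"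

definition Qconst :: "('d::finite) offspring \<Rightarrow> real" where
  "Qconst p = (let u = right_pvec (mean_mat p); v = left_pvec (mean_mat p) in
     1/2 * (\<Sum>k\<in>UNIV. v k * (\<Sum>l\<in>UNIV. \<Sum>m\<in>UNIV. bcoef p k l m * u l * u m)))"

fun iid_sum :: "('d \<Rightarrow> nat) pmf \<Rightarrow> nat \<Rightarrow> ('d \<Rightarrow> nat) pmf" where
  "iid_sum q 0 = return_pmf (\<lambda>_. 0)"
| "iid_sum q (Suc m) = bind_pmf q (\<lambda>x. map_pmf (\<lambda>y. \<lambda>l. x l + y l) (iid_sum q m))"

definition gw_step :: "('d::finite) offspring \<Rightarrow> ('d \<Rightarrow> nat) \<Rightarrow> ('d \<Rightarrow> nat) pmf" where
  "gw_step p z = map_pmf (\<lambda>g. \<lambda>l. \<Sum>k\<in>UNIV. g k l) (Pi_pmf UNIV (\<lambda>_. 0) (\<lambda>k. iid_sum (p k) (z k)))"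

fun gw_path :: "('d::finite) offspring \<Rightarrow> ('d \<Rightarrow> nat) \<Rightarrow> nat \<Rightarrow> ('d \<Rightarrow> nat) list pmf" where
  "gw_path p z0 0 = return_pmf [z0]"
| "gw_path p z0 (Suc n) = bind_pmf (gw_path p z0 n) (\<lambda>zs. map_pmf (\<lambda>z. zs @ [z]) (gw_step p (last zs)))"

definition ext_prob :: "('d::finite) offspring \<Rightarrow> 'd \<Rightarrow> real" where
  "ext_prob p k = lim (\<lambda>n. measure_pmf.prob (gw_path p (unit_vec k) n) {zs. zs ! n = (\<lambda>_. 0)})"

definition rho_mu :: "('d::finite) offspring \<Rightarrow> real" where
  "rho_mu p = perron_root (dpgf p (ext_prob p))"

definition ext_at :: "nat \<Rightarrow> ('d \<Rightarrow> nat) list set" where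
  "ext_at n = {zs. zs ! n = (\<lambda>_. 0) \<and> (\<forall>l<n. zs ! l \<noteq> (\<lambda>_. 0))}"

definition Phi :: "('d::finite) offspring \<Rightarrow> ('d \<Rightarrow> real) \<Rightarrow> ('d \<Rightarrow> real) \<Rightarrow> nat \<Rightarrow> 'd \<Rightarrow> real" where
  "Phi p t m n j = measure_pmf.expectation (cond_pmf (gw_path p (unit_vec j) n) (ext_at n))
     (\<lambda>zs. exp (- (\<Sum>l\<in>UNIV. t l * real (\<Sum>i\<le>n. (zs ! i) l) / m l)))"

fun hseq :: "('d::finite) offspring \<Rightarrow> ('d \<Rightarrow> real) \<Rightarrow> nat \<Rightarrow> 'd \<Rightarrow> real" where
  "hseq p s 0 = (\<lambda>_. 0)"
| "hseq p s (Suc n) = (\<lambda>k. s k * pgf p (hseq p s n) k)"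

definition hstar :: "('d::finite) offspring \<Rightarrow> ('d \<Rightarrow> real) \<Rightarrow> 'd \<Rightarrow> real" where
  "hstar p s = (\<lambda>k. lim (\<lambda>n. hseq p s n k))"

definition v_hstar :: "('d::finite) offspring \<Rightarrow> ('d \<Rightarrow> real) \<Rightarrow> 'd \<Rightarrow> real" where
  "v_hstar p s = left_pvec (dpgf p (hstar p s))"

definition hfun :: "real \<Rightarrow> real" where
  "hfun x = (x * (1 + exp x) - 2 * (1 - exp x)) / (exp x - 1) ^ 3"

definition dfun :: "real \<Rightarrow> real \<Rightarrow> real" where
  "dfun y x = sqrt (1 + 2 * y / ((1 - x)^2 * hfun (ln x)))"

end

theory Submission
  imports Defs
begin

text \<open>
  Writing \<open>s = exp(-t/m)\<close>, conditioning on \<open>N = n\<close> turns the transform into the quotient of increments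
  \<open>(h\<^sub>n(s) - h\<^sub>n\<^sub>-\<^sub>1(s)) / (h\<^sub>n(1) - h\<^sub>n\<^sub>-\<^sub>1(1))\<close>. Let \<open>\<lambda>(s)\<close> be the Perron root of the linearisation
  \<open>diag(s) M(h*(s))\<close> at the fixed point and \<open>w\<^sub>n\<close> the component of \<open>h*(s) - h\<^sub>n(s)\<close> along its left
  eigenvector. Then \<open>w\<^sub>n\<^sub>+\<^sub>1 = \<lambda> w\<^sub>n - (Q + o(1)) w\<^sub>n\<^sup>2\<close>, so \<open>1/w\<^sub>n\<close> satisfies an asymptotically linear recursion
  and \<open>w\<^sub>n\<close> is asymptotic to \<open>\<lambda>\<^sup>n / (Q G\<^sub>n)\<close> with \<open>G\<^sub>n = 1 + \<lambda> + \<dots> + \<lambda>\<^sup>n\<^sup>-\<^sup>1\<close>. Since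
  \<open>(1 - \<lambda>) G\<^sub>n + \<lambda>\<^sup>n = 1\<close>, the increments are asymptotic to \<open>\<lambda>\<^sup>n / (Q G\<^sub>n\<^sup>2)\<close>, uniformly as \<open>\<lambda> \<rightarrow> 1\<close>.
  It remains to compare roots: \<open>(1 - \<lambda>(s))\<^sup>2 - (1 - \<lambda>(1))\<^sup>2\<close> is asymptotic to \<open>4 Q v'(1 - s)\<close>, and
  \<open>1 - \<lambda>(1)\<close> to \<open>|1 - \<rho>|\<close>. Uniformity over the class is reduced, by passing to subsequences, to
  sequences whose mean matrices and second derivatives converge.
\<close>

section \<open>Perron--Frobenius theory of primitive matrices\<close>

text \<open>The obstacle is that generation and offspring law move together at unrelated speeds.
  Limits are therefore taken along a product filter, and a vector recursion becomes scalar only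
  after its direction is known: crude first-order bounds, a projective contraction, and only then
  the second-order expansion that produces \<open>Q\<close>. The factor 4 Q comes from eliminating
  the gap t between the fixed points at s and at 1. With a = 1 - \<lambda>(s), b = 1 - \<lambda>(1)
  and \<sigma> = v'(1 - s), to leading order a - b = 2 Q t (change of the root) and a t = Q t^2 +
  \<sigma> (fixed point equations), so a^2 - b^2 = 2 Q t (2 a - 2 Q t) = 4 Q \<sigma>. A scale m =
  \<kappa> v makes \<kappa> \<sigma> tend to T. If \<kappa> / n^2 tends to K and n b to c, then n a
  tends to sqrt(c^2 + 4 Q T / K), and the quotient of increments has an explicit limit; the first
  two regimes are choices of K and c. In the third, b dominates: a^2 - b^2 is close to 2 b (a - b),
  n (a - b) tends to T, and a pure exponential remains.\<close>

definition dot :: "('d::finite \<Rightarrow> real) \<Rightarrow> ('d \<Rightarrow> real) \<Rightarrow> real" where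
  "dot x y = (\<Sum>i\<in>UNIV. x i * y i)"

definition mv :: "('d::finite \<Rightarrow> 'd \<Rightarrow> real) \<Rightarrow> ('d \<Rightarrow> real) \<Rightarrow> 'd \<Rightarrow> real" where
  "mv A x i = (\<Sum>j\<in>UNIV. A i j * x j)"

definition tr :: "('d \<Rightarrow> 'd \<Rightarrow> real) \<Rightarrow> 'd \<Rightarrow> 'd \<Rightarrow> real" where
  "tr A i j = A j i"

text \<open>The exponent is \<open>Suc n\<close> because over a one-element index type the zeroth
  power is positive for every matrix, even for zero.\<close>

definition primitive :: "('d::finite \<Rightarrow> 'd \<Rightarrow> real) \<Rightarrow> bool" where
  "primitive A \<longleftrightarrow> (\<forall>i j. 0 \<le> A i j) \<and> (\<exists>n. \<forall>i j. 0 < mat_pow A (Suc n) i j)"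

lemma dot_add_right: "dot x (\<lambda>i. y i + z i) = dot x y + dot x z"
  by (simp add: dot_def algebra_simps sum.distrib)

lemma dot_diff_right: "dot x (\<lambda>i. y i - z i) = dot x y - dot x z"
  by (simp add: dot_def algebra_simps sum_subtractf)

lemma dot_scale_right: "dot x (\<lambda>i. c * y i) = c * dot x y"
  by (simp add: dot_def sum_distrib_left mult_ac)

lemma dot_divide: "dot y (\<lambda>l. z l / c) = dot y z / c"
  using dot_scale_right[of y "inverse c" z] by (simp add: divide_inverse mult.commute)

lemma dot_commute: "dot x y = dot y x"
  by (simp add: dot_def mult.commute)

lemma dot_mono: "(\<And>i. 0 \<le> v i) \<Longrightarrow> (\<And>i. x i \<le> y i) \<Longrightarrow> dot v x \<le> dot v y"
  unfolding dot_def by (intro sum_mono mult_left_mono) auto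

lemma dot_nonneg: "(\<And>i. 0 \<le> v i) \<Longrightarrow> (\<And>i. 0 \<le> x i) \<Longrightarrow> 0 \<le> dot v x"
  unfolding dot_def by (intro sum_nonneg mult_nonneg_nonneg) auto

lemma dot_ge_component:
  assumes "\<And>i. 0 \<le> v i" "\<And>i. 0 \<le> x i"
  shows "v i * x i \<le> dot v x"
  unfolding dot_def by (rule member_le_sum) (auto simp: assms)

lemma dot_pos:
  assumes "\<And>i. 0 < v i" "\<And>i. 0 \<le> x i" "x i \<noteq> 0"
  shows "0 < dot v x"
proof -
  have "0 < v i * x i"
    using assms by (metis mult_pos_pos order_le_less)
  then show ?thesis
    using dot_ge_component[of v x i] assms by (simp add: less_imp_le order_less_le_trans)
qed

lemma dot_eq_0D:
  assumes "\<And>i. 0 < v i" "\<And>i. 0 \<le> x i" "dot v x = 0"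
  shows "x i = 0"
  using dot_pos[of v x i] assms by force

lemma dot_mv: "dot y (mv A x) = dot (mv (tr A) y) x"
proof -
  have "dot y (mv A x) = (\<Sum>i\<in>UNIV. \<Sum>j\<in>UNIV. y i * (A i j * x j))"
    by (simp add: dot_def mv_def sum_distrib_left)
  also have "\<dots> = (\<Sum>j\<in>UNIV. \<Sum>i\<in>UNIV. y i * (A i j * x j))"
    by (rule sum.swap)
  also have "\<dots> = dot (mv (tr A) y) x"
    by (simp add: dot_def mv_def tr_def sum_distrib_right sum_distrib_left mult_ac)
  finally show ?thesis .
qed

lemma mv_diff: "mv A (\<lambda>i. x i - y i) = (\<lambda>i. mv A x i - mv A y i)"
  by (simp add: mv_def fun_eq_iff algebra_simps sum_subtractf)

lemma mv_scale: "mv A (\<lambda>i. c * x i) = (\<lambda>i. c * mv A x i)"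
  by (simp add: mv_def fun_eq_iff sum_distrib_left mult_ac)

lemma mv_mono: "(\<And>i j. 0 \<le> A i j) \<Longrightarrow> (\<And>i. x i \<le> y i) \<Longrightarrow> mv A x i \<le> mv A y i"
  unfolding mv_def by (intro sum_mono mult_left_mono) auto

lemma mv_nonneg: "(\<And>i j. 0 \<le> A i j) \<Longrightarrow> (\<And>i. 0 \<le> x i) \<Longrightarrow> 0 \<le> mv A x i"
  unfolding mv_def by (intro sum_nonneg mult_nonneg_nonneg) auto

lemma mv_pos:
  assumes "\<And>i j. 0 < A i j" "\<And>i. 0 \<le> x i" "x j \<noteq> 0"
  shows "0 < mv A x i"
  using dot_pos[of "A i" x j] assms by (simp add: dot_def mv_def)

lemma mv_mat_mult: "mv (mat_mult A B) x = mv A (mv B x)"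
proof
  fix i
  have "mv (mat_mult A B) x i = (\<Sum>j\<in>UNIV. \<Sum>l\<in>UNIV. A i l * B l j * x j)"
    by (simp add: mv_def mat_mult_def sum_distrib_right)
  also have "\<dots> = (\<Sum>l\<in>UNIV. \<Sum>j\<in>UNIV. A i l * B l j * x j)"
    by (rule sum.swap)
  also have "\<dots> = mv A (mv B x) i"
    by (simp add: mv_def sum_distrib_left mult_ac)
  finally show "mv (mat_mult A B) x i = mv A (mv B x) i" .
qed

lemma mat_mult_assoc: "mat_mult (mat_mult A B) C = mat_mult A (mat_mult B C)"
proof (intro ext)
  fix i j
  have "mat_mult (mat_mult A B) C i j = mv (mat_mult A B) (\<lambda>l. C l j) i"
    by (simp add: mv_def mat_mult_def)
  also have "\<dots> = mv A (mv B (\<lambda>l. C l j)) i"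
    by (simp add: mv_mat_mult)
  also have "\<dots> = mat_mult A (mat_mult B C) i j"
    by (simp add: mv_def mat_mult_def)
  finally show "mat_mult (mat_mult A B) C i j = mat_mult A (mat_mult B C) i j" .
qed

lemma mat_mult_one [simp]:
  "mat_mult A (\<lambda>i j. if i = j then 1 else 0) = A"
  "mat_mult (\<lambda>i j. if i = j then 1 else 0) A = A"
  by (simp_all add: mat_mult_def fun_eq_iff if_distrib[of "\<lambda>x. _ * x"]
      if_distrib[of "\<lambda>x. x * _"] sum.delta sum.delta' cong: if_cong)

lemma mat_pow_Suc': "mat_pow A (Suc n) = mat_mult A (mat_pow A n)"
proof (induction n)
  case (Suc n)
  have "mat_pow A (Suc (Suc n)) = mat_mult (mat_mult A (mat_pow A n)) A"
    by (metis Suc mat_pow.simps(2))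
  then show ?case
    by (simp add: mat_mult_assoc)
qed simp

lemma tr_mat_mult: "tr (mat_mult A B) = mat_mult (tr B) (tr A)"
  by (simp add: tr_def mat_mult_def fun_eq_iff mult.commute)

lemma tr_mat_pow: "tr (mat_pow A n) = mat_pow (tr A) n"
proof (induction n)
  case 0
  show ?case by (auto simp: tr_def fun_eq_iff)
next
  case (Suc n)
  have "tr (mat_pow A (Suc n)) = mat_mult (tr A) (tr (mat_pow A n))"
    by (simp add: tr_mat_mult)
  then show ?case
    by (simp add: Suc mat_pow_Suc' del: mat_pow.simps(2))
qed

lemma primitive_tr: "primitive A \<Longrightarrow> primitive (tr A)"
  unfolding primitive_def tr_mat_pow[symmetric] tr_def by blast

lemma mv_mat_pow_eigen:
  assumes "mv A x = (\<lambda>i. l * x i)"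
  shows "mv (mat_pow A n) x = (\<lambda>i. l ^ n * x i)"
proof (induction n)
  case 0
  show ?case
    by (simp add: mv_def fun_eq_iff if_distrib[of "\<lambda>x. x * _"] sum.delta cong: if_cong)
next
  case (Suc n)
  show ?case
    by (simp add: mv_mat_mult assms mv_scale Suc mult_ac)
qed

text \<open>A vector killed by \<open>A\<close> is an eigenvector for the eigenvalue 0, hence killed
  by every power \<open>Suc n\<close>, one of which is entrywise positive.\<close>

lemma primitive_mv_nonzero:
  assumes A: "primitive A" and x: "\<And>i. 0 \<le> x i" "x j \<noteq> 0"
  shows "\<exists>i. mv A x i \<noteq> 0"
proof (rule ccontr)
  assume "\<not> ?thesis"
  then have "mv A x = (\<lambda>i. 0 * x i)" by auto
  moreover obtain n where "\<And>i j. 0 < mat_pow A (Suc n) i j"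
    using A unfolding primitive_def by blast
  ultimately show False
    using mv_mat_pow_eigen[of A x 0 "Suc n"] mv_pos[of "mat_pow A (Suc n)" x j j] x by simp
qed

text \<open>A positive power of \<open>A\<close> sends \<open>x\<close> to the strictly positive
  vector with entries \<open>l ^ Suc n * x i\<close>; this excludes both zero entries and
  \<open>l = 0\<close>.\<close>

lemma primitive_eigenvector_pos:
  assumes A: "primitive A" and x: "\<And>i. 0 \<le> x i" "x j \<noteq> 0" and e: "mv A x = (\<lambda>i. l * x i)"
  shows "0 < l" "0 < x i"
proof -
  obtain n where n: "\<And>i j. 0 < mat_pow A (Suc n) i j"
    using A unfolding primitive_def by blast
  have pos: "0 < l ^ Suc n * x i" for i
    using mv_mat_pow_eigen[OF e, of "Suc n"] mv_pos[of "mat_pow A (Suc n)" x j i] n x by simp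
  show "0 < x i"
    using pos[of i] x(1)[of i] by (metis mult_zero_right order_le_less order_less_irrefl)
  have "0 \<le> mv A x i"
    using A x by (auto simp: primitive_def intro: mv_nonneg)
  then have "0 \<le> l"
    using \<open>0 < x i\<close> by (simp add: e zero_le_mult_iff)
  then show "0 < l"
    using pos[of i] by (cases "l = 0") auto
qed

text \<open>Brouwer's theorem for the normalised map \<open>A x / sum (A x)\<close> on the simplex,
  transported to \<open>real^'d\<close>. Primitivity keeps the denominator nonzero and makes the
  fixed point positive.\<close>

lemma primitive_eigenvector_exists:
  fixes A :: "'d::finite \<Rightarrow> 'd \<Rightarrow> real"
  assumes A: "primitive A"
  shows "\<exists>l u. 0 < l \<and> (\<forall>i. 0 < u i) \<and> mv A u = (\<lambda>i. l * u i) \<and> (\<Sum>i\<in>UNIV. u i) = 1"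
proof -
  let ?S = "{x :: real^'d. (\<forall>i. 0 \<le> x $ i) \<and> (\<Sum>i\<in>UNIV. x $ i) = 1}"
  let ?s = "\<lambda>x :: real^'d. (\<Sum>i\<in>UNIV. mv A (($) x) i)"
  let ?f = "\<lambda>x :: real^'d. (\<chi> i. mv A (($) x) i / ?s x) :: real^'d"
  have nonneg: "0 \<le> mv A (($) x) i" if "x \<in> ?S" for x i
    using A that by (auto simp: primitive_def intro: mv_nonneg)
  have spos: "0 < ?s x" if "x \<in> ?S" for x
  proof -
    have "\<not> (\<forall>j. x $ j = 0)"
    proof
      assume "\<forall>j. x $ j = 0"
      then show False using that by simp
    qed
    then obtain j where "x $ j \<noteq> 0" by blast
    moreover have "\<And>i. 0 \<le> x $ i" using that by simp
    ultimately obtain i where "mv A (($) x) i \<noteq> 0"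
      using primitive_mv_nonzero[OF A, of "($) x" j] by blast
    then have "0 < mv A (($) x) i"
      using nonneg[OF that] by (metis order_le_less)
    then show ?thesis
      using nonneg[OF that] by (meson UNIV_I finite sum_pos2)
  qed
  have "closed ?S"
  proof -
    have "?S = (\<Inter>i. {x. 0 \<le> x $ i}) \<inter> {x. (\<Sum>i\<in>UNIV. x $ i) = 1}" by auto
    then show ?thesis
      by (auto intro!: closed_Inter closed_Int closed_Collect_le closed_Collect_eq continuous_intros)
  qed
  moreover have "bounded ?S"
  proof (rule boundedI)
    fix x :: "real^'d" assume "x \<in> ?S"
    then show "norm x \<le> 1"
      using norm_le_l1_cart[of x] by simp
  qed
  ultimately have "compact ?S"
    by (simp add: compact_eq_bounded_closed)
  moreover have "convex ?S"
    by (auto simp: convex_def sum.distrib simp flip: sum_distrib_left)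
  moreover have "?S \<noteq> {}"
  proof -
    have "(\<chi> i. 1 / real CARD('d)) \<in> ?S" by simp
    then show ?thesis by blast
  qed
  moreover have "continuous_on ?S ?f"
    unfolding mv_def
    by (intro continuous_intros continuous_on_vec_lambda) (use spos in \<open>force simp: mv_def\<close>)
  moreover have "?f \<in> ?S \<rightarrow> ?S"
    using nonneg spos by (auto simp: less_imp_le simp flip: sum_divide_distrib) (smt (verit) divide_eq_1_iff)+
  ultimately obtain x where x: "x \<in> ?S" "?f x = x"
    using brouwer[of ?S ?f] by blast
  have e: "mv A (($) x) = (\<lambda>i. ?s x * x $ i)"
  proof
    fix i
    have "mv A (($) x) i / ?s x = x $ i"
      using x(2) by (metis (no_types, lifting) vec_lambda_beta)
    then show "mv A (($) x) i = ?s x * x $ i"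
      using spos[OF x(1)] by (simp add: field_simps)
  qed
  obtain j where "x $ j \<noteq> 0"
    using x(1) by force
  then have "\<forall>i. 0 < x $ i"
    using primitive_eigenvector_pos[OF A, of "($) x"] x(1) e by auto
  with spos[OF x(1)] e x(1) show ?thesis by blast
qed

text \<open>\<open>perron_root\<close> is a \<open>Max\<close>, meaningful only over a finite set.
  Eigenvalues are roots of the characteristic polynomial, and a single non-eigenvalue
  \<open>z0\<close> certifies that this polynomial is nonzero.\<close>

lemma finite_complex_spectrum:
  fixes A :: "'d::finite \<Rightarrow> 'd \<Rightarrow> complex"
  assumes z0: "\<And>x. (\<And>i. (\<Sum>j\<in>UNIV. A i j * x j) = z0 * x i) \<Longrightarrow> (\<forall>i. x i = 0)"
  shows "finite {z. \<exists>x. (\<exists>i. x i \<noteq> 0) \<and> (\<forall>i. (\<Sum>j\<in>UNIV. A i j * x j) = z * x i)}"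
proof -
  let ?N = "\<lambda>z. (\<chi> i j. A i j - (if i = j then z else 0)) :: complex^'d^'d"
  \<comment> \<open>Leibniz formula with linear polynomials as entries, so that evaluation at z
    gives det (A - z I).\<close>
  define P where "P = (\<Sum>p | p permutes (UNIV :: 'd set).
      [:of_int (sign p):] * (\<Prod>i\<in>UNIV. [:A i (p i), if i = p i then -1 else 0:]))"
  have P: "poly P z = det (?N z)" for z
    unfolding P_def det_def
    by (auto simp: poly_sum poly_prod intro!: sum.cong prod.cong arg_cong2[of _ _ _ _ "(*)"])
  have Nv: "(?N z *v x) $ i = (\<Sum>j\<in>UNIV. A i j * x $ j) - z * x $ i" for z x i
    by (simp add: matrix_vector_mult_def algebra_simps sum_subtractf
        if_distrib[of "\<lambda>y. _ * y"] sum.delta cong: if_cong)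
  have "det (?N z) \<noteq> 0 \<longleftrightarrow> (\<forall>x. ?N z *v x = 0 \<longrightarrow> x = 0)" for z
    using invertible_det_nz[of "?N z"]
    unfolding invertible_left_inverse matrix_left_invertible_ker by blast
  then have det0: "det (?N z) \<noteq> 0 \<longleftrightarrow> (\<forall>x::complex^'d. (\<forall>i. (\<Sum>j\<in>UNIV. A i j * x $ j) = z * x $ i) \<longrightarrow> x = 0)" for z
    by (simp add: vec_eq_iff Nv)
  have "poly P z0 \<noteq> 0"
    unfolding P det0 using z0 by (auto simp: vec_eq_iff)
  then have "P \<noteq> 0" by auto
  then have fin: "finite {z. poly P z = 0}"
    by (rule poly_roots_finite)
  have "{z. \<exists>x. (\<exists>i. x i \<noteq> 0) \<and> (\<forall>i. (\<Sum>j\<in>UNIV. A i j * x j) = z * x i)} \<subseteq> {z. poly P z = 0}"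
  proof clarify
    fix z x i assume x: "x i \<noteq> 0" "\<forall>i. (\<Sum>j\<in>UNIV. A i j * x j) = z * x i"
    let ?x = "(\<chi> i. x i) :: complex^'d"
    have "\<forall>i. (\<Sum>j\<in>UNIV. A i j * ?x $ j) = z * ?x $ i" "?x \<noteq> 0"
      using x by (auto simp: vec_eq_iff)
    then show "poly P z = 0"
      using det0[of z] unfolding P by blast
  qed
  then show ?thesis
    using fin finite_subset by blast
qed

text \<open>Compare the moduli of \<open>x\<close> with the least multiple \<open>c * u\<close>
  dominating them; at an index \<open>m\<close> where the two touch, the triangle inequality bounds
  \<open>cmod z * c * u m\<close> by \<open>l * c * u m\<close>.\<close>

lemma spectrum_le_of_pos_eigenvector:
  fixes A :: "'d::finite \<Rightarrow> 'd \<Rightarrow> real" and x :: "'d \<Rightarrow> complex"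
  assumes A: "\<And>i j. 0 \<le> A i j" and u: "\<And>i. 0 < u i" "mv A u = (\<lambda>i. l * u i)"
    and x: "x k \<noteq> 0" "\<And>i. (\<Sum>j\<in>UNIV. complex_of_real (A i j) * x j) = z * x i"
  shows "cmod z \<le> l"
proof -
  define c where "c = Max (range (\<lambda>i. cmod (x i) / u i))"
  have le: "cmod (x i) \<le> c * u i" for i
  proof -
    have "cmod (x i) / u i \<le> c" unfolding c_def by (intro Max_ge) auto
    then show ?thesis using u(1)[of i] by (simp add: field_simps)
  qed
  have "c \<in> range (\<lambda>i. cmod (x i) / u i)"
    unfolding c_def by (intro Max_in) auto
  then obtain m where "c = cmod (x m) / u m" by blast
  then have m: "cmod (x m) = c * u m"
    using u(1)[of m] by simp
  have "0 < cmod (x k)" using x(1) by simp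
  then have "0 < c"
    using le[of k] u(1)[of k] by (smt (verit) zero_less_mult_pos2)
  have "cmod z * cmod (x m) = cmod (\<Sum>j\<in>UNIV. complex_of_real (A m j) * x j)"
    by (simp add: x(2) norm_mult)
  also have "\<dots> \<le> (\<Sum>j\<in>UNIV. A m j * cmod (x j))"
    by (rule norm_sum[THEN order_trans]) (simp add: norm_mult A)
  also have "\<dots> \<le> (\<Sum>j\<in>UNIV. A m j * (c * u j))"
    by (intro sum_mono mult_left_mono le A)
  also have "\<dots> = c * mv A u m"
    by (simp add: mv_def sum_distrib_left mult_ac)
  also have "\<dots> = l * cmod (x m)"
    by (simp add: u(2) m)
  finally show ?thesis
    using \<open>0 < c\<close> u(1)[of m] by (simp add: m)
qed

text \<open>The bound \<open>l\<close> on all moduli is attained by \<open>u\<close> itself, and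
  \<open>l + 1\<close> serves as the non-eigenvalue that gives finiteness.\<close>

lemma perron_root_eq:
  fixes A :: "'d::finite \<Rightarrow> 'd \<Rightarrow> real"
  assumes A: "\<And>i j. 0 \<le> A i j" and u: "\<And>i. 0 < u i" "mv A u = (\<lambda>i. l * u i)" and l: "0 \<le> l"
  shows "perron_root A = l"
proof -
  let ?E = "{z. \<exists>x :: 'd \<Rightarrow> complex. (\<exists>i. x i \<noteq> 0) \<and>
       (\<forall>i. (\<Sum>j\<in>UNIV. complex_of_real (A i j) * x j) = z * x i)}"
  have bnd: "cmod z \<le> l" if "z \<in> ?E" for z
    using that spectrum_le_of_pos_eigenvector[of A u l] A u by blast
  have "finite ?E"
  proof (rule finite_complex_spectrum[where ?z0.0 = "of_real (l + 1)"])
    fix x :: "'d \<Rightarrow> complex"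
    assume "\<And>i. (\<Sum>j\<in>UNIV. complex_of_real (A i j) * x j) = of_real (l + 1) * x i"
    then show "\<forall>i. x i = 0"
      using spectrum_le_of_pos_eigenvector[OF A u, of x _ "of_real (l + 1)"] l
      by (metis abs_of_nonneg add_nonneg_nonneg less_add_one linorder_not_less norm_of_real zero_le_one)
  qed
  then have fin: "finite (cmod ` ?E)" by simp
  have "complex_of_real l \<in> ?E"
  proof (intro CollectI exI conjI allI)
    show "complex_of_real (u undefined) \<noteq> 0" using u(1)[of undefined] by simp
    fix i
    have "complex_of_real (mv A u i) = of_real l * of_real (u i)" by (simp add: u(2))
    then show "(\<Sum>j\<in>UNIV. complex_of_real (A i j) * of_real (u j)) = of_real l * of_real (u i)"
      by (simp add: mv_def)
  qed
  then have "l \<in> cmod ` ?E"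
    using l by (metis (no_types, lifting) abs_of_nonneg image_eqI norm_of_real)
  then have "Max (cmod ` ?E) = l"
    using fin bnd by (intro Max_eqI) auto
  then show ?thesis
    by (simp only: perron_root_def setcompr_eq_image)
qed

text \<open>Pairing with a positive left eigenvector forces equal eigenvalues. Then remove the
  largest multiple of \<open>u\<close> that keeps \<open>x\<close> nonnegative: the remainder has a
  zero entry, which a nonzero eigenvector of this kind cannot have.\<close>

lemma primitive_eigen_unique:
  fixes A :: "'d::finite \<Rightarrow> 'd \<Rightarrow> real"
  assumes A: "primitive A"
    and u: "\<And>i. 0 < u i" "mv A u = (\<lambda>i. l * u i)"
    and x: "\<And>i. 0 \<le> x i" "x m \<noteq> 0" "mv A x = (\<lambda>i. k * x i)"
  shows "k = l \<and> (\<exists>c>0. \<forall>i. x i = c * u i)"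
proof -
  obtain k' v where v: "\<And>i. 0 < v i" "mv (tr A) v = (\<lambda>i. k' * v i)"
    using primitive_eigenvector_exists[OF primitive_tr[OF A]] by blast
  have eq: "\<kappa> = k'" if "\<And>i. 0 < y i" "mv A y = (\<lambda>i. \<kappa> * y i)" for y \<kappa>
  proof -
    have "dot v (mv A y) = dot (mv (tr A) v) y" by (rule dot_mv)
    then have "\<kappa> * dot v y = k' * dot v y"
      by (simp add: that v(2) dot_scale_right) (simp add: dot_commute[of _ y] dot_scale_right)
    moreover have "0 < dot v y"
      using that v by (intro dot_pos[of v y undefined]) (auto simp: less_imp_le, metis less_irrefl)
    ultimately show ?thesis by simp
  qed
  have xpos: "\<And>i. 0 < x i"
    using primitive_eigenvector_pos(2)[OF A x] .
  have kl: "k = l"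
    using eq[OF u] eq[OF xpos x(3)] by simp
  define c where "c = Min (range (\<lambda>i. x i / u i))"
  have le: "c * u i \<le> x i" for i
  proof -
    have "c \<le> x i / u i" unfolding c_def by (intro Min_le) auto
    then show ?thesis using u(1)[of i] by (simp add: field_simps)
  qed
  have "c \<in> range (\<lambda>i. x i / u i)"
    unfolding c_def by (intro Min_in) auto
  then obtain n where "c = x n / u n" by blast
  then have n: "x n - c * u n = 0" "0 < c"
    using u(1)[of n] xpos[of n] by auto
  have "x i - c * u i = 0" for i
  proof (rule ccontr)
    assume i: "x i - c * u i \<noteq> 0"
    have "mv A (\<lambda>i. x i - c * u i) = (\<lambda>i. l * (x i - c * u i))"
      by (simp add: mv_diff mv_scale x u kl algebra_simps)
    then have "0 < x n - c * u n"
      using primitive_eigenvector_pos(2)[OF A, of "\<lambda>i. x i - c * u i" i l n] le i by auto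
    then show False using n by simp
  qed
  then show ?thesis using kl n(2) by auto
qed

text \<open>Discharges the \<open>Max\<close> and the \<open>THE\<close> in the definitions of the
  Perron data. Uniqueness is stated for an arbitrary eigenvalue \<open>k\<close> so that limits of
  eigenvectors can be identified.\<close>

lemma
  fixes A :: "'d::finite \<Rightarrow> 'd \<Rightarrow> real"
  assumes A: "primitive A"
  shows right_pvec_pos: "0 < right_pvec A i"
    and right_pvec_sum: "(\<Sum>i\<in>UNIV. right_pvec A i) = 1"
    and right_pvec_eigen: "mv A (right_pvec A) = (\<lambda>i. perron_root A * right_pvec A i)"
    and left_pvec_pos: "0 < left_pvec A i"
    and left_right_pvec: "dot (left_pvec A) (right_pvec A) = 1"
    and left_pvec_eigen: "mv (tr A) (left_pvec A) = (\<lambda>i. perron_root A * left_pvec A i)"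
    and right_pvec_unique: "\<lbrakk>\<And>i. 0 \<le> x i; mv A x = (\<lambda>i. k * x i); (\<Sum>i\<in>UNIV. x i) = 1\<rbrakk>
           \<Longrightarrow> k = perron_root A \<and> x = right_pvec A"
    and left_pvec_unique: "\<lbrakk>\<And>i. 0 \<le> x i; mv (tr A) x = (\<lambda>i. k * x i); dot (right_pvec A) x = 1\<rbrakk>
           \<Longrightarrow> k = perron_root A \<and> x = left_pvec A"
proof -
  have A0: "\<And>i j. 0 \<le> A i j" using A by (simp add: primitive_def)
  obtain l u where u: "0 < l" "\<And>i. 0 < u i" "mv A u = (\<lambda>i. l * u i)" "(\<Sum>i\<in>UNIV. u i) = 1"
    using primitive_eigenvector_exists[OF A] by blast
  have l: "perron_root A = l"
    using perron_root_eq[of A u l] A0 u by auto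
  have uniq: "k = l \<and> x = u"
    if x: "\<And>i. 0 \<le> x i" "mv A x = (\<lambda>i. k * x i)" "(\<Sum>i\<in>UNIV. x i) = 1" for x k
  proof -
    obtain m where "x m \<noteq> 0" using x(3) by force
    then obtain c where c: "k = l" "\<And>i. x i = c * u i"
      using primitive_eigen_unique[OF A u(2,3) x(1) _ x(2)] by blast
    then have "c = 1"
      using x(3) u(4) by (simp flip: sum_distrib_left)
    then show ?thesis using c by auto
  qed
  have ru: "right_pvec A = u"
    unfolding right_pvec_def l
  proof (rule the_equality)
    show "(\<forall>i. 0 \<le> u i) \<and> (\<forall>i. (\<Sum>j\<in>UNIV. A i j * u j) = l * u i) \<and> sum u UNIV = 1"
      using u by (simp add: less_imp_le fun_eq_iff mv_def)
  qed (use uniq in \<open>auto simp: mv_def fun_eq_iff\<close>)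
  obtain k0 w where w: "0 < k0" "\<And>i. 0 < w i" "mv (tr A) w = (\<lambda>i. k0 * w i)"
    using primitive_eigenvector_exists[OF primitive_tr[OF A]] by blast
  have uw: "0 < dot u w"
    using u w by (intro dot_pos[of u w undefined]) (auto simp: less_imp_le, metis less_irrefl)
  define v where "v = (\<lambda>i. inverse (dot u w) * w i)"
  have v: "\<And>i. 0 < v i" "mv (tr A) v = (\<lambda>i. k0 * v i)" "dot u v = 1"
    using w uw unfolding v_def mv_scale dot_scale_right by (auto simp: mult_ac)
  \<comment> \<open>Evaluating v'Au from both sides identifies the left eigenvalue with the right
    one, since v'u = 1.\<close>
  have uv0: "dot v (mv A u) = dot (mv (tr A) v) u" by (rule dot_mv)
  then have kl: "k0 = l"
    by (simp add: u v dot_scale_right dot_commute[of _ u])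
  have luniq: "k' = l \<and> x = v"
    if x: "\<And>i. 0 \<le> x i" "mv (tr A) x = (\<lambda>i. k' * x i)" "dot u x = 1" for x k'
  proof -
    obtain m where "x m \<noteq> 0" using x(3) by (force simp: dot_def)
    then obtain c where c: "k' = k0" "\<And>i. x i = c * v i"
      using primitive_eigen_unique[OF primitive_tr[OF A] v(1,2) x(1) _ x(2)] by blast
    have "x = (\<lambda>i. c * v i)" using c by auto
    then have "c = 1" using x(3) v(3) by (simp add: dot_scale_right)
    then show ?thesis using c kl by auto
  qed
  have lv: "left_pvec A = v"
    unfolding left_pvec_def l ru
  proof (rule the_equality)
    show "(\<forall>i. 0 \<le> v i) \<and> (\<forall>j. (\<Sum>i\<in>UNIV. v i * A i j) = l * v j) \<and> (\<Sum>i\<in>UNIV. u i * v i) = 1"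
      using v kl by (simp add: less_imp_le fun_eq_iff mv_def tr_def dot_def mult.commute)
  qed (use luniq in \<open>auto simp: mv_def fun_eq_iff tr_def dot_def mult.commute\<close>)
  show "0 < right_pvec A i" "(\<Sum>i\<in>UNIV. right_pvec A i) = 1"
    "mv A (right_pvec A) = (\<lambda>i. perron_root A * right_pvec A i)" "0 < left_pvec A i"
    "dot (left_pvec A) (right_pvec A) = 1"
    "mv (tr A) (left_pvec A) = (\<lambda>i. perron_root A * left_pvec A i)"
    using u v kl by (auto simp: l ru lv dot_commute[of v u])
  show "\<lbrakk>\<And>i. 0 \<le> x i; mv A x = (\<lambda>i. k * x i); (\<Sum>i\<in>UNIV. x i) = 1\<rbrakk>
           \<Longrightarrow> k = perron_root A \<and> x = right_pvec A"
    unfolding l ru by (rule uniq)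
  show "\<lbrakk>\<And>i. 0 \<le> x i; mv (tr A) x = (\<lambda>i. k * x i); dot (right_pvec A) x = 1\<rbrakk>
           \<Longrightarrow> k = perron_root A \<and> x = left_pvec A"
    unfolding l ru lv by (rule luniq)
qed

section \<open>Limits of matrices and double sequences\<close>

lemma tendsto_dot:
  assumes "\<And>l. ((\<lambda>n. x n l) \<longlongrightarrow> x' l) F" "\<And>l. ((\<lambda>n. y n l) \<longlongrightarrow> y' l) F"
  shows "((\<lambda>n. dot (x n) (y n)) \<longlongrightarrow> dot x' y') F"
  unfolding dot_def by (intro tendsto_intros assms)

lemma tendsto_mv:
  assumes "\<And>i j. ((\<lambda>n. A n i j) \<longlongrightarrow> A' i j) F" "\<And>l. ((\<lambda>n. y n l) \<longlongrightarrow> y' l) F"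
  shows "((\<lambda>n. mv (A n) (y n) i) \<longlongrightarrow> mv A' y' i) F"
  unfolding mv_def by (intro tendsto_intros assms)

lemma tendsto_mat_pow:
  assumes "\<And>i j. ((\<lambda>n. A n i j) \<longlongrightarrow> A' i j) F"
  shows "((\<lambda>n. mat_pow (A n) m i j) \<longlongrightarrow> mat_pow A' m i j) F"
proof (induction m arbitrary: i j)
  case (Suc m)
  show ?case
    unfolding mat_pow.simps mat_mult_def by (intro tendsto_intros assms Suc)
qed simp

text \<open>Lets compactness replace explicit uniform estimates: it suffices to treat subsequences
  along which finitely many parameters converge.\<close>

lemma tendsto_if_subseq:
  fixes X :: "nat \<Rightarrow> 'a :: metric_space"
  assumes "\<And>r :: nat \<Rightarrow> nat. strict_mono r \<Longrightarrow> \<exists>q. strict_mono q \<and> (\<lambda>n. X (r (q n))) \<longlonglongrightarrow> L"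
  shows "X \<longlonglongrightarrow> L"
proof (rule ccontr)
  assume "\<not> X \<longlonglongrightarrow> L"
  then obtain e where e: "0 < e" "\<And>N. \<exists>n\<ge>N. e \<le> dist (X n) L"
    unfolding lim_sequentially by (meson linorder_not_less)
  have "infinite {n. e \<le> dist (X n) L}"
    using e(2) by (auto simp: infinite_nat_iff_unbounded_le)
  then obtain r :: "nat \<Rightarrow> nat" where r: "strict_mono r" "\<And>n. e \<le> dist (X (r n)) L"
    using infinite_enumerate[of "{n. e \<le> dist (X n) L}"] by auto
  obtain q where "(\<lambda>n. X (r (q n))) \<longlonglongrightarrow> L"
    using assms[OF r(1)] by blast
  then obtain n where "dist (X (r (q n))) L < e"
    using e(1) unfolding lim_sequentially by blast
  then show False
    using r(2)[of "q n"] by simp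
qed

lemma bounded_fun_convergent_subseq:
  fixes X :: "nat \<Rightarrow> 'i::finite \<Rightarrow> real"
  assumes "\<And>n i. \<bar>X n i\<bar> \<le> C"
  obtains r L where "strict_mono r" "\<And>i. (\<lambda>n. X (r n) i) \<longlonglongrightarrow> L i"
proof -
  define Y where "Y n = (\<chi> i. X n i)" for n
  have "bounded (range Y)"
  proof (rule boundedI)
    fix y assume "y \<in> range Y"
    then obtain n where n: "y = Y n" by blast
    have "norm (Y n) \<le> (\<Sum>i\<in>UNIV. \<bar>X n i\<bar>)"
      using norm_le_l1_cart[of "Y n"] by (simp add: Y_def)
    also have "\<dots> \<le> (\<Sum>i\<in>(UNIV :: 'i set). C)"
      by (intro sum_mono assms)
    finally show "norm y \<le> (\<Sum>i\<in>(UNIV :: 'i set). C)" using n by simp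
  qed
  then obtain l r where "strict_mono r" "(Y \<circ> r) \<longlonglongrightarrow> l"
    using bounded_imp_convergent_subsequence by blast
  moreover from this have "(\<lambda>n. X (r n) i) \<longlonglongrightarrow> l $ i" for i
    using tendsto_vec_nth[of "Y \<circ> r" l sequentially i] by (simp add: Y_def o_def)
  ultimately show ?thesis using that by blast
qed

text \<open>Strict positivity of one fixed power is an open condition on the matrix.\<close>

lemma eventually_primitive:
  fixes A :: "nat \<Rightarrow> 'd::finite \<Rightarrow> 'd \<Rightarrow> real"
  assumes A: "\<And>i j. (\<lambda>k. A k i j) \<longlonglongrightarrow> B i j" "primitive B" "\<And>k i j. 0 \<le> A k i j"
  shows "\<forall>\<^sub>F k in sequentially. primitive (A k)"
proof -
  obtain n where n: "\<And>i j. 0 < mat_pow B (Suc n) i j"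
    using A(2) unfolding primitive_def by blast
  have "\<forall>\<^sub>F k in sequentially. \<forall>i j. 0 < mat_pow (A k) (Suc n) i j"
    by (intro eventually_all_finite order_tendstoD(1)[OF tendsto_mat_pow[OF A(1)] n])
  then show ?thesis
    by eventually_elim (use A(3) in \<open>auto simp: primitive_def\<close>)
qed

text \<open>Normalised eigenvectors stay in a compact simplex, and each subsequential limit is a
  normalised nonnegative eigenvector of \<open>B\<close>, hence unique. Convergence of the roots is
  not presupposed: a root is the entry sum of the matrix applied to its eigenvector.\<close>

lemma tendsto_right_pvec:
  fixes A :: "nat \<Rightarrow> 'd::finite \<Rightarrow> 'd \<Rightarrow> real"
  assumes A: "\<And>i j. (\<lambda>k. A k i j) \<longlonglongrightarrow> B i j" and B: "primitive B" and nn: "\<And>k i j. 0 \<le> A k i j"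
  shows "(\<lambda>k. right_pvec (A k) i) \<longlonglongrightarrow> right_pvec B i"
proof -
  obtain k0 where k0: "\<And>k. k \<ge> k0 \<Longrightarrow> primitive (A k)"
    using eventually_primitive[OF A B nn] unfolding eventually_sequentially by blast
  have root: "perron_root (A k) = (\<Sum>i\<in>UNIV. mv (A k) (right_pvec (A k)) i)" if "k \<ge> k0" for k
    using right_pvec_eigen[OF k0[OF that]] right_pvec_sum[OF k0[OF that]]
    by (simp flip: sum_distrib_left)
  \<comment> \<open>Primitivity holds only from \<open>k0\<close> on, so subsequences are shifted by
    \<open>k0\<close>; this absorbs the shift into the index map.\<close>
  have lim_mono: "(\<lambda>n. Z (r (q n + k0))) \<longlonglongrightarrow> L \<Longrightarrow> strict_mono r \<Longrightarrow> strict_mono q \<Longrightarrow>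
       \<exists>q. strict_mono q \<and> (\<lambda>n. Z (r (q n))) \<longlonglongrightarrow> L"
    for Z :: "nat \<Rightarrow> real" and r q :: "nat \<Rightarrow> nat" and L
    by (rule exI[of _ "\<lambda>n. q n + k0"]) (simp add: strict_mono_def)
  have sub: "(\<lambda>n. A (r (q n + k0)) i j) \<longlonglongrightarrow> B i j"
    if "strict_mono r" "strict_mono q" for r q :: "nat \<Rightarrow> nat" and i j
  proof -
    have "strict_mono (\<lambda>n. r (q n + k0))"
      using that by (simp add: strict_mono_def)
    then show ?thesis
      using LIMSEQ_subseq_LIMSEQ[OF A] by (simp add: o_def)
  qed
  have ge: "r (q n + k0) \<ge> k0" if "strict_mono r" for r q :: "nat \<Rightarrow> nat" and n
    using seq_suble[OF that, of "q n + k0"] by linarith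
  show ?thesis
  proof (rule tendsto_if_subseq)
    fix r :: "nat \<Rightarrow> nat" assume r: "strict_mono r"
    have "\<bar>right_pvec (A (r (n + k0))) i\<bar> \<le> 1" for n i
    proof -
      have P: "primitive (A (r (n + k0)))"
        using k0 ge[OF r, of "\<lambda>n. n"] by blast
      have "right_pvec (A (r (n + k0))) i \<le> (\<Sum>i\<in>UNIV. right_pvec (A (r (n + k0))) i)"
        by (rule member_le_sum) (auto intro: less_imp_le right_pvec_pos[OF P])
      then show ?thesis
        using right_pvec_pos[OF P, of i] by (simp add: right_pvec_sum[OF P])
    qed
    then obtain q u where q: "strict_mono q"
      and u: "\<And>i. (\<lambda>n. right_pvec (A (r (q n + k0))) i) \<longlonglongrightarrow> u i"
      using bounded_fun_convergent_subseq[of "\<lambda>n. right_pvec (A (r (n + k0)))" 1] by blast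
    have P: "primitive (A (r (q n + k0)))" for n
      using k0 ge[OF r] by blast
    have "0 \<le> u i" for i
      by (rule LIMSEQ_le_const[OF u]) (use right_pvec_pos[OF P] in \<open>auto intro: less_imp_le\<close>)
    moreover have s1: "(\<Sum>i\<in>UNIV. u i) = 1"
    proof -
      have "(\<lambda>n. \<Sum>i\<in>UNIV. right_pvec (A (r (q n + k0))) i) \<longlonglongrightarrow> (\<Sum>i\<in>UNIV. u i)"
        by (intro tendsto_intros u)
      then show ?thesis
        by (simp add: right_pvec_sum[OF P] LIMSEQ_const_iff)
    qed
    moreover have "mv B u = (\<lambda>i. (\<Sum>i\<in>UNIV. mv B u i) * u i)"
    proof
      fix i
      have l1: "(\<lambda>n. mv (A (r (q n + k0))) (right_pvec (A (r (q n + k0)))) i) \<longlonglongrightarrow> mv B u i" for i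
        by (rule tendsto_mv[OF sub[OF r q] u])
      have "(\<lambda>n. (\<Sum>i\<in>UNIV. mv (A (r (q n + k0))) (right_pvec (A (r (q n + k0)))) i) *
          right_pvec (A (r (q n + k0))) i) \<longlonglongrightarrow> (\<Sum>i\<in>UNIV. mv B u i) * u i"
        by (intro tendsto_intros l1 u)
      moreover have "(\<Sum>i\<in>UNIV. mv (A (r (q n + k0))) (right_pvec (A (r (q n + k0)))) i) *
          right_pvec (A (r (q n + k0))) i = mv (A (r (q n + k0))) (right_pvec (A (r (q n + k0)))) i" for n
        unfolding root[OF ge[OF r], symmetric] by (simp add: right_pvec_eigen[OF P])
      ultimately show "mv B u i = (\<Sum>i\<in>UNIV. mv B u i) * u i"
        using l1[of i] LIMSEQ_unique by simp
    qed
    ultimately have "u = right_pvec B"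
      using right_pvec_unique[OF B, of u] by blast
    then show "\<exists>q. strict_mono q \<and> (\<lambda>n. right_pvec (A (r (q n))) i) \<longlonglongrightarrow> right_pvec B i"
      using lim_mono[OF _ r q, of "\<lambda>n. right_pvec (A n) i"] u[of i] by simp
  qed
qed

lemma tendsto_perron_root:
  fixes A :: "nat \<Rightarrow> 'd::finite \<Rightarrow> 'd \<Rightarrow> real"
  assumes A: "\<And>i j. (\<lambda>k. A k i j) \<longlonglongrightarrow> B i j" and B: "primitive B" and nn: "\<And>k i j. 0 \<le> A k i j"
  shows "(\<lambda>k. perron_root (A k)) \<longlonglongrightarrow> perron_root B"
proof -
  have sum_eigen: "(\<Sum>i\<in>UNIV. mv M (right_pvec M) i) = perron_root M" if "primitive M" for M :: "'d \<Rightarrow> 'd \<Rightarrow> real"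
    using right_pvec_eigen[OF that] right_pvec_sum[OF that] by (simp flip: sum_distrib_left)
  have "(\<lambda>k. \<Sum>i\<in>UNIV. mv (A k) (right_pvec (A k)) i) \<longlonglongrightarrow> (\<Sum>i\<in>UNIV. mv B (right_pvec B) i)"
    by (intro tendsto_intros tendsto_mv A tendsto_right_pvec[OF A B nn])
  moreover have "\<forall>\<^sub>F k in sequentially. (\<Sum>i\<in>UNIV. mv (A k) (right_pvec (A k)) i) = perron_root (A k)"
    using eventually_primitive[OF A B nn] by eventually_elim (rule sum_eigen)
  ultimately show ?thesis
    unfolding sum_eigen[OF B] by (rule Lim_transform_eventually)
qed

text \<open>Left vectors are right vectors of the transpose up to normalisation, so their continuity
  follows from that of right vectors.\<close>

lemma left_pvec_tr:
  fixes A :: "'d::finite \<Rightarrow> 'd \<Rightarrow> real"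
  assumes A: "primitive A"
  shows "left_pvec A i = right_pvec (tr A) i / dot (right_pvec A) (right_pvec (tr A))"
    and "0 < dot (right_pvec A) (right_pvec (tr A))"
proof -
  let ?w = "right_pvec (tr A)" and ?c = "dot (right_pvec A) (right_pvec (tr A))"
  note w = right_pvec_pos[OF primitive_tr[OF A]]
  show c: "0 < ?c"
    using right_pvec_pos[OF A] w[of i] by (intro dot_pos[of _ _ i]) (auto intro: less_imp_le w)
  have "(\<lambda>i. inverse ?c * ?w i) = left_pvec A"
  proof (rule left_pvec_unique[OF A, THEN conjunct2])
    show "0 \<le> inverse ?c * ?w i" for i using c w[of i] by simp
    show "mv (tr A) (\<lambda>i. inverse ?c * ?w i) = (\<lambda>i. perron_root (tr A) * (inverse ?c * ?w i))"
      by (simp only: mv_scale right_pvec_eigen[OF primitive_tr[OF A]]) (simp add: mult_ac)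
    show "dot (right_pvec A) (\<lambda>i. inverse ?c * ?w i) = 1"
      using c by (simp only: dot_scale_right) simp
  qed
  then show "left_pvec A i = ?w i / ?c"
    by (metis divide_inverse mult.commute)
qed

lemma tendsto_left_pvec:
  fixes A :: "nat \<Rightarrow> 'd::finite \<Rightarrow> 'd \<Rightarrow> real"
  assumes A: "\<And>i j. (\<lambda>k. A k i j) \<longlonglongrightarrow> B i j" and B: "primitive B" and nn: "\<And>k i j. 0 \<le> A k i j"
  shows "(\<lambda>k. left_pvec (A k) i) \<longlonglongrightarrow> left_pvec B i"
proof -
  have "(\<lambda>k. tr (A k) i j) \<longlonglongrightarrow> tr B i j" "0 \<le> tr (A k) i j" for i j k
    using A nn by (simp_all add: tr_def)
  note tr = tendsto_right_pvec[OF this(1) primitive_tr[OF B] this(2)]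
  have "(\<lambda>k. right_pvec (tr (A k)) i / dot (right_pvec (A k)) (right_pvec (tr (A k)))) \<longlonglongrightarrow> left_pvec B i"
    unfolding left_pvec_tr(1)[OF B]
    by (intro tendsto_divide tendsto_dot tr tendsto_right_pvec[OF A B nn]) (use left_pvec_tr(2)[OF B] in simp)
  moreover have "\<forall>\<^sub>F k in sequentially. right_pvec (tr (A k)) i / dot (right_pvec (A k)) (right_pvec (tr (A k))) = left_pvec (A k) i"
    using eventually_primitive[OF A B nn] by eventually_elim (rule left_pvec_tr(1)[symmetric])
  ultimately show ?thesis by (rule Lim_transform_eventually)
qed

text \<open>Both indices tend to infinity with no relation between them. Convergence along this
  filter is the form that uniformity near criticality takes, and it restricts to every path
  \<open>(k, n k)\<close> with \<open>n k\<close> tending to infinity.\<close>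

abbreviation seq2 :: "(nat \<times> nat) filter" where
  "seq2 \<equiv> sequentially \<times>\<^sub>F sequentially"

lemma eventually_seq2: "eventually P seq2 \<longleftrightarrow> (\<exists>N. \<forall>k\<ge>N. \<forall>i\<ge>N. P (k, i))"
  unfolding eventually_prod_sequentially by blast

lemma filterlim_seq2_shift: "filterlim (\<lambda>p. (fst p, snd p + m)) seq2 seq2"
proof -
  have "filterlim (\<lambda>p. snd p + m) sequentially seq2"
    by (rule filterlim_compose[OF filterlim_add_const_nat_at_top filterlim_snd])
  then show ?thesis
    by (intro filterlim_Pair filterlim_fst)
qed

lemma filterlim_seq2_graph:
  "filterlim n sequentially sequentially \<Longrightarrow> filterlim (\<lambda>k. (k, n k)) seq2 sequentially"
  by (intro filterlim_Pair filterlim_ident)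

lemma tendsto_seq2_shift:
  assumes "(f \<longlongrightarrow> L) seq2" shows "((\<lambda>p. f (fst p, snd p + m)) \<longlongrightarrow> L) seq2"
  by (rule filterlim_compose[OF assms filterlim_seq2_shift])

lemma eventually_seq2_shift:
  assumes "eventually P seq2" shows "\<forall>\<^sub>F p in seq2. P (fst p, snd p + m)"
  using filterlim_seq2_shift[of m] assms unfolding filterlim_iff by blast

lemma tendsto_seq2_fst:
  assumes "X \<longlonglongrightarrow> L" shows "((\<lambda>p. X (fst p)) \<longlongrightarrow> L) seq2"
  by (rule filterlim_compose[OF assms filterlim_fst])

lemma eventually_seq2_fst:
  assumes "eventually P sequentially" shows "\<forall>\<^sub>F p in seq2. P (fst p)"
  using assms filterlim_fst unfolding filterlim_iff by blast

text \<open>Iterating gives \<open>b ^ m * C\<close> plus a geometric sum of errors. For each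
  \<open>e\<close> a fixed number \<open>m\<close> of iterations suffices, so only a bounded shift
  of the second index is lost.\<close>

lemma tendsto_0_contraction_seq2:
  fixes R h :: "nat \<times> nat \<Rightarrow> real"
  assumes b: "0 \<le> b" "b < 1" and h: "(h \<longlongrightarrow> 0) seq2"
    and R: "\<forall>\<^sub>F p in seq2. 0 \<le> R p \<and> R p \<le> C"
    and step: "\<forall>\<^sub>F p in seq2. R (fst p, snd p + U) \<le> b * R p + h p"
  shows "(R \<longlongrightarrow> 0) seq2"
proof (rule tendstoI)
  fix e :: real assume e: "0 < e"
  \<comment> \<open>With this error size the map r to b r + e (1 - b) / 2 has the fixed point e / 2,
    the bound propagated below.\<close>
  have "\<forall>\<^sub>F p in seq2. \<bar>h p\<bar> < e * (1 - b) / 2"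
    using tendstoD[OF h, of "e * (1 - b) / 2"] e b by (simp add: dist_real_def)
  with R step have "\<forall>\<^sub>F p in seq2. (0 \<le> R p \<and> R p \<le> C) \<and> R (fst p, snd p + U) \<le> b * R p + h p
      \<and> \<bar>h p\<bar> < e * (1 - b) / 2"
    by eventually_elim auto
  then obtain N where N: "\<And>k i. k \<ge> N \<Longrightarrow> i \<ge> N \<Longrightarrow> (0 \<le> R (k, i) \<and> R (k, i) \<le> C)
      \<and> R (k, i + U) \<le> b * R (k, i) + h (k, i) \<and> \<bar>h (k, i)\<bar> < e * (1 - b) / 2"
    unfolding eventually_seq2 by auto
  have "(\<lambda>m. b ^ m * C) \<longlonglongrightarrow> 0 * C"
    using b by (intro tendsto_intros LIMSEQ_realpow_zero) auto
  then have "\<forall>\<^sub>F m in sequentially. b ^ m * C < e / 2"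
    using e by (intro order_tendstoD(2)[where y = "0 * C"]) auto
  then obtain m where m: "b ^ m * C < e / 2"
    by (auto simp: eventually_sequentially)
  have iter: "R (k, i + m * U) \<le> b ^ m * C + e / 2" if "k \<ge> N" "i \<ge> N" for k i m
  proof (induction m)
    case 0
    show ?case using N[OF that] e by auto
  next
    case (Suc m)
    have "R (k, i + Suc m * U) = R (k, (i + m * U) + U)"
      by (simp add: algebra_simps)
    also have "\<dots> \<le> b * R (k, i + m * U) + h (k, i + m * U)"
      using N[OF that(1), of "i + m * U"] that(2) by simp
    also have "\<dots> \<le> b * (b ^ m * C + e / 2) + e * (1 - b) / 2"
      using N[OF that(1), of "i + m * U"] that(2) Suc b by (intro add_mono mult_left_mono) auto
    also have "\<dots> = b ^ Suc m * C + e / 2" by (simp add: field_simps)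
    finally show ?case .
  qed
  have "\<bar>R (k, i)\<bar> < e" if "k \<ge> N + m * U" "i \<ge> N + m * U" for k i
  proof -
    have "R (k, (i - m * U) + m * U) \<le> b ^ m * C + e / 2"
      using that by (intro iter) auto
    moreover have "(i - m * U) + m * U = i" using that by simp
    ultimately have "R (k, i) \<le> b ^ m * C + e / 2" by (simp del: le_add_diff_inverse2)
    moreover have "0 \<le> R (k, i)" using N that by auto
    ultimately show ?thesis using m by auto
  qed
  then show "\<forall>\<^sub>F p in seq2. dist (R p) 0 < e"
    unfolding eventually_seq2 dist_real_def by auto
qed

text \<open>Doeblin's argument: the rank-one matrix a u v' may be subtracted from \<open>P\<close>
  because it annihilates \<open>z\<close>, and what remains is nonnegative, with left v-mass reduced
  by the factor 1 - a.\<close>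

lemma dot_abs_contraction:
  fixes u v z :: "'d::finite \<Rightarrow> real"
  assumes u: "\<And>i. 0 < u i" and v: "\<And>i. 0 < v i" and uv: "dot v u = 1"
    and P: "\<And>i j. a * (u i * v j) \<le> P i j" "mv (tr P) v = v" and z: "dot v z = 0"
  shows "dot v (\<lambda>i. \<bar>mv P z i\<bar>) \<le> (1 - a) * dot v (\<lambda>i. \<bar>z i\<bar>)"
proof -
  have "\<bar>mv P z i\<bar> \<le> mv P (\<lambda>j. \<bar>z j\<bar>) i - a * u i * dot v (\<lambda>j. \<bar>z j\<bar>)" for i
  proof -
    have "mv P z i = mv P z i - a * u i * dot v z" by (simp add: z)
    also have "\<dots> = (\<Sum>j\<in>UNIV. (P i j - a * (u i * v j)) * z j)"
      by (simp add: mv_def dot_def algebra_simps sum_subtractf sum_distrib_left)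
    finally have "\<bar>mv P z i\<bar> \<le> (\<Sum>j\<in>UNIV. \<bar>(P i j - a * (u i * v j)) * z j\<bar>)"
      by (metis sum_abs)
    also have "\<dots> = (\<Sum>j\<in>UNIV. (P i j - a * (u i * v j)) * \<bar>z j\<bar>)"
      using P(1) by (simp add: abs_mult)
    also have "\<dots> = mv P (\<lambda>j. \<bar>z j\<bar>) i - a * u i * dot v (\<lambda>j. \<bar>z j\<bar>)"
      by (simp add: mv_def dot_def algebra_simps sum_subtractf sum_distrib_left)
    finally show ?thesis .
  qed
  then have "dot v (\<lambda>i. \<bar>mv P z i\<bar>) \<le> dot v (\<lambda>i. mv P (\<lambda>j. \<bar>z j\<bar>) i - a * u i * dot v (\<lambda>j. \<bar>z j\<bar>))"
    using v by (intro dot_mono) (auto intro: less_imp_le)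
  also have "\<dots> = dot v (\<lambda>i. mv P (\<lambda>j. \<bar>z j\<bar>) i - (a * dot v (\<lambda>j. \<bar>z j\<bar>)) * u i)"
    by (simp add: mult_ac)
  also have "\<dots> = dot v (mv P (\<lambda>j. \<bar>z j\<bar>)) - (a * dot v (\<lambda>j. \<bar>z j\<bar>)) * dot v u"
    by (simp only: dot_diff_right dot_scale_right)
  also have "\<dots> = (1 - a) * dot v (\<lambda>i. \<bar>z i\<bar>)"
    by (simp add: dot_mv P(2) uv algebra_simps)
  finally show ?thesis .
qed

text \<open>One step of an approximately linear recursion is only asymptotically \<open>A\<close>, but the projective
  action of a power of \<open>A\<close> contracts towards the Perron direction.\<close>

lemma perron_direction:
  fixes A :: "'d::finite \<Rightarrow> 'd \<Rightarrow> real" and x :: "nat \<Rightarrow> nat \<Rightarrow> 'd \<Rightarrow> real"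
  assumes A: "primitive A" "perron_root A = 1"
    and pos: "\<forall>\<^sub>F p in seq2. (\<forall>l. 0 \<le> x (fst p) (snd p) l) \<and> 0 < dot (left_pvec A) (x (fst p) (snd p))"
    and step: "\<And>l. ((\<lambda>p. (x (fst p) (Suc (snd p)) l - mv A (x (fst p) (snd p)) l) /
                 dot (left_pvec A) (x (fst p) (snd p))) \<longlongrightarrow> 0) seq2"
  shows "((\<lambda>p. x (fst p) (snd p) l / dot (left_pvec A) (x (fst p) (snd p))) \<longlongrightarrow> right_pvec A l) seq2"
proof -
  define u v where "u = right_pvec A" and "v = left_pvec A"
  have u: "\<And>i. 0 < u i" and v: "\<And>i. 0 < v i" and uv: "dot v u = 1"
    and Au: "mv A u = u" and Av: "mv (tr A) v = v"
    using right_pvec_pos[OF A(1)] left_pvec_pos[OF A(1)] left_right_pvec[OF A(1)]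
      right_pvec_eigen[OF A(1)] left_pvec_eigen[OF A(1)] by (simp_all add: u_def v_def A(2))
  define t where "t p = dot v (x (fst p) (snd p))" for p
  define y where "y p l = x (fst p) (snd p) l / t p" for p l
  define S where "S p = (fst p, Suc (snd p))" for p :: "nat \<times> nat"
  have shift: "(\<lambda>p. f (S p)) = (\<lambda>p. f (fst p, snd p + 1))" for f :: "nat \<times> nat \<Rightarrow> 'c"
    by (simp add: S_def)
  have E: "\<forall>\<^sub>F p in seq2. (\<forall>l. 0 \<le> y p l) \<and> dot v (y p) = 1 \<and> 0 < t p"
    using pos
  proof eventually_elim
    case (elim p)
    have "y p = (\<lambda>l. (1 / t p) * x (fst p) (snd p) l)" by (simp add: y_def fun_eq_iff)
    then have "dot v (y p) = (1 / t p) * t p" by (simp only: dot_scale_right t_def)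
    then show ?case using elim by (auto simp: y_def t_def v_def)
  qed
  have ES: "\<forall>\<^sub>F p in seq2. (\<forall>l. 0 \<le> y (S p) l) \<and> dot v (y (S p)) = 1 \<and> 0 < t (S p)"
    using eventually_seq2_shift[OF E, of 1] by (simp add: S_def)
  define e where "e p l = (x (fst p) (Suc (snd p)) l - mv A (x (fst p) (snd p)) l) / t p" for p l
  have e0: "((\<lambda>p. e p l) \<longlongrightarrow> 0) seq2" for l
    using step by (simp add: e_def t_def v_def)
  \<comment> \<open>Growth factor of the component along v. It tends to 1 because v is a left fixed
    vector of A and the one-step error is negligible.\<close>
  define c where "c p = t (S p) / t p" for p
  have c_eq: "\<forall>\<^sub>F p in seq2. 1 + dot v (e p) = c p"
    using E
  proof eventually_elim
    case (elim p)
    have "e p = (\<lambda>l. (1 / t p) * (x (fst p) (Suc (snd p)) l - mv A (x (fst p) (snd p)) l))"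
      by (simp add: e_def fun_eq_iff)
    then have "dot v (e p) = (1 / t p) * (t (S p) - dot v (mv A (x (fst p) (snd p))))"
      by (simp only: dot_scale_right dot_diff_right) (simp add: t_def S_def)
    also have "dot v (mv A (x (fst p) (snd p))) = t p"
      by (simp add: dot_mv Av t_def)
    finally show ?case using elim by (simp add: c_def field_simps)
  qed
  have "((\<lambda>p. 1 + dot v (e p)) \<longlongrightarrow> 1 + dot v (\<lambda>_. 0)) seq2"
    by (intro tendsto_intros tendsto_dot e0)
  then have "((\<lambda>p. 1 + dot v (e p)) \<longlongrightarrow> 1) seq2"
    by (simp add: dot_def)
  from this c_eq have c1: "(c \<longlongrightarrow> 1) seq2"
    by (rule Lim_transform_eventually)
  have ybound: "\<forall>\<^sub>F p in seq2. \<forall>l. y p l \<le> 1 / v l"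
    using E
  proof (eventually_elim, intro allI)
    fix p l assume "(\<forall>l. 0 \<le> y p l) \<and> dot v (y p) = 1 \<and> 0 < t p"
    then have "v l * y p l \<le> 1"
      using dot_ge_component[of v "y p" l] v by (auto intro: less_imp_le)
    then show "y p l \<le> 1 / v l" using v[of l] by (simp add: field_simps)
  qed
  have A0: "\<And>i j. 0 \<le> A i j" using A(1) by (simp add: primitive_def)
  have Y2: "((\<lambda>p. y (S p) l - mv A (y p) l) \<longlongrightarrow> 0) seq2" for l
  proof -
    let ?K = "mv A (\<lambda>l. 1 / v l) l"
    have "((\<lambda>p. ?K * \<bar>1 - c p\<bar>) \<longlongrightarrow> ?K * \<bar>1 - 1\<bar>) seq2"
      by (intro tendsto_intros c1)
    then have lim: "((\<lambda>p. ?K * \<bar>1 - c p\<bar>) \<longlongrightarrow> 0) seq2" by simp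
    have "((\<lambda>p. mv A (y p) l * (1 - c p)) \<longlongrightarrow> 0) seq2"
    proof (rule Lim_null_comparison[OF _ lim])
      show "\<forall>\<^sub>F p in seq2. norm (mv A (y p) l * (1 - c p)) \<le> ?K * \<bar>1 - c p\<bar>"
        using E ybound
      proof eventually_elim
        case (elim p)
        have "0 \<le> mv A (y p) l" "mv A (y p) l \<le> ?K"
          using elim A0 by (auto intro: mv_nonneg mv_mono)
        then show ?case by (simp add: abs_mult mult_right_mono)
      qed
    qed
    then have "((\<lambda>p. (mv A (y p) l * (1 - c p) + e p l) / c p) \<longlongrightarrow> (0 + 0) / 1) seq2"
      by (intro tendsto_divide tendsto_add e0 c1) auto
    then have "((\<lambda>p. (mv A (y p) l * (1 - c p) + e p l) / c p) \<longlongrightarrow> 0) seq2" by simp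
    then show ?thesis
    proof (rule Lim_transform_eventually)
      show "\<forall>\<^sub>F p in seq2. (mv A (y p) l * (1 - c p) + e p l) / c p = y (S p) l - mv A (y p) l"
        using E ES
      proof eventually_elim
        case (elim p)
        have "y p = (\<lambda>l. (1 / t p) * x (fst p) (snd p) l)" by (simp add: y_def fun_eq_iff)
        then have "mv A (y p) l = (1 / t p) * mv A (x (fst p) (snd p)) l"
          by (simp only: mv_scale)
        then have "e p l = y (S p) l * c p - mv A (y p) l"
          using elim by (simp add: e_def y_def c_def S_def diff_divide_distrib)
        then show ?case using elim by (simp add: c_def field_simps)
      qed
    qed
  qed
  \<comment> \<open>For each fixed m the one-step errors add up to something still negligible, so a
    positive power of A can be treated as one step.\<close>
  have Ym: "((\<lambda>p. y (fst p, snd p + m) l - mv (mat_pow A m) (y p) l) \<longlongrightarrow> 0) seq2" for m l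
  proof (induction m arbitrary: l)
    case 0
    have "mv (mat_pow A 0) z = z" for z
      by (simp add: mv_def fun_eq_iff if_distrib[of "\<lambda>x. x * _"] sum.delta cong: if_cong)
    then show ?case by simp
  next
    case (Suc m)
    have "((\<lambda>p. (y (S (fst p, snd p + m)) l - mv A (y (fst p, snd p + m)) l) +
        mv A (\<lambda>l. y (fst p, snd p + m) l - mv (mat_pow A m) (y p) l) l) \<longlongrightarrow> 0 + mv A (\<lambda>_. 0) l) seq2"
      by (intro tendsto_intros tendsto_mv Suc tendsto_seq2_shift[OF Y2])
    then show ?case
      by (simp add: mv_diff mat_pow_Suc' mv_mat_mult S_def mv_def[of A "\<lambda>_. 0"] del: mat_pow.simps(2))
  qed
  obtain n where n: "\<And>i j. 0 < mat_pow A (Suc n) i j"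
    using A(1) unfolding primitive_def by blast
  define P where "P = mat_pow A (Suc n)"
  \<comment> \<open>The best minorisation constant for the power, capped at 1 so that the
    contraction factor is nonnegative.\<close>
  define a where "a = min 1 (Min (range (\<lambda>(i, j). P i j / (u i * v j))))"
  have a: "a * (u i * v j) \<le> P i j" for i j
  proof -
    have "Min (range (\<lambda>(i, j). P i j / (u i * v j))) \<le> P i j / (u i * v j)"
      by (rule Min_le) (auto intro!: image_eqI[of _ _ "(i, j)"])
    then have "a \<le> P i j / (u i * v j)" by (simp add: a_def)
    then show ?thesis using u[of i] v[of j] by (simp add: pos_le_divide_eq)
  qed
  have "0 < Min (range (\<lambda>(i, j). P i j / (u i * v j)))"
    using n u v by (subst Min_gr_iff) (auto simp: P_def simp del: mat_pow.simps)
  then have a01: "0 < a" "a \<le> 1" by (auto simp: a_def)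
  have Pv: "mv (tr P) v = v"
    using mv_mat_pow_eigen[of "tr A" v 1 "Suc n"] Av by (simp add: P_def tr_mat_pow del: mat_pow.simps)
  have Pu: "mv P u = u"
    using mv_mat_pow_eigen[of A u 1 "Suc n"] Au by (simp add: P_def del: mat_pow.simps)
  define R where "R p = dot v (\<lambda>l. \<bar>y p l - u l\<bar>)" for p
  have "((\<lambda>p. dot v (\<lambda>l. \<bar>y (fst p, snd p + Suc n) l - mv P (y p) l\<bar>)) \<longlongrightarrow> dot v (\<lambda>l. \<bar>0\<bar>)) seq2"
    unfolding P_def by (intro tendsto_dot tendsto_const tendsto_rabs Ym)
  then have h: "((\<lambda>p. dot v (\<lambda>l. \<bar>y (fst p, snd p + Suc n) l - mv P (y p) l\<bar>)) \<longlongrightarrow> 0) seq2"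
    by (simp add: dot_def)
  have R0: "(R \<longlongrightarrow> 0) seq2"
  proof (rule tendsto_0_contraction_seq2[OF _ _ h, of "1 - a" R 2 "Suc n"])
    show "0 \<le> 1 - a" "1 - a < 1" using a01 by auto
    show "\<forall>\<^sub>F p in seq2. 0 \<le> R p \<and> R p \<le> 2"
      using E
    proof eventually_elim
      case (elim p)
      have "R p \<le> dot v (\<lambda>l. y p l + u l)"
        unfolding R_def using elim u v by (intro dot_mono) (auto intro!: less_imp_le simp: abs_le_iff add_nonneg_pos)
      then have "R p \<le> 2"
        using elim uv by (simp add: dot_add_right)
      then show ?case
        unfolding R_def using v by (auto intro!: dot_nonneg intro: less_imp_le)
    qed
    show "\<forall>\<^sub>F p in seq2. R (fst p, snd p + Suc n)
        \<le> (1 - a) * R p + dot v (\<lambda>l. \<bar>y (fst p, snd p + Suc n) l - mv P (y p) l\<bar>)"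
      using E
    proof eventually_elim
      case (elim p)
      let ?z = "\<lambda>l. y p l - u l"
      have "R (fst p, snd p + Suc n) \<le> dot v (\<lambda>l. \<bar>mv P ?z l\<bar> + \<bar>y (fst p, snd p + Suc n) l - mv P (y p) l\<bar>)"
        unfolding R_def using v by (intro dot_mono) (auto intro: less_imp_le simp: mv_diff Pu)
      also have "\<dots> = dot v (\<lambda>l. \<bar>mv P ?z l\<bar>) + dot v (\<lambda>l. \<bar>y (fst p, snd p + Suc n) l - mv P (y p) l\<bar>)"
        by (simp add: dot_add_right)
      also have "dot v (\<lambda>l. \<bar>mv P ?z l\<bar>) \<le> (1 - a) * R p"
        unfolding R_def
        by (rule dot_abs_contraction[OF u v uv a Pv]) (use elim uv in \<open>simp add: dot_diff_right\<close>)
      finally show ?case by simp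
    qed
  qed
  have "((\<lambda>p. y p l - u l) \<longlongrightarrow> 0) seq2"
  proof (rule Lim_null_comparison)
    show "\<forall>\<^sub>F p in seq2. norm (y p l - u l) \<le> R p / v l"
    proof (rule always_eventually, intro allI)
      fix p
      have "v l * \<bar>y p l - u l\<bar> \<le> R p"
        unfolding R_def by (rule dot_ge_component) (use v in \<open>auto intro: less_imp_le\<close>)
      then show "norm (y p l - u l) \<le> R p / v l"
        using v[of l] by (simp add: field_simps)
    qed
    show "((\<lambda>p. R p / v l) \<longlongrightarrow> 0) seq2"
      using tendsto_divide[OF R0 tendsto_const, of "v l"] v[of l] by simp
  qed
  then show ?thesis
    by (simp add: y_def t_def u_def v_def LIM_zero_iff)
qed

text \<open>Kept as a sum because the quotient form degenerates at \<open>x = 1\<close>, which is an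
  admissible value of the root.\<close>

definition geo :: "nat \<Rightarrow> real \<Rightarrow> real" where
  "geo n x = (\<Sum>i<n. x ^ i)"

lemma geo_Suc: "geo (Suc n) x = geo n x + x ^ n"
  by (simp add: geo_def)

lemma geo_telescope: "(1 - x) * geo n x = 1 - x ^ n"
  unfolding geo_def by (simp add: one_diff_power_eq)

lemma geo_mono: "m \<le> n \<Longrightarrow> 0 \<le> x \<Longrightarrow> geo m x \<le> geo n x"
  unfolding geo_def by (intro sum_mono2) auto

lemma geo_nonneg: "0 \<le> x \<Longrightarrow> 0 \<le> geo n x"
  unfolding geo_def by (intro sum_nonneg) auto

lemma geo_le: "0 \<le> x \<Longrightarrow> x \<le> 1 \<Longrightarrow> geo n x \<le> n"
  unfolding geo_def using sum_mono[of "{..<n}" "\<lambda>i. x ^ i" "\<lambda>_. 1"] by (simp add: power_le_one)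

text \<open>The first m terms alone tend to m, and the further terms are nonnegative.\<close>

lemma filterlim_geo_at_top:
  assumes L: "L \<longlonglongrightarrow> 1" "\<forall>\<^sub>F k in sequentially. 0 < L k"
  shows "filterlim (\<lambda>p. geo (snd p) (L (fst p))) at_top seq2"
proof (rule filterlim_at_top[THEN iffD2], rule allI)
  fix Z :: real
  obtain m :: nat where m: "Z < real m" using reals_Archimedean2 by blast
  have "(\<lambda>k. geo m (L k)) \<longlonglongrightarrow> (\<Sum>i<m. 1 ^ i)"
    unfolding geo_def by (intro tendsto_intros L)
  then have "\<forall>\<^sub>F k in sequentially. Z < geo m (L k)"
    using m by (intro order_tendstoD(1)[where y = "\<Sum>i<m. 1 ^ i"]) auto
  with L(2) have "\<forall>\<^sub>F k in sequentially. Z < geo m (L k) \<and> 0 < L k"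
    by eventually_elim auto
  then obtain N where N: "\<And>k. k \<ge> N \<Longrightarrow> Z < geo m (L k) \<and> 0 < L k"
    unfolding eventually_sequentially by blast
  show "\<forall>\<^sub>F p in seq2. Z \<le> geo (snd p) (L (fst p))"
    unfolding eventually_seq2
  proof (intro exI allI impI)
    fix k i assume "N + m \<le> k" "N + m \<le> i"
    then show "Z \<le> geo (snd (k, i)) (L (fst (k, i)))"
      using N[of k] geo_mono[of m i "L k"] by auto
  qed
qed

text \<open>After multiplication by powers of \<open>L\<close> the recursion telescopes:
  \<open>L ^ n * g n - c0 * geo n L\<close> changes by \<open>L ^ n * (L * c - c0)\<close>. The
  accumulated error is small relative to \<open>geo\<close>, and the starting value is negligible
  because \<open>geo\<close> diverges.\<close>

lemma geometric_average:
  fixes L :: "nat \<Rightarrow> real" and g c :: "nat \<Rightarrow> nat \<Rightarrow> real"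
  assumes L: "L \<longlonglongrightarrow> 1" "\<forall>\<^sub>F k in sequentially. 0 < L k \<and> L k \<le> 1"
    and c: "((\<lambda>p. c (fst p) (snd p)) \<longlongrightarrow> c0) seq2"
    and step: "\<forall>\<^sub>F p in seq2. g (fst p) (Suc (snd p)) = g (fst p) (snd p) / L (fst p) + c (fst p) (snd p)"
    and bound: "\<And>i. \<exists>K. \<forall>\<^sub>F k in sequentially. \<bar>g k i\<bar> \<le> K"
  shows "((\<lambda>p. L (fst p) ^ snd p * g (fst p) (snd p) / geo (snd p) (L (fst p))) \<longlongrightarrow> c0) seq2"
proof (rule tendstoI)
  fix e :: real assume e: "0 < e"
  have "((\<lambda>p. L (fst p) * c (fst p) (snd p) - c0) \<longlongrightarrow> 1 * c0 - c0) seq2"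
    by (intro tendsto_intros c tendsto_seq2_fst[OF L(1)])
  then have lim0: "((\<lambda>p. L (fst p) * c (fst p) (snd p) - c0) \<longlongrightarrow> 0) seq2" by simp
  have "\<forall>\<^sub>F p in seq2. \<bar>L (fst p) * c (fst p) (snd p) - c0\<bar> < e / 3"
    using tendstoD[OF lim0, of "e / 3"] e by (simp add: dist_real_def)
  with step eventually_seq2_fst[OF L(2)]
  have "\<forall>\<^sub>F p in seq2. (0 < L (fst p) \<and> L (fst p) \<le> 1) \<and>
     g (fst p) (Suc (snd p)) = g (fst p) (snd p) / L (fst p) + c (fst p) (snd p) \<and>
     \<bar>L (fst p) * c (fst p) (snd p) - c0\<bar> < e / 3"
    by eventually_elim auto
  then obtain N where N: "\<And>k i. k \<ge> N \<Longrightarrow> i \<ge> N \<Longrightarrow> (0 < L k \<and> L k \<le> 1) \<and>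
     g k (Suc i) = g k i / L k + c k i \<and> \<bar>L k * c k i - c0\<bar> < e / 3"
    unfolding eventually_seq2 by auto
  obtain K where "\<forall>\<^sub>F k in sequentially. \<bar>g k N\<bar> \<le> K"
    using bound[of N] by blast
  then obtain N1 where N1: "\<And>k. k \<ge> N1 \<Longrightarrow> \<bar>g k N\<bar> \<le> K"
    unfolding eventually_sequentially by blast
  \<comment> \<open>Bounds the discrepancy at generation \<open>N\<close>: powers of
    \<open>L k\<close> are at most 1, and \<open>geo N\<close> is at most \<open>N\<close>.\<close>
  define K' where "K' = K + \<bar>c0\<bar> * N"
  have main: "\<bar>L k ^ n * g k n - c0 * geo n (L k)\<bar> \<le> K' + e / 3 * geo n (L k)"
    if k: "k \<ge> N" "k \<ge> N1" and n: "n \<ge> N" for k n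
    using n
  proof (induction n rule: dec_induct)
    case base
    have Lk: "0 < L k" "L k \<le> 1" using N[of k N] k by auto
    have "\<bar>L k ^ N * g k N\<bar> \<le> 1 * K"
      unfolding abs_mult using Lk N1[OF k(2)] by (intro mult_mono) (auto simp: power_le_one)
    moreover have "\<bar>c0 * geo N (L k)\<bar> \<le> \<bar>c0\<bar> * N"
      unfolding abs_mult using geo_le[of "L k" N] geo_nonneg[of "L k" N] Lk by (intro mult_left_mono) auto
    moreover have "0 \<le> e / 3 * geo N (L k)"
      using geo_nonneg[of "L k" N] Lk e by auto
    ultimately show ?case unfolding K'_def by linarith
  next
    case (step n)
    have Lk: "0 < L k" "L k \<le> 1" and gs: "g k (Suc n) = g k n / L k + c k n"
      and cc: "\<bar>L k * c k n - c0\<bar> < e / 3"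
      using N[of k n] k step by auto
    have "L k ^ Suc n * g k (Suc n) - c0 * geo (Suc n) (L k)
        = (L k ^ n * g k n - c0 * geo n (L k)) + L k ^ n * (L k * c k n - c0)"
      using Lk by (simp add: gs geo_Suc field_simps)
    moreover have "\<bar>L k ^ n * (L k * c k n - c0)\<bar> \<le> L k ^ n * (e / 3)"
      unfolding abs_mult using Lk cc by (intro mult_mono) auto
    moreover have "e / 3 * geo (Suc n) (L k) = e / 3 * geo n (L k) + L k ^ n * (e / 3)"
      by (simp add: geo_Suc algebra_simps)
    ultimately show ?case using step.IH by linarith
  qed
  have "\<forall>\<^sub>F k in sequentially. 0 < L k" using L(2) by eventually_elim auto
  then have G: "filterlim (\<lambda>p. geo (snd p) (L (fst p))) at_top seq2"
    using L(1) filterlim_geo_at_top by blast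
  have "\<forall>\<^sub>F p in seq2. max 1 (3 * K' / e) \<le> geo (snd p) (L (fst p))"
    using G unfolding filterlim_at_top by blast
  moreover have "\<forall>\<^sub>F p in seq2. fst p \<ge> N \<and> fst p \<ge> N1 \<and> snd p \<ge> N"
    unfolding eventually_seq2 by (intro exI[of _ "max N N1"]) auto
  ultimately show "\<forall>\<^sub>F p in seq2. dist (L (fst p) ^ snd p * g (fst p) (snd p) / geo (snd p) (L (fst p))) c0 < e"
  proof eventually_elim
    case (elim p)
    let ?G = "geo (snd p) (L (fst p))"
    let ?x = "L (fst p) ^ snd p * g (fst p) (snd p)"
    have G: "1 \<le> ?G" "3 * K' / e \<le> ?G" using elim by auto
    then have "K' \<le> e / 3 * ?G" using e by (simp add: field_simps)
    then have "\<bar>?x - c0 * ?G\<bar> \<le> 2 * (e / 3) * ?G"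
      using main[of "fst p" "snd p"] elim by auto
    also have "\<dots> < e * ?G" using G e by (simp add: mult_strict_right_mono)
    finally have "\<bar>?x - c0 * ?G\<bar> / ?G < e" using G by (simp add: field_simps)
    moreover have "\<bar>?x / ?G - c0\<bar> = \<bar>?x - c0 * ?G\<bar> / ?G"
    proof -
      have "?x / ?G - c0 = (?x - c0 * ?G) / ?G" using G by (simp add: field_simps)
      then show ?thesis using G by simp
    qed
    ultimately show ?case by (simp add: dist_real_def)
  qed
qed

section \<open>Taylor bounds for multitype generating functions\<close>

definition mon :: "('d::finite \<Rightarrow> real) \<Rightarrow> ('d \<Rightarrow> nat) \<Rightarrow> real" where
  "mon s n = (\<Prod>l\<in>UNIV. s l ^ n l)"

text \<open>Truncated subtraction does no harm in the derivatives: whenever it truncates, the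
  accompanying factor \<open>n l\<close> is 0.\<close>

definition drop1 :: "('d \<Rightarrow> nat) \<Rightarrow> 'd \<Rightarrow> 'd \<Rightarrow> nat" where
  "drop1 n l = (\<lambda>m. n m - unit_vec l m)"

definition dmon :: "('d::finite \<Rightarrow> real) \<Rightarrow> ('d \<Rightarrow> nat) \<Rightarrow> 'd \<Rightarrow> real" where
  "dmon s n l = real (n l) * mon s (drop1 n l)"

definition ddmon :: "('d::finite \<Rightarrow> real) \<Rightarrow> ('d \<Rightarrow> nat) \<Rightarrow> 'd \<Rightarrow> 'd \<Rightarrow> real" where
  "ddmon s n l m = real (n l) * dmon s (drop1 n l) m"

definition total :: "('d::finite \<Rightarrow> nat) \<Rightarrow> nat" where
  "total n = (\<Sum>l\<in>UNIV. n l)"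

lemma mon_mono: "(\<And>l. 0 \<le> x l) \<Longrightarrow> (\<And>l. x l \<le> y l) \<Longrightarrow> mon x n \<le> mon y n"
  unfolding mon_def by (intro prod_mono conjI power_mono zero_le_power) auto

lemma mon_nonneg: "(\<And>l. 0 \<le> x l) \<Longrightarrow> 0 \<le> mon x n"
  unfolding mon_def by (intro prod_nonneg) auto

lemma mon_one [simp]: "mon (\<lambda>_. 1) n = 1"
  by (simp add: mon_def)

lemma mon_le_1: "(\<And>l. 0 \<le> x l) \<Longrightarrow> (\<And>l. x l \<le> 1) \<Longrightarrow> mon x n \<le> 1"
  using mon_mono[of x "\<lambda>_. 1" n] by simp

lemma dmon_mono: "(\<And>l. 0 \<le> x l) \<Longrightarrow> (\<And>l. x l \<le> y l) \<Longrightarrow> dmon x n l \<le> dmon y n l"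
  unfolding dmon_def by (intro mult_left_mono mon_mono) auto

lemma dmon_nonneg: "(\<And>l. 0 \<le> x l) \<Longrightarrow> 0 \<le> dmon x n l"
  unfolding dmon_def by (simp add: mon_nonneg)

lemma ddmon_mono: "(\<And>l. 0 \<le> x l) \<Longrightarrow> (\<And>l. x l \<le> y l) \<Longrightarrow> ddmon x n l m \<le> ddmon y n l m"
  unfolding ddmon_def by (intro mult_left_mono dmon_mono) auto

lemma ddmon_nonneg: "(\<And>l. 0 \<le> x l) \<Longrightarrow> 0 \<le> ddmon x n l m"
  unfolding ddmon_def by (simp add: dmon_nonneg)

lemma le_total: "n l \<le> total n"
  unfolding total_def by (rule member_le_sum) auto

lemma drop1_le_total: "drop1 n l m \<le> total n"
  using le_total[of n m] by (simp add: drop1_def)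

lemma drop1_drop1_total: "(\<Sum>j\<in>UNIV. real (drop1 (drop1 n l) m j) * w j) \<le> real (total n) * (\<Sum>j\<in>UNIV. w j)"
  if "\<And>j. 0 \<le> w j" for w :: "'d::finite \<Rightarrow> real"
proof -
  have "drop1 (drop1 n l) m j \<le> total n" for j
    using drop1_le_total[of n l j] by (simp add: drop1_def[of "drop1 n l"])
  then show ?thesis
    unfolding sum_distrib_left by (intro sum_mono mult_right_mono) (auto simp: that)
qed

lemma deriv_mon_line:
  "((\<lambda>\<tau>. mon (\<lambda>l. x l + \<tau> * e l) n) has_real_derivative
      (\<Sum>l\<in>UNIV. dmon (\<lambda>l. x l + \<tau> * e l) n l * e l)) (at \<tau>)"
proof -
  have "((\<lambda>\<tau>. \<Prod>l\<in>UNIV. (x l + \<tau> * e l) ^ n l) has_real_derivative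
      (\<Sum>l\<in>UNIV. (real (n l) * (x l + \<tau> * e l) ^ (n l - 1) * e l) *
         (\<Prod>m\<in>UNIV - {l}. (x m + \<tau> * e m) ^ n m))) (at \<tau>)"
    by (intro has_field_derivative_prod) (auto intro!: derivative_eq_intros)
  moreover have "(real (n l) * (x l + \<tau> * e l) ^ (n l - 1) * e l) *
         (\<Prod>m\<in>UNIV - {l}. (x m + \<tau> * e m) ^ n m) = dmon (\<lambda>l. x l + \<tau> * e l) n l * e l" for l
  proof -
    have "mon (\<lambda>l. x l + \<tau> * e l) (drop1 n l) =
       (x l + \<tau> * e l) ^ (n l - 1) * (\<Prod>m\<in>UNIV - {l}. (x m + \<tau> * e m) ^ drop1 n l m)"
      unfolding mon_def by (subst prod.remove[of UNIV l]) (auto simp: drop1_def unit_vec_def)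
    also have "(\<Prod>m\<in>UNIV - {l}. (x m + \<tau> * e m) ^ drop1 n l m) = (\<Prod>m\<in>UNIV - {l}. (x m + \<tau> * e m) ^ n m)"
      by (intro prod.cong) (auto simp: drop1_def unit_vec_def)
    finally show ?thesis by (simp add: dmon_def)
  qed
  ultimately show ?thesis by (simp only: mon_def)
qed

text \<open>Mean value theorem on the segment from \<open>x\<close> to \<open>y\<close>; the partial
  derivatives of a monomial increase along it.\<close>

lemma mon_diff_bounds:
  assumes x: "\<And>l. 0 \<le> x l" "\<And>l. x l \<le> y l"
  shows "(\<Sum>l\<in>UNIV. dmon x n l * (y l - x l)) \<le> mon y n - mon x n"
    and "mon y n - mon x n \<le> (\<Sum>l\<in>UNIV. dmon y n l * (y l - x l))"
proof -
  obtain z where z: "0 < z" "z < 1"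
    "mon (\<lambda>l. x l + 1 * (y l - x l)) n - mon (\<lambda>l. x l + 0 * (y l - x l)) n =
     (1 - 0) * (\<Sum>l\<in>UNIV. dmon (\<lambda>l. x l + z * (y l - x l)) n l * (y l - x l))"
    using MVT2[of 0 1 "\<lambda>\<tau>. mon (\<lambda>l. x l + \<tau> * (y l - x l)) n", OF _ deriv_mon_line] by auto
  have "x l \<le> x l + z * (y l - x l)" "x l + z * (y l - x l) \<le> y l" for l
    using x[of l] z mult_left_le_one_le[of "y l - x l" z] by (auto simp: mult.commute)
  then have "dmon x n l \<le> dmon (\<lambda>l. x l + z * (y l - x l)) n l"
    "dmon (\<lambda>l. x l + z * (y l - x l)) n l \<le> dmon y n l" for l
    using x by (auto intro!: dmon_mono intro: order_trans)
  then have "(\<Sum>l\<in>UNIV. dmon x n l * (y l - x l)) \<le> (\<Sum>l\<in>UNIV. dmon (\<lambda>l. x l + z * (y l - x l)) n l * (y l - x l))"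
    "(\<Sum>l\<in>UNIV. dmon (\<lambda>l. x l + z * (y l - x l)) n l * (y l - x l)) \<le> (\<Sum>l\<in>UNIV. dmon y n l * (y l - x l))"
    using x by (auto intro!: sum_mono mult_right_mono)
  then show "(\<Sum>l\<in>UNIV. dmon x n l * (y l - x l)) \<le> mon y n - mon x n"
    "mon y n - mon x n \<le> (\<Sum>l\<in>UNIV. dmon y n l * (y l - x l))"
    using z(3) by simp_all
qed

lemma dmon_diff_bounds:
  assumes x: "\<And>l. 0 \<le> x l" "\<And>l. x l \<le> y l"
  shows "(\<Sum>m\<in>UNIV. ddmon x n l m * (y m - x m)) \<le> dmon y n l - dmon x n l"
    and "dmon y n l - dmon x n l \<le> (\<Sum>m\<in>UNIV. ddmon y n l m * (y m - x m))"
proof -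
  have "real (n l) * (\<Sum>m\<in>UNIV. dmon x (drop1 n l) m * (y m - x m)) \<le> real (n l) * (mon y (drop1 n l) - mon x (drop1 n l))"
    by (intro mult_left_mono mon_diff_bounds x) auto
  then show "(\<Sum>m\<in>UNIV. ddmon x n l m * (y m - x m)) \<le> dmon y n l - dmon x n l"
    by (simp add: ddmon_def dmon_def[of _ n l] sum_distrib_left algebra_simps)
  have "real (n l) * (mon y (drop1 n l) - mon x (drop1 n l)) \<le> real (n l) * (\<Sum>m\<in>UNIV. dmon y (drop1 n l) m * (y m - x m))"
    by (intro mult_left_mono mon_diff_bounds x) auto
  then show "dmon y n l - dmon x n l \<le> (\<Sum>m\<in>UNIV. ddmon y n l m * (y m - x m))"
    by (simp add: ddmon_def dmon_def[of _ n l] sum_distrib_left algebra_simps)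
qed

text \<open>Lipschitz-type bounds on \<open>f'\<close> stand in for bounds on a second derivative.
  Each inequality is monotonicity of \<open>f t - a * t - b * t\<^sup>2 / 2\<close> for a suitable
  slope a; the last pair expands at the endpoint 1.\<close>

lemma taylor2_bounds:
  fixes f f' :: "real \<Rightarrow> real"
  assumes f: "\<And>t. (f has_real_derivative f' t) (at t)"
    and lo: "\<And>s t. 0 \<le> s \<Longrightarrow> s \<le> t \<Longrightarrow> t \<le> 1 \<Longrightarrow> K * (t - s) \<le> f' t - f' s"
    and hi: "\<And>s t. 0 \<le> s \<Longrightarrow> s \<le> t \<Longrightarrow> t \<le> 1 \<Longrightarrow> f' t - f' s \<le> K' * (t - s)"
  shows "K / 2 \<le> f 1 - f 0 - f' 0" "f 1 - f 0 - f' 0 \<le> K' / 2"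
    and "K / 2 \<le> f' 1 - (f 1 - f 0)" "f' 1 - (f 1 - f 0) \<le> K' / 2"
proof -
  let ?g = "\<lambda>a b t. f t - a * t - b * t\<^sup>2 / 2"
  have D: "((?g a b) has_real_derivative f' t - a - b * t) (at t)" for a b t
    by (auto intro!: derivative_eq_intros f)
  have "?g (f' 0) K 0 \<le> ?g (f' 0) K 1"
    by (rule DERIV_nonneg_imp_nondecreasing) (use D lo[of 0] in force)+
  then show "K / 2 \<le> f 1 - f 0 - f' 0" by simp
  have "?g (f' 0) K' 0 \<ge> ?g (f' 0) K' 1"
    by (rule DERIV_nonpos_imp_nonincreasing) (use D hi[of 0] in force)+
  then show "f 1 - f 0 - f' 0 \<le> K' / 2" by simp
  have "?g (f' 1 - K) K 0 \<ge> ?g (f' 1 - K) K 1"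
  proof (rule DERIV_nonpos_imp_nonincreasing[where f = "?g (f' 1 - K) K"])
    fix t :: real assume "0 \<le> t" "t \<le> 1"
    then show "\<exists>y. ((?g (f' 1 - K) K) has_real_derivative y) (at t) \<and> y \<le> 0"
      using lo[of t 1] by (intro exI[of _ "f' t - (f' 1 - K) - K * t"] conjI D) (simp add: algebra_simps)
  qed simp
  then show "K / 2 \<le> f' 1 - (f 1 - f 0)" by (simp add: field_simps)
  have "?g (f' 1 - K') K' 0 \<le> ?g (f' 1 - K') K' 1"
  proof (rule DERIV_nonneg_imp_nondecreasing[where f = "?g (f' 1 - K') K'"])
    fix t :: real assume "0 \<le> t" "t \<le> 1"
    then show "\<exists>y. ((?g (f' 1 - K') K') has_real_derivative y) (at t) \<and> y \<ge> 0"
      using hi[of t 1] by (intro exI[of _ "f' t - (f' 1 - K') - K' * t"] conjI D) (simp add: algebra_simps)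
  qed simp
  then show "f' 1 - (f 1 - f 0) \<le> K' / 2" by (simp add: field_simps)
qed

definition quad :: "('d::finite \<Rightarrow> 'd \<Rightarrow> real) \<Rightarrow> ('d \<Rightarrow> real) \<Rightarrow> real" where
  "quad B e = (\<Sum>l\<in>UNIV. \<Sum>m\<in>UNIV. B l m * e l * e m)"

lemma quad_minus_const: "quad (\<lambda>l m. B l m - c) e = quad B e - c * (\<Sum>l\<in>UNIV. e l)\<^sup>2"
  unfolding quad_def power2_eq_square sum_product
  by (simp add: left_diff_distrib right_diff_distrib sum_subtractf sum_distrib_left mult_ac)

text \<open>Expansions at the lower and at the upper endpoint are both used later. Monotone second
  derivatives trap either remainder between the Hessian forms at the two endpoints.\<close>

lemma mon_taylor2_bounds:
  assumes x: "\<And>l. 0 \<le> x l" "\<And>l. x l \<le> y l"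
  defines "e \<equiv> \<lambda>l. y l - x l"
  shows "quad (ddmon x n) e / 2 \<le> mon y n - mon x n - (\<Sum>l\<in>UNIV. dmon x n l * e l)"
    and "mon y n - mon x n - (\<Sum>l\<in>UNIV. dmon x n l * e l) \<le> quad (ddmon y n) e / 2"
    and "quad (ddmon x n) e / 2 \<le> (\<Sum>l\<in>UNIV. dmon y n l * e l) - (mon y n - mon x n)"
    and "(\<Sum>l\<in>UNIV. dmon y n l * e l) - (mon y n - mon x n) \<le> quad (ddmon y n) e / 2"
proof -
  let ?z = "\<lambda>t l. x l + t * e l"
  have z: "0 \<le> ?z s l" "?z s l \<le> ?z t l" "x l \<le> ?z s l" "?z t l \<le> y l" if "0 \<le> s" "s \<le> t" "t \<le> 1" for s t l
    using x[of l] that mult_left_le_one_le[of "e l" t]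
    by (auto simp: e_def intro!: mult_right_mono add_nonneg_nonneg mult_nonneg_nonneg)
  have e0: "0 \<le> e l" for l using x by (simp add: e_def)
  have diff: "(\<Sum>l\<in>UNIV. dmon (?z t) n l * e l) - (\<Sum>l\<in>UNIV. dmon (?z s) n l * e l) =
      (\<Sum>l\<in>UNIV. (dmon (?z t) n l - dmon (?z s) n l) * e l)" for s t
    by (simp add: sum_subtractf algebra_simps)
  have step: "(\<Sum>m\<in>UNIV. ddmon w n l m * (?z t m - ?z s m)) = (t - s) * (\<Sum>m\<in>UNIV. ddmon w n l m * e m)" for w s t l
    by (simp add: sum_distrib_left algebra_simps flip: sum_subtractf)
  have q: "quad (ddmon w n) e * r = (\<Sum>l\<in>UNIV. (r * (\<Sum>m\<in>UNIV. ddmon w n l m * e m)) * e l)" for w r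
    by (simp add: quad_def sum_distrib_left sum_distrib_right mult_ac)
  note T = taylor2_bounds[of "\<lambda>t. mon (?z t) n" "\<lambda>t. \<Sum>l\<in>UNIV. dmon (?z t) n l * e l"
      "quad (ddmon x n) e" "quad (ddmon y n) e", OF deriv_mon_line]
  have lo: "quad (ddmon x n) e * (t - s) \<le> (\<Sum>l\<in>UNIV. dmon (?z t) n l * e l) - (\<Sum>l\<in>UNIV. dmon (?z s) n l * e l)"
    if st: "0 \<le> s" "s \<le> t" "t \<le> 1" for s t
    unfolding diff q
  proof (intro sum_mono mult_right_mono e0)
    fix l
    have "(t - s) * (\<Sum>m\<in>UNIV. ddmon x n l m * e m) \<le> (t - s) * (\<Sum>m\<in>UNIV. ddmon (?z s) n l m * e m)"
      using z[OF st] x st by (intro mult_left_mono sum_mono mult_right_mono ddmon_mono e0) auto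
    also have "\<dots> \<le> dmon (?z t) n l - dmon (?z s) n l"
      using dmon_diff_bounds(1)[of "?z s" "?z t" n l] z[OF st] by (simp only: step)
    finally show "(t - s) * (\<Sum>m\<in>UNIV. ddmon x n l m * e m) \<le> dmon (?z t) n l - dmon (?z s) n l" .
  qed
  have hi: "(\<Sum>l\<in>UNIV. dmon (?z t) n l * e l) - (\<Sum>l\<in>UNIV. dmon (?z s) n l * e l) \<le> quad (ddmon y n) e * (t - s)"
    if st: "0 \<le> s" "s \<le> t" "t \<le> 1" for s t
    unfolding diff q
  proof (intro sum_mono mult_right_mono e0)
    fix l
    have "dmon (?z t) n l - dmon (?z s) n l \<le> (t - s) * (\<Sum>m\<in>UNIV. ddmon (?z t) n l m * e m)"
      using dmon_diff_bounds(2)[of "?z s" "?z t" n l] z[OF st] by (simp only: step)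
    also have "\<dots> \<le> (t - s) * (\<Sum>m\<in>UNIV. ddmon y n l m * e m)"
      using z[OF st] z(1)[of t t] x st by (intro mult_left_mono sum_mono mult_right_mono ddmon_mono e0) auto
    finally show "dmon (?z t) n l - dmon (?z s) n l \<le> (t - s) * (\<Sum>m\<in>UNIV. ddmon y n l m * e m)" .
  qed
  have z01: "?z 0 = x" "?z 1 = y" by (auto simp: e_def)
  show "quad (ddmon x n) e / 2 \<le> mon y n - mon x n - (\<Sum>l\<in>UNIV. dmon x n l * e l)"
    "mon y n - mon x n - (\<Sum>l\<in>UNIV. dmon x n l * e l) \<le> quad (ddmon y n) e / 2"
    "quad (ddmon x n) e / 2 \<le> (\<Sum>l\<in>UNIV. dmon y n l * e l) - (mon y n - mon x n)"
    "(\<Sum>l\<in>UNIV. dmon y n l * e l) - (mon y n - mon x n) \<le> quad (ddmon y n) e / 2"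
    using T[OF lo hi] unfolding z01 by auto
qed

text \<open>Moving a second derivative to the point 1 costs one more factor \<open>total n\<close>:
  this is where third moments enter.\<close>

lemma ddmon_one_diff:
  assumes x: "\<And>l. 0 \<le> x l" "\<And>l. x l \<le> 1"
  shows "ddmon (\<lambda>_. 1) n l m - ddmon x n l m \<le> real (total n) ^ 3 * (\<Sum>j\<in>UNIV. 1 - x j)"
proof -
  let ?n = "drop1 (drop1 n l) m"
  have "1 - mon x ?n \<le> (\<Sum>j\<in>UNIV. real (?n j) * (1 - x j))"
    using mon_diff_bounds(2)[of x "\<lambda>_. 1" ?n] x by (simp add: dmon_def)
  also have "\<dots> \<le> real (total n) * (\<Sum>j\<in>UNIV. 1 - x j)"
    using x by (intro drop1_drop1_total) auto
  finally have b: "1 - mon x ?n \<le> real (total n) * (\<Sum>j\<in>UNIV. 1 - x j)" .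
  have "ddmon (\<lambda>_. 1) n l m - ddmon x n l m = real (n l) * real (drop1 n l m) * (1 - mon x ?n)"
    by (simp add: ddmon_def dmon_def algebra_simps)
  also have "\<dots> \<le> (real (total n) * real (total n)) * (real (total n) * (\<Sum>j\<in>UNIV. 1 - x j))"
    using x by (intro mult_mono b) (auto simp: le_total drop1_le_total mon_le_1)
  also have "\<dots> = real (total n) ^ 3 * (\<Sum>j\<in>UNIV. 1 - x j)"
    by (simp add: power3_eq_cube)
  finally show ?thesis .
qed

text \<open>Replaces both endpoint Hessians by the one at 1, whose expectation is
  \<open>bcoef\<close>, at a price that is integrable under a third moment.\<close>

lemma mon_taylor2_error_bounds:
  fixes n :: "'d::finite \<Rightarrow> nat"
  assumes x: "\<And>l. 0 \<le> x l" "\<And>l. x l \<le> y l" and y: "\<And>l. y l \<le> 1"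
  defines "e \<equiv> \<lambda>l. y l - x l" and "\<delta> \<equiv> \<Sum>j\<in>UNIV. 1 - x j"
  defines "lo \<equiv> (quad (ddmon (\<lambda>_. 1) n) e - real (total n) ^ 3 * (\<delta> * (\<Sum>l\<in>UNIV. e l)\<^sup>2)) / 2"
    and "hi \<equiv> quad (ddmon (\<lambda>_. 1) n) e / 2"
  shows "lo \<le> mon y n - mon x n - (\<Sum>l\<in>UNIV. dmon x n l * e l)"
    and "mon y n - mon x n - (\<Sum>l\<in>UNIV. dmon x n l * e l) \<le> hi"
    and "lo \<le> (\<Sum>l\<in>UNIV. dmon y n l * e l) - (mon y n - mon x n)"
    and "(\<Sum>l\<in>UNIV. dmon y n l * e l) - (mon y n - mon x n) \<le> hi"
proof -
  have x1: "x l \<le> 1" and y0: "0 \<le> y l" and e0: "0 \<le> e l" for l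
    using x[of l] y[of l] by (auto simp: e_def)
  have mono: "quad B e \<le> quad B' e" if "\<And>l m. B l m \<le> B' l m" for B B'
    unfolding quad_def by (intro sum_mono mult_right_mono e0 that)
  have "quad (ddmon (\<lambda>_. 1) n) e - (real (total n) ^ 3 * \<delta>) * (\<Sum>l\<in>UNIV. e l)\<^sup>2 \<le> quad (ddmon x n) e"
    unfolding quad_minus_const[symmetric]
    by (rule mono) (use ddmon_one_diff[of x n, OF x(1) x1] in \<open>simp add: \<delta>_def algebra_simps\<close>)
  then have lo: "lo \<le> quad (ddmon x n) e / 2" by (simp add: lo_def mult.assoc)
  have hi: "quad (ddmon y n) e / 2 \<le> hi"
    unfolding hi_def by (intro divide_right_mono mono ddmon_mono y0 y) auto
  have e_app: "y l - x l = e l" for l by (simp add: e_def)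
  note T = mon_taylor2_bounds[of x y n, OF x, unfolded e_app]
  show "lo \<le> mon y n - mon x n - (\<Sum>l\<in>UNIV. dmon x n l * e l)"
    "lo \<le> (\<Sum>l\<in>UNIV. dmon y n l * e l) - (mon y n - mon x n)"
    by (rule order_trans[OF lo T(1)], rule order_trans[OF lo T(3)])
  show "mon y n - mon x n - (\<Sum>l\<in>UNIV. dmon x n l * e l) \<le> hi"
    "(\<Sum>l\<in>UNIV. dmon y n l * e l) - (mon y n - mon x n) \<le> hi"
    by (rule order_trans[OF T(2) hi], rule order_trans[OF T(4) hi])
qed

lemma dmon_diff_error_bounds:
  assumes x: "\<And>l. 0 \<le> x l" "\<And>l. x l \<le> y l" and y: "\<And>l. y l \<le> 1"
  defines "e \<equiv> \<lambda>l. y l - x l" and "\<delta> \<equiv> \<Sum>j\<in>UNIV. 1 - x j"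
  shows "(\<Sum>m\<in>UNIV. ddmon (\<lambda>_. 1) n l m * e m) - real (total n) ^ 3 * (\<delta> * (\<Sum>m\<in>UNIV. e m)) \<le> dmon y n l - dmon x n l"
    and "dmon y n l - dmon x n l \<le> (\<Sum>m\<in>UNIV. ddmon (\<lambda>_. 1) n l m * e m)"
proof -
  have x1: "x l \<le> 1" and y0: "0 \<le> y l" and e0: "0 \<le> e l" for l
    using x[of l] y[of l] by (auto simp: e_def)
  have "(\<Sum>m\<in>UNIV. ddmon (\<lambda>_. 1) n l m * e m) - real (total n) ^ 3 * (\<delta> * (\<Sum>m\<in>UNIV. e m))
     = (\<Sum>m\<in>UNIV. (ddmon (\<lambda>_. 1) n l m - real (total n) ^ 3 * \<delta>) * e m)"
    by (simp add: left_diff_distrib sum_subtractf sum_distrib_left mult.assoc)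
  also have "\<dots> \<le> (\<Sum>m\<in>UNIV. ddmon x n l m * e m)"
  proof (intro sum_mono mult_right_mono e0)
    show "ddmon (\<lambda>_. 1) n l m - real (total n) ^ 3 * \<delta> \<le> ddmon x n l m" for m
      using ddmon_one_diff[of x n l m, OF x(1) x1] by (simp add: \<delta>_def)
  qed
  also have "\<dots> \<le> dmon y n l - dmon x n l"
    unfolding e_def by (rule dmon_diff_bounds[OF x])
  finally show "(\<Sum>m\<in>UNIV. ddmon (\<lambda>_. 1) n l m * e m) - real (total n) ^ 3 * (\<delta> * (\<Sum>m\<in>UNIV. e m)) \<le> dmon y n l - dmon x n l" .
  have "dmon y n l - dmon x n l \<le> (\<Sum>m\<in>UNIV. ddmon y n l m * e m)"
    unfolding e_def by (rule dmon_diff_bounds[OF x])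
  also have "\<dots> \<le> (\<Sum>m\<in>UNIV. ddmon (\<lambda>_. 1) n l m * e m)"
    by (intro sum_mono mult_right_mono ddmon_mono y0 y e0)
  finally show "dmon y n l - dmon x n l \<le> (\<Sum>m\<in>UNIV. ddmon (\<lambda>_. 1) n l m * e m)" .
qed

text \<open>A raw moment of the total offspring number is used because it controls means, second
  derivatives and Taylor errors by one constant for the whole class.\<close>

definition moment3_le :: "real \<Rightarrow> ('d::finite) offspring \<Rightarrow> bool" where
  "moment3_le C p \<longleftrightarrow> (\<forall>k. integrable (measure_pmf (p k)) (\<lambda>n. real (total n) ^ 3) \<and>
     measure_pmf.expectation (p k) (\<lambda>n. real (total n) ^ 3) \<le> C)"

lemma pgf_mon: "pgf p s k = measure_pmf.expectation (p k) (mon s)"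
  by (simp add: pgf_def mon_def[abs_def])

lemma dpgf_dmon: "dpgf p s k l = measure_pmf.expectation (p k) (\<lambda>n. dmon s n l)"
  by (simp add: dpgf_def mon_def dmon_def drop1_def)

lemma bcoef_ddmon: "bcoef p k l m = measure_pmf.expectation (p k) (\<lambda>n. ddmon (\<lambda>_. 1) n l m)"
  unfolding bcoef_def fmom2_def
  by (subst integral_eq_nn_integral)
     (auto simp: ddmon_def dmon_def drop1_def ennreal_of_nat_eq_real_of_nat)

lemma pgf_one [simp]: "pgf p (\<lambda>_. 1) k = 1"
  by (simp add: pgf_mon mon_def[abs_def])

section \<open>Generating functions under a uniform third moment bound\<close>

context
  fixes C :: real and p :: "('d::finite) offspring"
  assumes C: "moment3_le C p"
begin

lemma integrable_cube: "integrable (measure_pmf (p k)) (\<lambda>n. real (total n) ^ 3)"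
  and integral_cube: "measure_pmf.expectation (p k) (\<lambda>n. real (total n) ^ 3) \<le> C"
  using C by (auto simp: moment3_le_def)

lemma moment_bound_nonneg: "0 \<le> C"
  by (rule order_trans[OF _ integral_cube]) (auto intro!: Bochner_Integration.integral_nonneg)

lemma integrable_bounded_cube:
  assumes "\<And>n. \<bar>f n\<bar> \<le> 1 + real (total n) ^ 3"
  shows "integrable (measure_pmf (p k)) (f :: _ \<Rightarrow> real)"
  by (rule Bochner_Integration.integrable_bound[OF Bochner_Integration.integrable_add[OF measure_pmf.integrable_const[of _ 1] integrable_cube]])
     (use assms in auto)

lemma total_le_cube: "real (total n) \<le> real (total n) ^ 3" "(real (total n))\<^sup>2 \<le> real (total n) ^ 3"
  using self_le_power[of "real (total n)" 3] power_increasing[of 2 3 "real (total n)"]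
  by (cases "total n = 0"; simp)+

lemma dmon_le_cube:
  assumes "\<And>l. 0 \<le> x l" "\<And>l. x l \<le> 1"
  shows "dmon x n l \<le> real (total n) ^ 3"
proof -
  have "dmon x n l \<le> real (total n) * 1"
    unfolding dmon_def using assms by (intro mult_mono) (auto simp: le_total mon_le_1 mon_nonneg)
  then show ?thesis using total_le_cube(1)[of n] by linarith
qed

lemma ddmon_le_cube:
  assumes "\<And>l. 0 \<le> x l" "\<And>l. x l \<le> 1"
  shows "ddmon x n l m \<le> real (total n) ^ 3"
proof -
  have "ddmon x n l m \<le> real (total n) * (real (total n) * 1)"
    unfolding ddmon_def dmon_def using assms
    by (intro mult_mono) (auto simp: le_total drop1_le_total mon_le_1 mon_nonneg)
  then show ?thesis using total_le_cube(2)[of n] by (simp add: power2_eq_square)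
qed

lemma integrable_mon:
  assumes "\<And>l. 0 \<le> x l" "\<And>l. x l \<le> 1"
  shows "integrable (measure_pmf (p k)) (mon x)"
  using assms mon_nonneg[of x] mon_le_1[of x] by (intro integrable_bounded_cube) (auto intro: add_increasing2)

lemma integrable_dmon:
  assumes "\<And>l. 0 \<le> x l" "\<And>l. x l \<le> 1"
  shows "integrable (measure_pmf (p k)) (\<lambda>n. dmon x n l)"
  using assms dmon_nonneg[of x] dmon_le_cube[of x] by (intro integrable_bounded_cube) (auto intro: add_increasing)

lemma integrable_ddmon:
  assumes "\<And>l. 0 \<le> x l" "\<And>l. x l \<le> 1"
  shows "integrable (measure_pmf (p k)) (\<lambda>n. ddmon x n l m)"
  using assms ddmon_nonneg[of x] ddmon_le_cube[of x] by (intro integrable_bounded_cube) (auto intro: add_increasing)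

lemma pgf_nonneg: "(\<And>l. 0 \<le> x l) \<Longrightarrow> 0 \<le> pgf p x k"
  unfolding pgf_mon by (intro Bochner_Integration.integral_nonneg) (auto simp: mon_nonneg)

lemma dpgf_nonneg: "(\<And>l. 0 \<le> x l) \<Longrightarrow> 0 \<le> dpgf p x k l"
  unfolding dpgf_dmon by (intro Bochner_Integration.integral_nonneg) (auto simp: dmon_nonneg)

lemma bcoef_nonneg: "0 \<le> bcoef p k l m"
  unfolding bcoef_ddmon by (intro Bochner_Integration.integral_nonneg) (auto simp: ddmon_nonneg)

lemma mean_mat_le: "mean_mat p k l \<le> C"
  unfolding mean_mat_def dpgf_dmon
  by (rule order_trans[OF integral_mono[OF integrable_dmon integrable_cube] integral_cube])
     (auto intro: dmon_le_cube)

lemma bcoef_le: "bcoef p k l m \<le> C"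
  unfolding bcoef_ddmon
  by (rule order_trans[OF integral_mono[OF integrable_ddmon integrable_cube] integral_cube])
     (auto intro: ddmon_le_cube)

context
  fixes x y e :: "'d \<Rightarrow> real"
  assumes x0: "\<And>l. 0 \<le> x l" and xy: "\<And>l. x l \<le> y l" and y1: "\<And>l. y l \<le> 1"
  defines "e \<equiv> \<lambda>l. y l - x l"
begin

private lemma x1: "x l \<le> 1" and y0: "0 \<le> y l" and e0: "0 \<le> e l"
  using x0[of l] xy[of l] y1[of l] by (auto simp: e_def)

private lemma e_app: "y l - x l = e l"
  by (simp add: e_def)

private lemmas ints = integrable_mon[OF x0 x1] integrable_mon[OF y0 y1] integrable_dmon[OF x0 x1]
  integrable_dmon[OF y0 y1] integrable_ddmon[of "\<lambda>_. 1", simplified] integrable_cube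

private lemmas int_intros = integral_mono Bochner_Integration.integrable_sum Bochner_Integration.integrable_diff
  integrable_mult_left integrable_divide_zero ints

lemma pgf_mono: "pgf p x k \<le> pgf p y k"
  unfolding pgf_mon by (intro int_intros mon_mono x0 xy)

lemma dpgf_mono: "dpgf p x k l \<le> dpgf p y k l"
  unfolding dpgf_dmon by (intro int_intros dmon_mono x0 xy)

lemma pgf_diff_ge: "mv (dpgf p x) e k \<le> pgf p y k - pgf p x k"
proof -
  have "measure_pmf.expectation (p k) (\<lambda>n. \<Sum>l\<in>UNIV. dmon x n l * e l) \<le> measure_pmf.expectation (p k) (\<lambda>n. mon y n - mon x n)"
    unfolding e_def by (intro int_intros mon_diff_bounds x0 xy)
  then show ?thesis by (simp add: mv_def dpgf_dmon pgf_mon ints)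
qed

lemma pgf_diff_le: "pgf p y k - pgf p x k \<le> mv (dpgf p y) e k"
proof -
  have "measure_pmf.expectation (p k) (\<lambda>n. mon y n - mon x n) \<le> measure_pmf.expectation (p k) (\<lambda>n. \<Sum>l\<in>UNIV. dmon y n l * e l)"
    unfolding e_def by (intro int_intros mon_diff_bounds x0 xy)
  then show ?thesis by (simp add: mv_def dpgf_dmon pgf_mon ints)
qed

private lemma quad_bcoef: "quad (bcoef p k) e = measure_pmf.expectation (p k) (\<lambda>n. quad (ddmon (\<lambda>_. 1) n) e)"
  by (simp add: quad_def bcoef_ddmon ints)

private lemma integrable_quad: "integrable (measure_pmf (p k)) (\<lambda>n. quad (ddmon (\<lambda>_. 1) n) e)"
  unfolding quad_def by (intro int_intros)

private lemma cube_error: "0 \<le> r \<Longrightarrow> a - C * r \<le> a - measure_pmf.expectation (p k) (\<lambda>n. real (total n) ^ 3) * r"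
  using mult_right_mono[OF integral_cube] by simp

private lemma delta_nonneg: "0 \<le> (\<Sum>j\<in>UNIV. 1 - x j)"
  by (intro sum_nonneg) (simp add: x1)

private lemma lower:
  "(quad (bcoef p k) e - C * (\<Sum>j\<in>UNIV. 1 - x j) * (\<Sum>l\<in>UNIV. e l)\<^sup>2) / 2 \<le>
   measure_pmf.expectation (p k) (\<lambda>n. (quad (ddmon (\<lambda>_. 1) n) e -
     real (total n) ^ 3 * ((\<Sum>j\<in>UNIV. 1 - x j) * (\<Sum>l\<in>UNIV. e l)\<^sup>2)) / 2)"
  using cube_error[of "(\<Sum>j\<in>UNIV. 1 - x j) * (\<Sum>l\<in>UNIV. e l)\<^sup>2" "quad (bcoef p k) e" k]
    mult_nonneg_nonneg[OF delta_nonneg zero_le_power2]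
  by (simp add: quad_bcoef integrable_quad integrable_cube mult_ac del: sum_subtractf)

text \<open>Gradient at the lower point \<open>x\<close>: used to compare the fixed point for
  weights \<open>s\<close> with the larger one for weights 1, linearising at the smaller of the
  two.\<close>

lemma pgf_taylor_low:
  "(quad (bcoef p k) e - C * (\<Sum>j\<in>UNIV. 1 - x j) * (\<Sum>l\<in>UNIV. e l)\<^sup>2) / 2
     \<le> pgf p y k - pgf p x k - mv (dpgf p x) e k"
  "pgf p y k - pgf p x k - mv (dpgf p x) e k \<le> quad (bcoef p k) e / 2"
proof -
  have eq: "pgf p y k - pgf p x k - mv (dpgf p x) e k =
     measure_pmf.expectation (p k) (\<lambda>n. mon y n - mon x n - (\<Sum>l\<in>UNIV. dmon x n l * e l))"
    by (simp add: pgf_mon mv_def dpgf_dmon ints)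
  note T = mon_taylor2_error_bounds[of x y, OF x0 xy y1, unfolded e_app]
  show "(quad (bcoef p k) e - C * (\<Sum>j\<in>UNIV. 1 - x j) * (\<Sum>l\<in>UNIV. e l)\<^sup>2) / 2
     \<le> pgf p y k - pgf p x k - mv (dpgf p x) e k"
    unfolding eq by (rule order_trans[OF lower]) (intro int_intros integrable_quad T)
  show "pgf p y k - pgf p x k - mv (dpgf p x) e k \<le> quad (bcoef p k) e / 2"
    unfolding eq quad_bcoef integral_divide_zero[symmetric] by (intro int_intros integrable_quad T)
qed

text \<open>Gradient at the upper point \<open>y\<close>: used for iterates below their fixed point,
  linearising at the fixed point.\<close>

lemma pgf_taylor_high:
  "(quad (bcoef p k) e - C * (\<Sum>j\<in>UNIV. 1 - x j) * (\<Sum>l\<in>UNIV. e l)\<^sup>2) / 2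
     \<le> mv (dpgf p y) e k - (pgf p y k - pgf p x k)"
  "mv (dpgf p y) e k - (pgf p y k - pgf p x k) \<le> quad (bcoef p k) e / 2"
proof -
  have eq: "mv (dpgf p y) e k - (pgf p y k - pgf p x k) =
     measure_pmf.expectation (p k) (\<lambda>n. (\<Sum>l\<in>UNIV. dmon y n l * e l) - (mon y n - mon x n))"
    by (simp add: pgf_mon mv_def dpgf_dmon ints)
  note T = mon_taylor2_error_bounds[of x y, OF x0 xy y1, unfolded e_app]
  show "(quad (bcoef p k) e - C * (\<Sum>j\<in>UNIV. 1 - x j) * (\<Sum>l\<in>UNIV. e l)\<^sup>2) / 2
     \<le> mv (dpgf p y) e k - (pgf p y k - pgf p x k)"
    unfolding eq by (rule order_trans[OF lower]) (intro int_intros integrable_quad T)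
  show "mv (dpgf p y) e k - (pgf p y k - pgf p x k) \<le> quad (bcoef p k) e / 2"
    unfolding eq quad_bcoef integral_divide_zero[symmetric] by (intro int_intros integrable_quad T)
qed

lemma dpgf_diff_bounds:
  "(\<Sum>m\<in>UNIV. bcoef p k l m * e m) - C * (\<Sum>j\<in>UNIV. 1 - x j) * (\<Sum>m\<in>UNIV. e m) \<le> dpgf p y k l - dpgf p x k l"
  "dpgf p y k l - dpgf p x k l \<le> (\<Sum>m\<in>UNIV. bcoef p k l m * e m)"
proof -
  have eq: "dpgf p y k l - dpgf p x k l = measure_pmf.expectation (p k) (\<lambda>n. dmon y n l - dmon x n l)"
    by (simp add: dpgf_dmon ints)
  have b: "(\<Sum>m\<in>UNIV. bcoef p k l m * e m) = measure_pmf.expectation (p k) (\<lambda>n. \<Sum>m\<in>UNIV. ddmon (\<lambda>_. 1) n l m * e m)"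
    by (simp add: bcoef_ddmon ints)
  note T = dmon_diff_error_bounds[of x y, OF x0 xy y1, unfolded e_app]
  show "dpgf p y k l - dpgf p x k l \<le> (\<Sum>m\<in>UNIV. bcoef p k l m * e m)"
    unfolding eq b by (intro int_intros T)
  let ?r = "(\<Sum>j\<in>UNIV. 1 - x j) * (\<Sum>m\<in>UNIV. e m)"
  have "(\<Sum>m\<in>UNIV. bcoef p k l m * e m) - C * ?r \<le>
      (\<Sum>m\<in>UNIV. bcoef p k l m * e m) - measure_pmf.expectation (p k) (\<lambda>n. real (total n) ^ 3) * ?r"
    by (intro cube_error mult_nonneg_nonneg delta_nonneg sum_nonneg e0)
  also have "\<dots> = measure_pmf.expectation (p k) (\<lambda>n. (\<Sum>m\<in>UNIV. ddmon (\<lambda>_. 1) n l m * e m) - real (total n) ^ 3 * ?r)"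
    by (simp add: bcoef_ddmon ints del: sum_subtractf)
  also have "\<dots> \<le> dpgf p y k l - dpgf p x k l"
    unfolding eq by (intro int_intros T)
  finally show "(\<Sum>m\<in>UNIV. bcoef p k l m * e m) - C * (\<Sum>j\<in>UNIV. 1 - x j) * (\<Sum>m\<in>UNIV. e m) \<le> dpgf p y k l - dpgf p x k l"
    by (simp only: mult.assoc)
qed

end

lemma pgf_le_1:
  assumes "\<And>l. 0 \<le> x l" "\<And>l. x l \<le> 1"
  shows "pgf p x k \<le> 1"
  using pgf_mono[of x "\<lambda>_. 1" k] assms by simp

end

text \<open>Sum out one index at a time: when the preceding factors are nonzero, the truncated
  differences are genuine and add up to the total minus 2 or minus 1.\<close>

lemma factorial_moment3_sum:
  fixes n :: "'d::finite \<Rightarrow> nat"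
  shows "(\<Sum>l\<in>UNIV. \<Sum>m\<in>UNIV. \<Sum>j\<in>UNIV. n l * (n m - unit_vec l m) * (n j - unit_vec l j - unit_vec m j))
    = total n * (total n - 1) * (total n - 2)"
proof -
  have u1: "(\<Sum>j\<in>UNIV. unit_vec l j) = 1" for l :: 'd
    by (simp add: unit_vec_def)
  have inner: "n l * (n m - unit_vec l m) * (\<Sum>j\<in>UNIV. n j - unit_vec l j - unit_vec m j)
     = n l * (n m - unit_vec l m) * (total n - 2)" for l m
  proof (cases "n l * (n m - unit_vec l m) = 0")
    case False
    then have le: "unit_vec l j + unit_vec m j \<le> n j" for j
      by (auto simp: unit_vec_def split: if_splits)
    have "(\<Sum>j\<in>UNIV. n j - unit_vec l j - unit_vec m j) = (\<Sum>j\<in>UNIV. n j - (unit_vec l j + unit_vec m j))"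
      by simp
    also have "\<dots> = total n - (\<Sum>j\<in>UNIV. unit_vec l j + unit_vec m j)"
      unfolding total_def by (rule sum_subtractf_nat) (rule le)
    also have "(\<Sum>j\<in>UNIV. unit_vec l j + unit_vec m j) = 2"
      by (simp add: sum.distrib u1)
    finally show ?thesis by simp
  qed auto
  have mid: "n l * (\<Sum>m\<in>UNIV. n m - unit_vec l m) = n l * (total n - 1)" for l
  proof (cases "n l = 0")
    case False
    then have "(\<Sum>m\<in>UNIV. n m - unit_vec l m) = total n - (\<Sum>m\<in>UNIV. unit_vec l m)"
      unfolding total_def by (intro sum_subtractf_nat) (auto simp: unit_vec_def)
    then show ?thesis by (simp add: u1)
  qed auto
  have "(\<Sum>l\<in>UNIV. \<Sum>m\<in>UNIV. \<Sum>j\<in>UNIV. n l * (n m - unit_vec l m) * (n j - unit_vec l j - unit_vec m j))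
    = (\<Sum>l\<in>UNIV. (n l * (\<Sum>m\<in>UNIV. n m - unit_vec l m)) * (total n - 2))"
    by (simp only: sum_distrib_left[symmetric] inner) (simp only: sum_distrib_right sum_distrib_left)
  also have "\<dots> = (\<Sum>l\<in>UNIV. n l) * (total n - 1) * (total n - 2)"
    by (simp only: mid sum_distrib_right)
  finally show ?thesis by (simp add: total_def)
qed

lemma in_K_moment3:
  assumes K: "in_K a b c U p" and c: "0 < c"
  shows "moment3_le (8 + 5 * c) p"
  unfolding moment3_le_def
proof
  fix k
  \<comment> \<open>Values up to 2 are covered by 8 = 2^3; beyond them N^2 / ((N - 1) (N - 2)) is
    largest at N = 3, where it is 4.5.\<close>
  have cube: "N ^ 3 \<le> 8 + 5 * (N * (N - 1) * (N - 2))" for N :: nat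
  proof (cases "N \<le> 2")
    case True
    then have "N ^ 3 \<le> 2 ^ 3" by (rule power_mono) simp
    then show ?thesis by simp
  next
    case False
    then obtain i where "N = i + 3" by (metis add.commute le_Suc_ex not_less_eq_eq numeral_2_eq_2 numeral_3_eq_3)
    then show ?thesis by (simp add: power3_eq_cube algebra_simps)
  qed
  let ?g = "\<lambda>k. \<Sum>l\<in>UNIV. \<Sum>m\<in>UNIV. \<Sum>j\<in>UNIV. fmom3 p k l m j"
  have "?g k \<le> (\<Sum>k\<in>UNIV. ?g k)"
    by (rule member_le_sum) auto
  also have "\<dots> \<le> ennreal c" using K by (simp add: in_K_def)
  finally have g: "?g k \<le> ennreal c" .
  have "?g k = (\<integral>\<^sup>+ \<xi>. of_nat (total \<xi> * (total \<xi> - 1) * (total \<xi> - 2)) \<partial>measure_pmf (p k))"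
    unfolding fmom3_def factorial_moment3_sum[symmetric] by (simp add: nn_integral_sum)
  with g have g: "(\<integral>\<^sup>+ \<xi>. of_nat (total \<xi> * (total \<xi> - 1) * (total \<xi> - 2)) \<partial>measure_pmf (p k)) \<le> ennreal c"
    by simp
  have "(\<integral>\<^sup>+ \<xi>. ennreal (real (total \<xi>) ^ 3) \<partial>measure_pmf (p k)) =
      (\<integral>\<^sup>+ \<xi>. of_nat (total \<xi> ^ 3) \<partial>measure_pmf (p k))"
    by (intro nn_integral_cong) (simp add: ennreal_of_nat_eq_real_of_nat)
  also have "\<dots> \<le> (\<integral>\<^sup>+ \<xi>. of_nat (8 + 5 * (total \<xi> * (total \<xi> - 1) * (total \<xi> - 2))) \<partial>measure_pmf (p k))"
    by (intro nn_integral_mono of_nat_mono cube)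
  also have "\<dots> = (\<integral>\<^sup>+ \<xi>. 8 + 5 * of_nat (total \<xi> * (total \<xi> - 1) * (total \<xi> - 2)) \<partial>measure_pmf (p k))"
    by (intro nn_integral_cong) (simp del: of_nat_diff)
  also have "\<dots> = 8 + 5 * (\<integral>\<^sup>+ \<xi>. of_nat (total \<xi> * (total \<xi> - 1) * (total \<xi> - 2)) \<partial>measure_pmf (p k))"
    by (simp add: nn_integral_add nn_integral_cmult measure_pmf.emeasure_space_1 del: of_nat_mult)
  also have "\<dots> \<le> 8 + 5 * ennreal c"
    using g by (intro add_left_mono mult_left_mono) auto
  also have "\<dots> = ennreal (8 + 5 * c)"
    using c by (simp add: ennreal_plus ennreal_mult' flip: ennreal_numeral)
  finally have le: "(\<integral>\<^sup>+ \<xi>. ennreal (real (total \<xi>) ^ 3) \<partial>measure_pmf (p k)) \<le> ennreal (8 + 5 * c)" .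
  then have int: "integrable (measure_pmf (p k)) (\<lambda>n. real (total n) ^ 3)"
    by (intro integrableI_bounded) (auto simp: le_less_trans)
  moreover have "measure_pmf.expectation (p k) (\<lambda>n. real (total n) ^ 3) \<le> 8 + 5 * c"
  proof -
    have "(\<integral>\<^sup>+ \<xi>. ennreal (real (total \<xi>) ^ 3) \<partial>measure_pmf (p k)) =
        ennreal (measure_pmf.expectation (p k) (\<lambda>n. real (total n) ^ 3))"
      by (rule nn_integral_eq_integral[OF int]) simp
    with le have "ennreal (measure_pmf.expectation (p k) (\<lambda>n. real (total n) ^ 3)) \<le> ennreal (8 + 5 * c)"
      by (simp only:)
    then show ?thesis
      by (subst (asm) ennreal_le_iff) (use c in auto)
  qed
  ultimately show "integrable (measure_pmf (p k)) (\<lambda>n. real (total n) ^ 3) \<and>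
      measure_pmf.expectation (p k) (\<lambda>n. real (total n) ^ 3) \<le> 8 + 5 * c" by blast
qed

section \<open>Near-critical sequences\<close>

lemma quad_scale: "quad B (\<lambda>l. c * e l) = c\<^sup>2 * quad B e"
  by (simp add: quad_def sum_distrib_left power2_eq_square mult_ac)

lemma quad_divide: "quad B (\<lambda>l. e l / c) = quad B e / c\<^sup>2"
  using quad_scale[of B "inverse c" e] by (simp add: field_simps power_inverse)

lemma quad_le:
  assumes "\<And>l m. B l m \<le> C" "\<And>l. 0 \<le> e l"
  shows "quad B e \<le> C * (\<Sum>l\<in>UNIV. e l)\<^sup>2"
proof -
  have "quad B e \<le> quad (\<lambda>l m. C) e"
    unfolding quad_def by (intro sum_mono mult_right_mono assms)
  also have "\<dots> = C * (\<Sum>l\<in>UNIV. e l)\<^sup>2"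
    by (simp add: quad_def power2_eq_square sum_product sum_distrib_left mult_ac)
  finally show ?thesis .
qed

lemma tendsto_quad:
  assumes "\<And>i j. ((\<lambda>n. B n i j) \<longlongrightarrow> B' i j) F" "\<And>l. ((\<lambda>n. e n l) \<longlongrightarrow> e' l) F"
  shows "((\<lambda>n. quad (B n) (e n)) \<longlongrightarrow> quad B' e') F"
  unfolding quad_def by (intro tendsto_intros assms)

context
  fixes C :: real and p :: "('d::finite) offspring" and s :: "'d \<Rightarrow> real"
  assumes C: "moment3_le C p" and s: "\<And>l. 0 \<le> s l" "\<And>l. s l \<le> 1"
begin

lemma hseq_bounds: "0 \<le> hseq p s n l \<and> hseq p s n l \<le> 1"
proof (induction n arbitrary: l)
  case (Suc n)
  have "0 \<le> pgf p (hseq p s n) l" "pgf p (hseq p s n) l \<le> 1"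
    using pgf_nonneg[OF C] pgf_le_1[OF C] Suc by auto
  then show ?case using s[of l] by (auto intro: mult_le_one)
qed simp

lemma hseq_nonneg: "0 \<le> hseq p s n l" and hseq_le_1: "hseq p s n l \<le> 1"
  using hseq_bounds by auto

lemma hseq_Suc_ge: "hseq p s n l \<le> hseq p s (Suc n) l"
proof (induction n arbitrary: l)
  case 0
  show ?case using hseq_nonneg[of "Suc 0" l] by simp
next
  case (Suc n)
  have "pgf p (hseq p s n) l \<le> pgf p (hseq p s (Suc n)) l"
    by (intro pgf_mono[OF C] hseq_nonneg hseq_le_1 Suc)
  then show ?case using s(1)[of l] by (simp add: mult_left_mono)
qed

lemma hseq_incseq: "incseq (\<lambda>n. hseq p s n l)"
  by (rule incseq_SucI) (rule hseq_Suc_ge)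

lemma hseq_lim: "(\<lambda>n. hseq p s n l) \<longlonglongrightarrow> hstar p s l"
proof -
  have "convergent (\<lambda>n. hseq p s n l)"
    by (rule Bseq_mono_convergent)
       (auto intro!: BseqI'[of _ 1] simp: hseq_nonneg hseq_le_1 incseqD[OF hseq_incseq])
  then show ?thesis by (simp add: hstar_def convergent_LIMSEQ_iff)
qed

lemma hseq_le_hstar: "hseq p s n l \<le> hstar p s l"
  by (rule incseq_le[OF hseq_incseq hseq_lim])

lemma hstar_nonneg: "0 \<le> hstar p s l"
  using hseq_le_hstar[of 0 l] by simp

lemma hstar_le_1: "hstar p s l \<le> 1"
  by (rule LIMSEQ_le_const2[OF hseq_lim]) (auto intro: hseq_le_1)

text \<open>The limit passes through the generating function because the mean value bound, with the
  gradient at the limit point, forces the increment to 0.\<close>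

lemma hstar_fixpoint: "hstar p s l = s l * pgf p (hstar p s) l"
proof -
  let ?e = "\<lambda>n l. hstar p s l - hseq p s n l"
  have "(\<lambda>n. mv (dpgf p (hstar p s)) (?e n) l) \<longlonglongrightarrow> mv (dpgf p (hstar p s)) (\<lambda>l. hstar p s l - hstar p s l) l"
    by (intro tendsto_mv tendsto_intros hseq_lim)
  then have "(\<lambda>n. mv (dpgf p (hstar p s)) (?e n) l) \<longlonglongrightarrow> 0"
    by (simp add: mv_def)
  then have "(\<lambda>n. pgf p (hstar p s) l - pgf p (hseq p s n) l) \<longlonglongrightarrow> 0"
    by (rule tendsto_sandwich[OF _ _ tendsto_const, rotated 2])
       (auto intro!: always_eventually pgf_mono[OF C] pgf_diff_le[OF C] hseq_nonneg hseq_le_hstar hstar_le_1)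
  from tendsto_diff[OF tendsto_const[of "pgf p (hstar p s) l"] this]
  have "(\<lambda>n. s l * pgf p (hseq p s n) l) \<longlonglongrightarrow> s l * pgf p (hstar p s) l"
    by (intro tendsto_intros) simp
  moreover have "(\<lambda>n. s l * pgf p (hseq p s n) l) \<longlonglongrightarrow> hstar p s l"
    using LIMSEQ_Suc[OF hseq_lim[of l]] by simp
  ultimately show ?thesis using LIMSEQ_unique by blast
qed

end

text \<open>The data left after passing to a subsequence: fixed limits \<open>A\<close> and
  \<open>B\<close> let every approximation refer to one pair of Perron vectors and one constant
  \<open>Q\<close>. \<open>B_nonzero\<close> is the trace of the lower bound on second derivatives
  and makes \<open>Q\<close> positive.\<close>

locale near_critical =
  fixes p :: "nat \<Rightarrow> ('d::finite) offspring" and C :: real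
    and A :: "'d \<Rightarrow> 'd \<Rightarrow> real" and B :: "'d \<Rightarrow> 'd \<Rightarrow> 'd \<Rightarrow> real"
  assumes moment: "\<And>k. moment3_le C (p k)"
    and mean_lim: "\<And>i j. (\<lambda>k. mean_mat (p k) i j) \<longlonglongrightarrow> A i j"
    and bcoef_lim: "\<And>l i j. (\<lambda>k. bcoef (p k) l i j) \<longlonglongrightarrow> B l i j"
    and A_primitive: "primitive A" and A_root: "perron_root A = 1"
    and B_nonzero: "\<exists>l i j. B l i j \<noteq> 0"
begin

definition u where "u = right_pvec A"
definition v where "v = left_pvec A"
definition Q where "Q = dot v (\<lambda>l. quad (B l) u) / 2"

lemma u_pos: "0 < u i" and v_pos: "0 < v i" and vu: "dot v u = 1"
  and Au: "mv A u = u" and vA: "mv (tr A) v = v"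
  using right_pvec_pos[OF A_primitive] left_pvec_pos[OF A_primitive] left_right_pvec[OF A_primitive]
    right_pvec_eigen[OF A_primitive] left_pvec_eigen[OF A_primitive]
  by (simp_all add: u_def v_def A_root)

lemma v_nonneg: "0 \<le> v i" using v_pos[of i] by simp

lemma A_nonneg: "0 \<le> A i j"
  using A_primitive by (simp add: primitive_def)

lemma dot_v_mv_A: "dot v (mv A x) = dot v x"
  by (simp add: dot_mv vA)

lemma C_nonneg: "0 \<le> C"
  using moment_bound_nonneg[OF moment[of 0]] .

lemma B_nonneg: "0 \<le> B l i j"
  by (rule LIMSEQ_le_const[OF bcoef_lim]) (auto intro: bcoef_nonneg[OF moment])

lemma quad_B_nonneg: "(\<And>l. 0 \<le> e l) \<Longrightarrow> 0 \<le> quad (B l) e"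
  unfolding quad_def by (intro sum_nonneg mult_nonneg_nonneg B_nonneg)

lemma Q_pos: "0 < Q"
proof -
  obtain l i j where lij: "B l i j \<noteq> 0" using B_nonzero by blast
  have "0 < B l i j * u i * u j"
    using lij B_nonneg[of l i j] u_pos by (intro mult_pos_pos) auto
  also have "\<dots> \<le> (\<Sum>m\<in>UNIV. B l i m * u i * u m)"
    by (rule member_le_sum) (auto intro!: mult_nonneg_nonneg B_nonneg less_imp_le[OF u_pos])
  also have "\<dots> \<le> quad (B l) u"
    unfolding quad_def
    by (rule member_le_sum[of i UNIV "\<lambda>i. \<Sum>m\<in>UNIV. B l i m * u i * u m"])
       (auto intro!: sum_nonneg mult_nonneg_nonneg B_nonneg less_imp_le[OF u_pos])
  finally have "quad (B l) u \<noteq> 0" by simp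
  then show ?thesis
    unfolding Q_def using dot_pos[of v "\<lambda>l. quad (B l) u" l] v_pos quad_B_nonneg u_pos
    by (simp add: less_imp_le)
qed

section \<open>Gradients near 1 along an arbitrary filter\<close>

context
  fixes G :: "'g filter" and K :: "'g \<Rightarrow> nat" and X Y :: "'g \<Rightarrow> 'd \<Rightarrow> real"
  assumes K: "filterlim K sequentially G"
    and X0: "\<And>g l. 0 \<le> X g l" and XY: "\<And>g l. X g l \<le> Y g l" and Y1: "\<And>g l. Y g l \<le> 1"
    and XL: "\<And>l. ((\<lambda>g. X g l) \<longlongrightarrow> 1) G"
begin

lemma Y_lim: "((\<lambda>g. Y g l) \<longlongrightarrow> 1) G"
  by (rule tendsto_sandwich[OF _ _ XL[of l] tendsto_const]) (auto simp: XY Y1)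

lemma eta_lim: "((\<lambda>g. C * (\<Sum>j\<in>UNIV. 1 - X g j)) \<longlongrightarrow> 0) G"
proof -
  have "((\<lambda>g. C * (\<Sum>j\<in>UNIV. 1 - X g j)) \<longlongrightarrow> C * (\<Sum>j\<in>(UNIV::'d set). 1 - 1)) G"
    by (intro tendsto_intros XL)
  then show ?thesis by simp
qed

text \<open>Second derivatives are at most \<open>C\<close>, so gradients are Lipschitz uniformly
  over the laws. The filter is left arbitrary because fixed points give simple sequences and
  iterates give double ones.\<close>

lemma dpgf_lim: "((\<lambda>g. dpgf (p (K g)) (X g) i j) \<longlongrightarrow> A i j) G"
proof -
  have X1: "X g l \<le> 1" for g l using XY[of g l] Y1[of g l] by simp
  have lim: "((\<lambda>g. mean_mat (p (K g)) i j) \<longlongrightarrow> A i j) G"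
    by (rule filterlim_compose[OF mean_lim K])
  have "((\<lambda>g. mean_mat (p (K g)) i j - C * (\<Sum>j\<in>UNIV. 1 - X g j)) \<longlongrightarrow> A i j - 0) G"
    by (intro tendsto_diff lim eta_lim)
  then have low: "((\<lambda>g. mean_mat (p (K g)) i j - C * (\<Sum>j\<in>UNIV. 1 - X g j)) \<longlongrightarrow> A i j) G"
    by simp
  show ?thesis
  proof (rule tendsto_sandwich[OF _ _ low lim])
    show "\<forall>\<^sub>F g in G. dpgf (p (K g)) (X g) i j \<le> mean_mat (p (K g)) i j"
      unfolding mean_mat_def by (intro always_eventually allI dpgf_mono[OF moment] X0 X1) auto
    show "\<forall>\<^sub>F g in G. mean_mat (p (K g)) i j - C * (\<Sum>j\<in>UNIV. 1 - X g j) \<le> dpgf (p (K g)) (X g) i j"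
    proof (intro always_eventually allI)
      fix g
      have "mean_mat (p (K g)) i j - dpgf (p (K g)) (X g) i j \<le> (\<Sum>m\<in>UNIV. bcoef (p (K g)) i j m * (1 - X g m))"
        unfolding mean_mat_def by (rule dpgf_diff_bounds(2)[OF moment]) (auto simp: X0 X1)
      also have "\<dots> \<le> (\<Sum>m\<in>UNIV. C * (1 - X g m))"
        by (intro sum_mono mult_right_mono bcoef_le[OF moment]) (auto simp: X1)
      also have "\<dots> = C * (\<Sum>j\<in>UNIV. 1 - X g j)"
        by (simp only: sum_distrib_left)
      finally show "mean_mat (p (K g)) i j - C * (\<Sum>j\<in>UNIV. 1 - X g j) \<le> dpgf (p (K g)) (X g) i j"
        by linarith
    qed
  qed
qed

end

section \<open>Increments between two points tending to 1\<close>

context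
  fixes G :: "'g filter" and K :: "'g \<Rightarrow> nat" and X Y :: "'g \<Rightarrow> 'd \<Rightarrow> real" and e t
  assumes K: "filterlim K sequentially G"
    and X0: "\<And>g l. 0 \<le> X g l" and XY: "\<And>g l. X g l \<le> Y g l" and Y1: "\<And>g l. Y g l \<le> 1"
    and XL: "\<And>l. ((\<lambda>g. X g l) \<longlongrightarrow> 1) G"
  defines "e \<equiv> \<lambda>g l. Y g l - X g l" and "t \<equiv> \<lambda>g. dot v (e g)"
begin

lemma e_nonneg: "0 \<le> e g l" using XY by (simp add: e_def)

lemma t_nonneg: "0 \<le> t g"
  unfolding t_def by (intro dot_nonneg v_nonneg e_nonneg)

lemma e_ratio: "e g l / t g \<le> 1 / v l"
proof -
  have "v l * e g l \<le> t g"
    unfolding t_def by (intro dot_ge_component v_nonneg e_nonneg)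
  then show ?thesis
    using v_pos[of l] t_nonneg[of g] by (cases "t g = 0") (auto simp: field_simps)
qed

lemma dpgf_lim_X: "((\<lambda>g. dpgf (p (K g)) (X g) i j) \<longlongrightarrow> A i j) G"
  by (rule dpgf_lim[OF K X0 XY Y1 XL])

lemma dpgf_lim_Y: "((\<lambda>g. dpgf (p (K g)) (Y g) i j) \<longlongrightarrow> A i j) G"
  by (rule dpgf_lim[OF K _ _ Y1 Y_lim[OF K X0 XY Y1 XL]]) (auto intro: order_trans[OF X0 XY])

text \<open>The increment lies between its linearisations at \<open>X\<close> and at
  \<open>Y\<close>, both tending to \<open>A\<close>. Only boundedness of \<open>e / t\<close>
  enters, so this is available before the direction of \<open>e\<close> is known and can feed
  \<open>perron_direction\<close>.\<close>

lemma pgf_increment_linear: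
  "((\<lambda>g. (pgf (p (K g)) (Y g) l - pgf (p (K g)) (X g) l - mv A (e g) l) / t g) \<longlongrightarrow> 0) G"
proof (rule Lim_null_comparison)
  let ?r = "\<lambda>g m. \<bar>dpgf (p (K g)) (X g) l m - A l m\<bar> + \<bar>dpgf (p (K g)) (Y g) l m - A l m\<bar>"
  have "((\<lambda>g. \<Sum>m\<in>UNIV. ?r g m * (1 / v m)) \<longlongrightarrow> (\<Sum>m\<in>UNIV. (\<bar>A l m - A l m\<bar> + \<bar>A l m - A l m\<bar>) * (1 / v m))) G"
    by (intro tendsto_intros dpgf_lim_X dpgf_lim_Y) (use v_pos in \<open>auto simp: less_le\<close>)
  then show "((\<lambda>g. \<Sum>m\<in>UNIV. ?r g m * (1 / v m)) \<longlongrightarrow> 0) G" by simp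
  show "\<forall>\<^sub>F g in G. norm ((pgf (p (K g)) (Y g) l - pgf (p (K g)) (X g) l - mv A (e g) l) / t g)
      \<le> (\<Sum>m\<in>UNIV. ?r g m * (1 / v m))"
  proof (intro always_eventually allI)
    fix g
    let ?D = "pgf (p (K g)) (Y g) l - pgf (p (K g)) (X g) l"
    have D: "mv (dpgf (p (K g)) (X g)) (e g) l \<le> ?D" "?D \<le> mv (dpgf (p (K g)) (Y g)) (e g) l"
      unfolding e_def by (intro pgf_diff_ge[OF moment] pgf_diff_le[OF moment] X0 XY Y1)+
    have d: "\<bar>mv (dpgf (p (K g)) Z) (e g) l - mv A (e g) l\<bar> \<le> (\<Sum>m\<in>UNIV. \<bar>dpgf (p (K g)) Z l m - A l m\<bar> * e g m)" for Z
    proof -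
      have "mv (dpgf (p (K g)) Z) (e g) l - mv A (e g) l = (\<Sum>m\<in>UNIV. (dpgf (p (K g)) Z l m - A l m) * e g m)"
        by (simp add: mv_def left_diff_distrib sum_subtractf)
      then show ?thesis
        using sum_abs[of "\<lambda>m. (dpgf (p (K g)) Z l m - A l m) * e g m" UNIV] by (simp add: abs_mult e_nonneg)
    qed
    have nn: "0 \<le> (\<Sum>m\<in>UNIV. \<bar>dpgf (p (K g)) Z l m - A l m\<bar> * e g m)" for Z
      by (intro sum_nonneg mult_nonneg_nonneg e_nonneg) auto
    have "(\<Sum>m\<in>UNIV. ?r g m * e g m) = (\<Sum>m\<in>UNIV. \<bar>dpgf (p (K g)) (X g) l m - A l m\<bar> * e g m)
        + (\<Sum>m\<in>UNIV. \<bar>dpgf (p (K g)) (Y g) l m - A l m\<bar> * e g m)"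
      by (simp add: distrib_right sum.distrib)
    then have "\<bar>?D - mv A (e g) l\<bar> \<le> (\<Sum>m\<in>UNIV. ?r g m * e g m)"
      using D d[of "X g"] d[of "Y g"] nn[of "X g"] nn[of "Y g"] by linarith
    then have "\<bar>?D - mv A (e g) l\<bar> / t g \<le> (\<Sum>m\<in>UNIV. ?r g m * e g m) / t g"
      using t_nonneg by (rule divide_right_mono)
    also have "\<dots> = (\<Sum>m\<in>UNIV. ?r g m * (e g m / t g))"
      by (simp add: sum_divide_distrib)
    also have "\<dots> \<le> (\<Sum>m\<in>UNIV. ?r g m * (1 / v m))"
      by (intro sum_mono mult_left_mono e_ratio) auto
    finally show "norm ((?D - mv A (e g) l) / t g) \<le> (\<Sum>m\<in>UNIV. ?r g m * (1 / v m))"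
      using t_nonneg[of g] by simp
  qed
qed

lemma scaled_pgf_increment_linear:
  assumes S: "(S \<longlongrightarrow> 1) G"
  shows "((\<lambda>g. (S g * (pgf (p (K g)) (Y g) l - pgf (p (K g)) (X g) l) - mv A (e g) l) / t g) \<longlongrightarrow> 0) G"
proof -
  have "((\<lambda>g. (1 - S g) * (mv A (e g) l / t g)) \<longlongrightarrow> 0) G"
  proof (rule Lim_null_comparison)
    let ?K = "mv A (\<lambda>m. 1 / v m) l"
    have "((\<lambda>g. \<bar>1 - S g\<bar> * ?K) \<longlongrightarrow> \<bar>1 - 1\<bar> * ?K) G"
      by (intro tendsto_intros S)
    then show "((\<lambda>g. \<bar>1 - S g\<bar> * ?K) \<longlongrightarrow> 0) G" by simp
    show "\<forall>\<^sub>F g in G. norm ((1 - S g) * (mv A (e g) l / t g)) \<le> \<bar>1 - S g\<bar> * ?K"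
    proof (intro always_eventually allI)
      fix g
      have "mv A (e g) l / t g = mv A (\<lambda>m. e g m / t g) l"
        by (simp add: mv_def sum_divide_distrib)
      also have "\<dots> \<le> ?K"
        by (intro mv_mono A_nonneg e_ratio)
      finally have "mv A (e g) l / t g \<le> ?K" .
      moreover have "0 \<le> mv A (e g) l / t g"
        by (intro divide_nonneg_nonneg mv_nonneg A_nonneg e_nonneg t_nonneg)
      ultimately have "\<bar>mv A (e g) l / t g\<bar> \<le> ?K" by simp
      then show "norm ((1 - S g) * (mv A (e g) l / t g)) \<le> \<bar>1 - S g\<bar> * ?K"
        unfolding real_norm_def abs_mult by (intro mult_left_mono) auto
    qed
  qed
  from tendsto_diff[OF tendsto_mult[OF S pgf_increment_linear[of l]] this]
  have lim: "((\<lambda>g. S g * ((pgf (p (K g)) (Y g) l - pgf (p (K g)) (X g) l - mv A (e g) l) / t g) -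
      (1 - S g) * (mv A (e g) l / t g)) \<longlongrightarrow> 0) G" by simp
  have eq: "S g * ((pgf (p (K g)) (Y g) l - pgf (p (K g)) (X g) l - mv A (e g) l) / t g) -
      (1 - S g) * (mv A (e g) l / t g) =
      (S g * (pgf (p (K g)) (Y g) l - pgf (p (K g)) (X g) l) - mv A (e g) l) / t g" for g
    by (cases "t g = 0") (simp_all add: field_simps)
  show ?thesis using lim unfolding eq .
qed

context
  assumes dir: "\<And>l. ((\<lambda>g. e g l / t g) \<longlongrightarrow> u l) G"
begin

lemma quad_lims:
  "((\<lambda>g. quad (bcoef (p (K g)) l) (e g) / 2 / (t g)\<^sup>2) \<longlongrightarrow> quad (B l) u / 2) G"
  "((\<lambda>g. (quad (bcoef (p (K g)) l) (e g) - C * (\<Sum>j\<in>UNIV. 1 - X g j) * (\<Sum>l\<in>UNIV. e g l)\<^sup>2) / 2 / (t g)\<^sup>2)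
      \<longlongrightarrow> quad (B l) u / 2) G"
proof -
  have q: "((\<lambda>g. quad (bcoef (p (K g)) l) (\<lambda>l. e g l / t g)) \<longlongrightarrow> quad (B l) u) G"
    by (intro tendsto_quad dir filterlim_compose[OF bcoef_lim K])
  then have "((\<lambda>g. quad (bcoef (p (K g)) l) (\<lambda>l. e g l / t g) / 2) \<longlongrightarrow> quad (B l) u / 2) G"
    by (intro tendsto_intros) auto
  then show "((\<lambda>g. quad (bcoef (p (K g)) l) (e g) / 2 / (t g)\<^sup>2) \<longlongrightarrow> quad (B l) u / 2) G"
    by (simp add: quad_divide mult.commute)
  have eq: "(quad (bcoef (p (K g)) l) (e g) - C * (\<Sum>j\<in>UNIV. 1 - X g j) * (\<Sum>l\<in>UNIV. e g l)\<^sup>2) / 2 / (t g)\<^sup>2 =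
      (quad (bcoef (p (K g)) l) (\<lambda>l. e g l / t g) - C * (\<Sum>j\<in>UNIV. 1 - X g j) * (\<Sum>l\<in>UNIV. e g l / t g)\<^sup>2) / 2" for g
    unfolding quad_divide sum_divide_distrib[symmetric] power_divide by (simp only: diff_divide_distrib times_divide_eq_right divide_divide_eq_left mult_ac)
  have "((\<lambda>g. (quad (bcoef (p (K g)) l) (\<lambda>l. e g l / t g) - C * (\<Sum>j\<in>UNIV. 1 - X g j) * (\<Sum>l\<in>UNIV. e g l / t g)\<^sup>2) / 2)
      \<longlongrightarrow> (quad (B l) u - 0 * (\<Sum>l\<in>UNIV. u l)\<^sup>2) / 2) G"
    by (intro tendsto_intros q dir eta_lim[OF K X0 XY Y1 XL]) auto
  then show "((\<lambda>g. (quad (bcoef (p (K g)) l) (e g) - C * (\<Sum>j\<in>UNIV. 1 - X g j) * (\<Sum>l\<in>UNIV. e g l)\<^sup>2) / 2 / (t g)\<^sup>2)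
      \<longlongrightarrow> quad (B l) u / 2) G"
    unfolding eq by simp
qed

text \<open>Once \<open>e\<close> is asymptotic to \<open>t\<close> times \<open>u\<close>, dividing
  the Taylor bounds by \<open>t\<^sup>2\<close> leaves the Hessian form at \<open>u\<close>; the
  third-moment error carries a factor tending to 0.\<close>

lemma pgf_increment_quadratic_low:
  "((\<lambda>g. (pgf (p (K g)) (Y g) l - pgf (p (K g)) (X g) l - mv (dpgf (p (K g)) (X g)) (e g) l) / (t g)\<^sup>2)
     \<longlongrightarrow> quad (B l) u / 2) G"
  by (rule tendsto_sandwich[OF _ _ quad_lims(2)[of l] quad_lims(1)[of l]];
      intro always_eventually allI divide_right_mono)
     (auto simp only: e_def intro!: pgf_taylor_low[OF moment] X0 XY Y1 zero_le_power2)

lemma pgf_increment_quadratic_high: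
  "((\<lambda>g. (mv (dpgf (p (K g)) (Y g)) (e g) l - (pgf (p (K g)) (Y g) l - pgf (p (K g)) (X g) l)) / (t g)\<^sup>2)
     \<longlongrightarrow> quad (B l) u / 2) G"
  by (rule tendsto_sandwich[OF _ _ quad_lims(2)[of l] quad_lims(1)[of l]];
      intro always_eventually allI divide_right_mono)
     (auto simp only: e_def intro!: pgf_taylor_high[OF moment] X0 XY Y1 zero_le_power2)

lemma dpgf_increment:
  "((\<lambda>g. (dpgf (p (K g)) (Y g) i j - dpgf (p (K g)) (X g) i j) / t g) \<longlongrightarrow> (\<Sum>m\<in>UNIV. B i j m * u m)) G"
proof -
  have q: "((\<lambda>g. \<Sum>m\<in>UNIV. bcoef (p (K g)) i j m * (e g m / t g)) \<longlongrightarrow> (\<Sum>m\<in>UNIV. B i j m * u m)) G"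
    by (intro tendsto_intros dir filterlim_compose[OF bcoef_lim K])
  then have hi: "((\<lambda>g. (\<Sum>m\<in>UNIV. bcoef (p (K g)) i j m * e g m) / t g) \<longlongrightarrow> (\<Sum>m\<in>UNIV. B i j m * u m)) G"
    by (simp add: sum_divide_distrib)
  have "((\<lambda>g. (\<Sum>m\<in>UNIV. bcoef (p (K g)) i j m * (e g m / t g)) - C * (\<Sum>j\<in>UNIV. 1 - X g j) * (\<Sum>m\<in>UNIV. e g m / t g))
      \<longlongrightarrow> (\<Sum>m\<in>UNIV. B i j m * u m) - 0 * (\<Sum>m\<in>UNIV. u m)) G"
    by (intro tendsto_diff tendsto_mult tendsto_sum q dir eta_lim[OF K X0 XY Y1 XL])
  then have lo: "((\<lambda>g. ((\<Sum>m\<in>UNIV. bcoef (p (K g)) i j m * e g m) - C * (\<Sum>j\<in>UNIV. 1 - X g j) * (\<Sum>m\<in>UNIV. e g m)) / t g)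
      \<longlongrightarrow> (\<Sum>m\<in>UNIV. B i j m * u m)) G"
    by (simp add: diff_divide_distrib flip: sum_divide_distrib)
  show ?thesis
    by (rule tendsto_sandwich[OF _ _ lo hi]; intro always_eventually allI divide_right_mono t_nonneg)
       (auto simp only: e_def intro!: dpgf_diff_bounds[OF moment] X0 XY Y1)
qed

end

end

text \<open>For \<open>X\<close> not small the quadratic Taylor error may swamp the linear part.
  Monotonicity allows \<open>X\<close> to be shrunk to \<open>r * X\<close>, where the gain has
  order r and the loss order r^2.\<close>

lemma complement_lower_bound:
  fixes X :: "'d \<Rightarrow> real"
  assumes X: "\<And>l. 0 \<le> X l" "\<And>l. X l \<le> 1" and r: "0 \<le> r" "r \<le> 1"
  shows "r * mv (mean_mat (p k)) X l - r\<^sup>2 * C * (\<Sum>l\<in>UNIV. X l)\<^sup>2 / 2 \<le> 1 - pgf (p k) (\<lambda>l. 1 - X l) l"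
proof -
  have rX: "0 \<le> r * X l" "r * X l \<le> X l" "r * X l \<le> 1" for l
    using X[of l] r mult_left_le_one_le[of "X l" r] by (auto intro: mult_le_one)
  have "pgf (p k) (\<lambda>l. 1 - X l) l \<le> pgf (p k) (\<lambda>l. 1 - r * X l) l"
    by (rule pgf_mono[OF moment]) (use X rX in auto)
  moreover have "mv (mean_mat (p k)) (\<lambda>l. r * X l) l - (1 - pgf (p k) (\<lambda>l. 1 - r * X l) l)
      \<le> quad (bcoef (p k) l) (\<lambda>l. r * X l) / 2"
    using pgf_taylor_high(2)[OF moment[of k], of "\<lambda>l. 1 - r * X l" "\<lambda>_. 1" l] rX
    by (simp add: mean_mat_def)
  moreover have "quad (bcoef (p k) l) (\<lambda>l. r * X l) \<le> C * (\<Sum>l\<in>UNIV. r * X l)\<^sup>2"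
    by (rule quad_le) (auto intro: bcoef_le[OF moment] rX)
  ultimately show ?thesis
    by (simp add: mv_scale power_mult_distrib mult_ac flip: sum_distrib_left)
qed

text \<open>Between 1 - X and 1 - r X only the mean matrix is used; on the remaining stretch the
  Hessian contributes at order r^2 and the error at order r^3, so a small r still detects the
  quadratic part.\<close>

lemma complement_upper_bound:
  fixes X :: "'d \<Rightarrow> real"
  assumes X: "\<And>l. 0 \<le> X l" "\<And>l. X l \<le> 1" and r: "0 \<le> r" "r \<le> 1"
  shows "1 - pgf (p k) (\<lambda>l. 1 - X l) l + (r\<^sup>2 * quad (bcoef (p k) l) X - r ^ 3 * C * (\<Sum>l\<in>UNIV. X l) ^ 3) / 2
      \<le> mv (mean_mat (p k)) X l"
proof -
  have rX: "0 \<le> r * X l" "r * X l \<le> X l" "r * X l \<le> 1" for l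
    using X[of l] r mult_left_le_one_le[of "X l" r] by (auto intro: mult_le_one)
  have "pgf (p k) (\<lambda>l. 1 - r * X l) l - pgf (p k) (\<lambda>l. 1 - X l) l
      \<le> mv (dpgf (p k) (\<lambda>l. 1 - r * X l)) (\<lambda>l. (1 - r * X l) - (1 - X l)) l"
    by (rule pgf_diff_le[OF moment]) (use X rX in auto)
  also have "\<dots> \<le> mv (mean_mat (p k)) (\<lambda>l. X l - r * X l) l"
    unfolding mv_def mean_mat_def
    by (intro sum_mono mult_mono dpgf_mono[OF moment] dpgf_nonneg[OF moment]) (use X rX in auto)
  finally have 1: "pgf (p k) (\<lambda>l. 1 - r * X l) l - pgf (p k) (\<lambda>l. 1 - X l) l
      \<le> mv (mean_mat (p k)) X l - mv (mean_mat (p k)) (\<lambda>l. r * X l) l" by (simp add: mv_diff)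
  have "(quad (bcoef (p k) l) (\<lambda>l. r * X l) - C * (\<Sum>l\<in>UNIV. r * X l) * (\<Sum>l\<in>UNIV. r * X l)\<^sup>2) / 2
     \<le> mv (mean_mat (p k)) (\<lambda>l. r * X l) l - (1 - pgf (p k) (\<lambda>l. 1 - r * X l) l)"
    using pgf_taylor_high(1)[OF moment[of k], of "\<lambda>l. 1 - r * X l" "\<lambda>_. 1" l] rX
    by (simp add: mean_mat_def)
  moreover have "C * (\<Sum>l\<in>UNIV. r * X l) * (\<Sum>l\<in>UNIV. r * X l)\<^sup>2 = r ^ 3 * C * (\<Sum>l\<in>UNIV. X l) ^ 3"
    by (simp add: power2_eq_square power3_eq_cube mult_ac flip: sum_distrib_left)
  ultimately have "(r\<^sup>2 * quad (bcoef (p k) l) X - r ^ 3 * C * (\<Sum>l\<in>UNIV. X l) ^ 3) / 2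
      \<le> mv (mean_mat (p k)) (\<lambda>l. r * X l) l - (1 - pgf (p k) (\<lambda>l. 1 - r * X l) l)"
    by (simp only: quad_scale)
  then show ?thesis using 1 by linarith
qed

end

text \<open>Weights identically 1 give the unweighted process, whose fixed point is the vector of
  extinction probabilities; that instance is interpreted below as \<open>one\<close>.\<close>

locale near_critical_s = near_critical p C A B
  for p :: "nat \<Rightarrow> ('d::finite) offspring" and C :: real
    and A :: "'d \<Rightarrow> 'd \<Rightarrow> real" and B :: "'d \<Rightarrow> 'd \<Rightarrow> 'd \<Rightarrow> real" +
  fixes s :: "nat \<Rightarrow> 'd \<Rightarrow> real"
  assumes s_pos: "\<And>k l. 0 < s k l" and s_le_1: "\<And>k l. s k l \<le> 1"
    and s_lim: "\<And>l. (\<lambda>k. s k l) \<longlonglongrightarrow> 1"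
begin

definition h where "h k = hseq (p k) (s k)"
definition hs where "hs k = hstar (p k) (s k)"

lemma s_nonneg: "0 \<le> s k l" using s_pos[of k l] by simp

lemmas h_nonneg = hseq_nonneg[where p = "p k" and s = "s k" for k, OF moment s_nonneg s_le_1, folded h_def]
  and h_le_1 = hseq_le_1[where p = "p k" and s = "s k" for k, OF moment s_nonneg s_le_1, folded h_def]
  and h_Suc_ge = hseq_Suc_ge[where p = "p k" and s = "s k" for k, OF moment s_nonneg s_le_1, folded h_def]
  and h_incseq = hseq_incseq[where p = "p k" and s = "s k" for k, OF moment s_nonneg s_le_1, folded h_def]
  and h_le_hs = hseq_le_hstar[where p = "p k" and s = "s k" for k, OF moment s_nonneg s_le_1, folded h_def hs_def]
  and h_tendsto_hs = hseq_lim[where p = "p k" and s = "s k" for k, OF moment s_nonneg s_le_1, folded h_def hs_def]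
  and hs_nonneg = hstar_nonneg[where p = "p k" and s = "s k" for k, OF moment s_nonneg s_le_1, folded hs_def]
  and hs_le_1 = hstar_le_1[where p = "p k" and s = "s k" for k, OF moment s_nonneg s_le_1, folded hs_def]
  and hs_fixpoint = hstar_fixpoint[where p = "p k" and s = "s k" for k, OF moment s_nonneg s_le_1, folded hs_def]

lemma h_0 [simp]: "h k 0 l = 0" by (simp add: h_def)
lemma h_Suc: "h k (Suc i) l = s k l * pgf (p k) (h k i) l" by (simp add: h_def)

text \<open>Keeps each fixed early generation away from 1, uniformly in large k:
  \<open>1 - h\<close> starts at 1, and in every step a definite amount of its component along v
  survives.\<close>

lemma h_complement_positive:
  "\<exists>c>0. \<forall>\<^sub>F k in sequentially. c \<le> dot v (\<lambda>l. 1 - h k i l)"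
proof (induction i)
  case 0
  have "dot v (\<lambda>l. 1) > 0"
    using dot_pos[of v "\<lambda>l. 1" undefined] v_pos by simp
  then show ?case by (intro exI[of _ "dot v (\<lambda>l. 1)"]) simp
next
  case (Suc i)
  then obtain c where c: "0 < c" "\<forall>\<^sub>F k in sequentially. c \<le> dot v (\<lambda>l. 1 - h k i l)" by blast
  define D where "D = C * (real CARD('d))\<^sup>2 * dot v (\<lambda>l. 1)"
  have V: "0 \<le> dot v (\<lambda>l. 1)" by (intro dot_nonneg v_nonneg) auto
  have D: "0 \<le> D" unfolding D_def by (intro mult_nonneg_nonneg V C_nonneg) auto
  \<comment> \<open>Chosen so that \<open>r * D\<close> is at most \<open>c / 2\<close>. The factors
    1/2 conceded for the mean matrix and for \<open>s\<close> then leave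
    \<open>r * c / 8\<close>.\<close>
  define r where "r = min 1 (c / (2 * D + 1))"
  have r: "0 < r" "r \<le> 1" "r * D \<le> c / 2"
  proof -
    show "0 < r" "r \<le> 1" using c D by (auto simp: r_def)
    have "r \<le> c / (2 * D + 1)" by (simp add: r_def)
    then have "r * (2 * D + 1) \<le> c" using D by (simp add: pos_le_divide_eq)
    then show "r * D \<le> c / 2" using \<open>0 < r\<close> by (simp add: algebra_simps)
  qed
  have "\<forall>\<^sub>F k in sequentially. \<forall>l. 1 / 2 < s k l"
    by (intro eventually_all_finite order_tendstoD(1)[OF s_lim]) auto
  moreover have "\<forall>\<^sub>F k in sequentially. \<forall>l. v l / 2 < mv (tr (mean_mat (p k))) v l"
  proof (intro eventually_all_finite)
    fix l
    have "(\<lambda>k. mv (tr (mean_mat (p k))) v l) \<longlonglongrightarrow> mv (tr A) v l"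
      by (intro tendsto_mv tendsto_const) (simp add: tr_def mean_lim)
    then show "\<forall>\<^sub>F k in sequentially. v l / 2 < mv (tr (mean_mat (p k))) v l"
      by (rule order_tendstoD(1)) (simp add: vA v_pos)
  qed
  ultimately have "\<forall>\<^sub>F k in sequentially. r * c / 8 \<le> dot v (\<lambda>l. 1 - h k (Suc i) l)"
    using c(2)
  proof eventually_elim
    case (elim k)
    let ?X = "\<lambda>l. 1 - h k i l"
    have X: "0 \<le> ?X l" "?X l \<le> 1" for l using h_nonneg h_le_1 by auto
    have X1: "(\<Sum>l\<in>UNIV. ?X l)\<^sup>2 \<le> (real CARD('d))\<^sup>2"
    proof (rule power_mono)
      show "(\<Sum>l\<in>UNIV. ?X l) \<le> real CARD('d)"
        using sum_mono[of UNIV ?X "\<lambda>_. 1"] X by simp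
      show "0 \<le> (\<Sum>l\<in>UNIV. ?X l)" by (intro sum_nonneg X)
    qed
    let ?m = "r * mv (mean_mat (p k)) ?X l - r\<^sup>2 * C * (real CARD('d))\<^sup>2 / 2"
    have F: "(r * mv (mean_mat (p k)) ?X l - r\<^sup>2 * C * (real CARD('d))\<^sup>2 / 2) / 2 \<le> 1 - h k (Suc i) l" for l
    proof -
      have "r * mv (mean_mat (p k)) ?X l - r\<^sup>2 * C * (\<Sum>l\<in>UNIV. ?X l)\<^sup>2 / 2 \<le> 1 - pgf (p k) (\<lambda>l. 1 - ?X l) l"
        by (rule complement_lower_bound) (use X r in auto)
      moreover have "r\<^sup>2 * C * (\<Sum>l\<in>UNIV. ?X l)\<^sup>2 \<le> r\<^sup>2 * C * (real CARD('d))\<^sup>2"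
        by (intro mult_left_mono X1) (use C_nonneg in auto)
      ultimately have "r * mv (mean_mat (p k)) ?X l - r\<^sup>2 * C * (real CARD('d))\<^sup>2 / 2 \<le> 1 - pgf (p k) (h k i) l"
        by simp
      moreover have "1 - h k (Suc i) l = (1 - s k l) + s k l * (1 - pgf (p k) (h k i) l)"
        by (simp add: h_Suc algebra_simps)
      moreover have "1 / 2 * (1 - pgf (p k) (h k i) l) \<le> s k l * (1 - pgf (p k) (h k i) l)"
        using elim pgf_le_1[OF moment[of k], of "h k i" l] h_nonneg h_le_1
        by (intro mult_right_mono) (auto intro: less_imp_le)
      ultimately show ?thesis using s_le_1[of k l] by simp
    qed
    have "dot v (mv (mean_mat (p k)) ?X) \<ge> dot (\<lambda>l. v l / 2) ?X"
      unfolding dot_mv unfolding dot_def using elim X by (intro sum_mono mult_right_mono) (auto intro: less_imp_le)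
    moreover have "dot (\<lambda>l. v l / 2) ?X = dot v ?X / 2"
      by (simp add: dot_def sum_divide_distrib)
    ultimately have dv: "c / 2 \<le> dot v (mv (mean_mat (p k)) ?X)"
      using elim by simp
    have "r * c / 8 \<le> (r * (c / 2) - r * (r * D) / 2) / 2"
      using mult_left_mono[OF r(3), of r] r(1) by (simp add: field_simps)
    also have "\<dots> \<le> (r * dot v (mv (mean_mat (p k)) ?X) - r * (r * D) / 2) / 2"
      using mult_left_mono[OF dv, of r] r(1) by simp
    also have "\<dots> = dot v (\<lambda>l. (r * mv (mean_mat (p k)) ?X l - r\<^sup>2 * C * (real CARD('d))\<^sup>2 / 2) / 2)"
      by (simp add: dot_def D_def sum_divide_distrib sum_subtractf sum_distrib_left algebra_simps power2_eq_square diff_divide_distrib)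
    also have "\<dots> \<le> dot v (\<lambda>l. 1 - h k (Suc i) l)"
      by (intro dot_mono v_nonneg F)
    finally show ?case .
  qed
  then show ?case using r c by (intro exI[of _ "r * c / 8"]) auto
qed

text \<open>Some increment in a long stretch is small, so a subsequence of \<open>1 - h\<close> converges to a fixed
  vector of \<open>A\<close> at which the quadratic part of the generating function must vanish.\<close>

lemma h_lim: "((\<lambda>p. h (fst p) (snd p) l) \<longlongrightarrow> 1) seq2"
proof -
  let ?q = "\<lambda>k i l. 1 - h k i l"
  have q: "0 \<le> ?q k i l" "?q k i l \<le> 1" for k i l using h_nonneg h_le_1 by auto
  define V where "V = dot v (\<lambda>l. 1)"
  have V: "0 < V" unfolding V_def using dot_pos[of v "\<lambda>l. 1" undefined] v_pos by simp
  have main: "\<forall>\<^sub>F p in seq2. (\<Sum>l\<in>UNIV. ?q (fst p) (snd p) l) < e" if e: "0 < e" for e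
  proof (rule ccontr)
    assume "\<not> ?thesis"
    then have "\<forall>N. \<exists>k i. N \<le> k \<and> N \<le> i \<and> e \<le> (\<Sum>l\<in>UNIV. ?q k i l)"
      unfolding eventually_seq2 by (auto simp: not_less)
    then obtain K I where KI: "\<And>N. N \<le> K N" "\<And>N. N \<le> I N" "\<And>N. e \<le> (\<Sum>l\<in>UNIV. ?q (K N) (I N) l)"
      by metis
    \<comment> \<open>Pigeonhole: the component along v decreases by at most \<open>V\<close> in
      total over \<open>Suc (I N)\<close> steps.\<close>
    have "\<exists>j\<le>I N. dot v (?q (K N) j) - dot v (?q (K N) (Suc j)) \<le> V / Suc (I N)" for N
    proof (rule ccontr)
      let ?f = "\<lambda>j. dot v (?q (K N) j)"
      assume "\<not> ?thesis"
      then have "\<forall>j\<le>I N. V / Suc (I N) < ?f j - ?f (Suc j)" by (meson not_le)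
      then have "(\<Sum>j<Suc (I N). V / Suc (I N)) < (\<Sum>j<Suc (I N). ?f j - ?f (Suc j))"
        by (intro sum_strict_mono) (auto simp: less_Suc_eq_le)
      also have "\<dots> = ?f 0 - ?f (Suc (I N))" by (rule sum_lessThan_telescope')
      also have "\<dots> \<le> V"
        using dot_nonneg[of v "?q (K N) (Suc (I N))"] v_nonneg q by (simp add: V_def)
      finally show False by simp
    qed
    then obtain J where J: "\<And>N. J N \<le> I N"
      "\<And>N. dot v (?q (K N) (J N)) - dot v (?q (K N) (Suc (J N))) \<le> V / Suc (I N)" by metis
    define X where "X N l = ?q (K N) (J N) l" for N l
    have "\<bar>X N l\<bar> \<le> 1" for N l using q by (simp add: X_def)
    then obtain r x where r: "strict_mono r" and x: "\<And>l. (\<lambda>n. X (r n) l) \<longlonglongrightarrow> x l"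
      using bounded_fun_convergent_subseq[of X 1] by blast
    have Kr: "filterlim (\<lambda>n. K (r n)) sequentially sequentially"
      by (rule filterlim_at_top_mono[OF filterlim_ident])
         (auto intro!: always_eventually order_trans[OF seq_suble[OF r] KI(1)])
    have x0: "0 \<le> x l" for l
      by (rule LIMSEQ_le_const[OF x]) (auto simp: X_def q(1) simp del: diff_ge_0_iff_ge)
    \<comment> \<open>The small step at \<open>J N\<close> comes no later than \<open>I N\<close>,
      and \<open>1 - h\<close> decreases, so the mass bound \<open>e\<close> survives.\<close>
    have xe: "e \<le> (\<Sum>l\<in>UNIV. x l)"
    proof (rule LIMSEQ_le_const)
      show "(\<lambda>n. \<Sum>l\<in>UNIV. X (r n) l) \<longlonglongrightarrow> (\<Sum>l\<in>UNIV. x l)" by (intro tendsto_intros x)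
      have "e \<le> (\<Sum>l\<in>UNIV. X N l)" for N
        by (rule order_trans[OF KI(3)[of N] sum_mono]) (simp add: X_def incseqD[OF h_incseq J(1)])
      then show "\<exists>N. \<forall>n\<ge>N. e \<le> (\<Sum>l\<in>UNIV. X (r n) l)" by blast
    qed
    have small: "(\<lambda>n. X (r n) l - ?q (K (r n)) (Suc (J (r n))) l) \<longlonglongrightarrow> 0" for l
    proof (rule Lim_null_comparison)
      have "(\<lambda>n. V / v l * (1 / Suc n)) \<longlonglongrightarrow> V / v l * 0"
        by (intro tendsto_intros LIMSEQ_Suc[OF lim_1_over_n])
      then show "(\<lambda>n. V / v l * (1 / Suc n)) \<longlonglongrightarrow> 0" by simp
      show "\<forall>\<^sub>F n in sequentially. norm (X (r n) l - ?q (K (r n)) (Suc (J (r n))) l) \<le> V / v l * (1 / Suc n)"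
      proof (intro always_eventually allI)
        fix n
        have nn: "0 \<le> X (r n) l - ?q (K (r n)) (Suc (J (r n))) l" for l
          using h_Suc_ge by (simp add: X_def)
        have "v l * (X (r n) l - ?q (K (r n)) (Suc (J (r n))) l)
           \<le> dot v (\<lambda>l. X (r n) l - ?q (K (r n)) (Suc (J (r n))) l)"
          by (rule dot_ge_component) (use v_nonneg nn in auto)
        also have "\<dots> \<le> V / Suc (I (r n))"
          using J(2)[of "r n"] by (simp only: dot_diff_right X_def)
        also have "\<dots> \<le> V / Suc n"
          using V order_trans[OF seq_suble[OF r, of n] KI(2)[of "r n"]]
          by (intro divide_left_mono) auto
        finally have "X (r n) l - ?q (K (r n)) (Suc (J (r n))) l \<le> V / Suc n / v l"
          by (subst pos_le_divide_eq[OF v_pos]) (simp only: mult.commute)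
        moreover have "V / Suc n / v l = V / v l * (1 / Suc n)" by simp
        ultimately show "norm (X (r n) l - ?q (K (r n)) (Suc (J (r n))) l) \<le> V / v l * (1 / Suc n)"
          unfolding real_norm_def abs_of_nonneg[OF nn[of l]] by (simp only:)
      qed
    qed
    have F: "(\<lambda>n. 1 - pgf (p (K (r n))) (\<lambda>l. 1 - X (r n) l) l) \<longlonglongrightarrow> x l" for l
    proof -
      have sl: "(\<lambda>n. s (K (r n)) l) \<longlonglongrightarrow> 1" by (rule filterlim_compose[OF s_lim Kr])
      have "(\<lambda>n. X (r n) l - (X (r n) l - ?q (K (r n)) (Suc (J (r n))) l)) \<longlonglongrightarrow> x l - 0"
        by (intro tendsto_intros x small)
      then have "(\<lambda>n. ?q (K (r n)) (Suc (J (r n))) l) \<longlonglongrightarrow> x l" by simp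
      then have "(\<lambda>n. 1 - (1 - ?q (K (r n)) (Suc (J (r n))) l) / s (K (r n)) l) \<longlonglongrightarrow> 1 - (1 - x l) / 1"
        by (intro tendsto_intros sl) auto
      moreover have "1 - (1 - ?q (K (r n)) (Suc (J (r n))) l) / s (K (r n)) l
          = 1 - pgf (p (K (r n))) (\<lambda>l. 1 - X (r n) l) l" for n
        using s_pos[of "K (r n)" l] by (simp add: h_Suc X_def)
      ultimately show ?thesis by simp
    qed
    have MX: "(\<lambda>n. mv (mean_mat (p (K (r n)))) (X (r n)) l) \<longlonglongrightarrow> mv A x l" for l
      by (intro tendsto_mv x filterlim_compose[OF mean_lim Kr])
    \<comment> \<open>Since the chosen step is asymptotically zero, the limit x inherits the upper
      bound for complements, with an arbitrary shrinking factor b.\<close>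
    have key: "x l + (b\<^sup>2 * quad (B l) x - b ^ 3 * C * (\<Sum>l\<in>UNIV. x l) ^ 3) / 2 \<le> mv A x l"
      if b: "0 \<le> b" "b \<le> 1" for b l
    proof (rule LIMSEQ_le[OF _ MX])
      show "(\<lambda>n. 1 - pgf (p (K (r n))) (\<lambda>l. 1 - X (r n) l) l +
          (b\<^sup>2 * quad (bcoef (p (K (r n))) l) (X (r n)) - b ^ 3 * C * (\<Sum>l\<in>UNIV. X (r n) l) ^ 3) / 2)
        \<longlonglongrightarrow> x l + (b\<^sup>2 * quad (B l) x - b ^ 3 * C * (\<Sum>l\<in>UNIV. x l) ^ 3) / 2"
        by (intro tendsto_add[OF F] tendsto_intros tendsto_quad x filterlim_compose[OF bcoef_lim Kr]) auto
      show "\<exists>N. \<forall>n\<ge>N. 1 - pgf (p (K (r n))) (\<lambda>l. 1 - X (r n) l) l +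
          (b\<^sup>2 * quad (bcoef (p (K (r n))) l) (X (r n)) - b ^ 3 * C * (\<Sum>l\<in>UNIV. X (r n) l) ^ 3) / 2
          \<le> mv (mean_mat (p (K (r n)))) (X (r n)) l"
        by (intro exI allI impI complement_upper_bound) (use b q in \<open>auto simp: X_def\<close>)
    qed
    \<comment> \<open>At b = 0 this gives x \<le> A x; both sides have the same component along the
      positive vector v, hence they agree.\<close>
    have le: "x l \<le> mv A x l" for l using key[of 0 l] by simp
    have "mv A x l - x l = 0" for l
      by (rule dot_eq_0D[of v]) (use v_pos le in \<open>auto simp: dot_diff_right dot_v_mv_A\<close>)
    then have Ax: "mv A x = (\<lambda>l. 1 * x l)" by (simp add: fun_eq_iff)
    define c where "c = (\<Sum>l\<in>UNIV. x l)"
    have c: "0 < c" using xe e by (simp add: c_def)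
    have "(\<lambda>l. x l / c) = right_pvec A"
    proof -
      have "mv A (\<lambda>l. inverse c * x l) = (\<lambda>l. 1 * (inverse c * x l))"
        by (simp only: mv_scale Ax) simp
      moreover have "(\<Sum>l\<in>UNIV. inverse c * x l) = 1"
        using c by (simp add: c_def flip: sum_distrib_left)
      moreover have "0 \<le> inverse c * x l" for l using c x0 by simp
      ultimately have "(\<lambda>l. inverse c * x l) = right_pvec A"
        using right_pvec_unique[OF A_primitive, of "\<lambda>l. inverse c * x l" 1] by blast
      then show ?thesis by (simp add: divide_inverse mult.commute)
    qed
    then have xu: "x = (\<lambda>l. c * u l)" using c by (auto simp: u_def fun_eq_iff field_simps)
    \<comment> \<open>With x = c u the linear terms cancel, so the quadratic part is dominated by
      the cubic error at every scale b; a small b then contradicts positivity of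
      \<open>Q\<close>.\<close>
    have Qb: "2 * Q \<le> b * (C * c * V)" if b: "0 < b" "b \<le> 1" for b
    proof -
      have "b\<^sup>2 * quad (B l) x - b ^ 3 * C * c ^ 3 \<le> 0" for l
        using key[of b l] b Ax by (simp add: c_def)
      then have "dot v (\<lambda>l. b\<^sup>2 * quad (B l) x - b ^ 3 * C * c ^ 3) \<le> dot v (\<lambda>l. 0)"
        by (intro dot_mono v_nonneg)
      moreover have "dot v (\<lambda>l. b\<^sup>2 * quad (B l) x - b ^ 3 * C * c ^ 3) = b\<^sup>2 * c\<^sup>2 * (2 * Q - b * (C * c * V))"
      proof -
        have "dot v (\<lambda>l. b\<^sup>2 * quad (B l) x - b ^ 3 * C * c ^ 3) =
            dot v (\<lambda>l. (b\<^sup>2 * c\<^sup>2) * quad (B l) u - (b ^ 3 * C * c ^ 3) * 1)"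
          by (simp add: xu quad_scale mult_ac)
        also have "\<dots> = (b\<^sup>2 * c\<^sup>2) * dot v (\<lambda>l. quad (B l) u) - (b ^ 3 * C * c ^ 3) * V"
          by (simp only: dot_diff_right dot_scale_right V_def)
        also have "\<dots> = b\<^sup>2 * c\<^sup>2 * (2 * Q - b * (C * c * V))"
          by (simp add: Q_def power2_eq_square power3_eq_cube algebra_simps)
        finally show ?thesis .
      qed
      ultimately have "b\<^sup>2 * c\<^sup>2 * (2 * Q - b * (C * c * V)) \<le> 0" by (simp add: dot_def)
      moreover have "0 < b\<^sup>2 * c\<^sup>2" using b c by simp
      ultimately show ?thesis using b c by (auto simp: mult_le_0_iff)
    qed
    define D where "D = C * c * V"
    have D: "0 \<le> D" unfolding D_def using C_nonneg c V by simp
    define b where "b = min 1 (Q / (D + 1))"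
    have b: "0 < b" "b \<le> 1" using Q_pos D by (auto simp: b_def)
    have "b \<le> Q / (D + 1)" by (simp add: b_def)
    then have "b * (D + 1) \<le> Q" using D by (simp add: pos_le_divide_eq)
    then have "b * D \<le> Q" using b by (simp add: algebra_simps)
    then show False using Qb[OF b] Q_pos by (simp add: D_def)
  qed
  show ?thesis
  proof (rule tendstoI)
    fix e :: real assume "0 < e"
    from main[OF this] show "\<forall>\<^sub>F p in seq2. dist (h (fst p) (snd p) l) 1 < e"
    proof eventually_elim
      case (elim p)
      have "?q (fst p) (snd p) l \<le> (\<Sum>l\<in>UNIV. ?q (fst p) (snd p) l)"
        by (rule member_le_sum[of l UNIV "?q (fst p) (snd p)"]) (use q in auto)
      then show ?case using elim q(1)[of "fst p" "snd p" l] by (simp add: dist_real_def)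
    qed
  qed
qed

text \<open>For all large k the fixed point is trapped between one fixed late generation and
  1.\<close>

lemma hs_lim: "(\<lambda>k. hs k l) \<longlonglongrightarrow> 1"
proof (rule tendstoI)
  fix e :: real assume "0 < e"
  then have "\<forall>\<^sub>F p in seq2. dist (h (fst p) (snd p) l) 1 < e" using h_lim tendstoD by blast
  then obtain N where N: "\<And>k i. k \<ge> N \<Longrightarrow> i \<ge> N \<Longrightarrow> dist (h k i l) 1 < e"
    unfolding eventually_seq2 by auto
  show "\<forall>\<^sub>F k in sequentially. dist (hs k l) 1 < e"
  proof (rule eventually_sequentiallyI[of N])
    fix k assume "N \<le> k"
    then show "dist (hs k l) 1 < e"
    proof -
      have "h k N l \<le> hs k l" "hs k l \<le> 1" by (rule h_le_hs, rule hs_le_1)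
      moreover have "dist (h k N l) 1 < e" using N \<open>N \<le> k\<close> by blast
      ultimately show ?thesis by (auto simp: dist_real_def)
    qed
  qed
qed

end

section \<open>Asymptotics of the increments\<close>

context near_critical_s
begin

definition As where "As k l m = s k l * dpgf (p k) (hs k) l m"
definition L where "L k = perron_root (As k)"
definition vs where "vs k = left_pvec (As k)"
definition x where "x k i = (\<lambda>l. hs k l - h k i l)"
definition d where "d k i = (\<lambda>l. h k (Suc i) l - h k i l)"
definition w where "w k i = dot (vs k) (x k i)"

lemma As_nonneg: "0 \<le> As k i j"
  unfolding As_def by (intro mult_nonneg_nonneg s_nonneg dpgf_nonneg[OF moment] hs_nonneg)

lemma dpgf_hs_lim: "(\<lambda>k. dpgf (p k) (hs k) i j) \<longlonglongrightarrow> A i j"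
  using dpgf_lim[where K = "\<lambda>k. k" and X = hs and Y = hs, OF filterlim_ident hs_nonneg order_refl hs_le_1 hs_lim] .

lemma As_lim: "(\<lambda>k. As k i j) \<longlonglongrightarrow> A i j"
  using tendsto_mult[OF s_lim dpgf_hs_lim, of i i j] by (simp add: As_def)

lemma As_primitive: "\<forall>\<^sub>F k in sequentially. primitive (As k)"
  by (rule eventually_primitive[OF As_lim A_primitive As_nonneg])

lemma L_lim: "L \<longlonglongrightarrow> 1"
  unfolding L_def using tendsto_perron_root[OF As_lim A_primitive As_nonneg] by (simp add: A_root)

lemma vs_lim: "(\<lambda>k. vs k l) \<longlonglongrightarrow> v l"
  unfolding vs_def v_def by (rule tendsto_left_pvec[OF As_lim A_primitive As_nonneg])

lemma L_pos: "\<forall>\<^sub>F k in sequentially. 0 < L k"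
  by (rule order_tendstoD(1)[OF L_lim]) simp

lemma vs_pos: "\<forall>\<^sub>F k in sequentially. \<forall>l. v l / 2 < vs k l"
  by (intro eventually_all_finite order_tendstoD(1)[OF vs_lim]) (use v_pos in simp)

lemma x_nonneg: "0 \<le> x k i l"
  using h_le_hs by (simp add: x_def)

lemma d_nonneg: "0 \<le> d k i l"
  using h_Suc_ge by (simp add: d_def)

lemma x_Suc: "x k (Suc i) l = s k l * (pgf (p k) (hs k) l - pgf (p k) (h k i) l)"
  using hs_fixpoint[of k l] by (simp add: x_def h_Suc algebra_simps)

lemma d_Suc: "d k (Suc i) l = s k l * (pgf (p k) (h k (Suc i)) l - pgf (p k) (h k i) l)"
  by (simp add: d_def h_Suc algebra_simps)

lemma x_linear: "((\<lambda>p. (x (fst p) (Suc (snd p)) l - mv A (x (fst p) (snd p)) l) / dot v (x (fst p) (snd p))) \<longlongrightarrow> 0) seq2"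
  using scaled_pgf_increment_linear[where K = fst and X = "\<lambda>p. h (fst p) (snd p)" and Y = "\<lambda>p. hs (fst p)",
    OF filterlim_fst h_nonneg h_le_hs hs_le_1 h_lim tendsto_seq2_fst[OF s_lim]]
  unfolding x_Suc unfolding x_def .

lemma d_linear: "((\<lambda>p. (d (fst p) (Suc (snd p)) l - mv A (d (fst p) (snd p)) l) / dot v (d (fst p) (snd p))) \<longlongrightarrow> 0) seq2"
  using scaled_pgf_increment_linear[where K = fst and X = "\<lambda>p. h (fst p) (snd p)" and Y = "\<lambda>p. h (fst p) (Suc (snd p))",
    OF filterlim_fst h_nonneg h_Suc_ge h_le_1 h_lim tendsto_seq2_fst[OF s_lim]]
  unfolding d_Suc unfolding d_def .

lemma hs_complement_lim: "(\<lambda>k. dot v (\<lambda>l. 1 - hs k l)) \<longlonglongrightarrow> 0"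
proof -
  have "(\<lambda>k. dot v (\<lambda>l. 1 - hs k l)) \<longlonglongrightarrow> dot v (\<lambda>l. 1 - 1)"
    by (intro tendsto_dot tendsto_intros hs_lim)
  then show ?thesis by (simp add: dot_def)
qed

lemma dot_x_lower: "\<exists>c>0. \<forall>\<^sub>F k in sequentially. c \<le> dot v (x k i)"
proof -
  obtain c where c: "0 < c" "\<forall>\<^sub>F k in sequentially. c \<le> dot v (\<lambda>l. 1 - h k i l)"
    using h_complement_positive by blast
  have "\<forall>\<^sub>F k in sequentially. dot v (\<lambda>l. 1 - hs k l) < c / 2"
    by (rule order_tendstoD(2)[OF hs_complement_lim]) (use c in simp)
  with c(2) have "\<forall>\<^sub>F k in sequentially. c / 2 \<le> dot v (x k i)"
  proof eventually_elim
    case (elim k)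
    have "dot v (x k i) = dot v (\<lambda>l. 1 - h k i l) - dot v (\<lambda>l. 1 - hs k l)"
      by (simp add: x_def dot_diff_right)
    then show ?case using elim by simp
  qed
  then show ?thesis using c by (intro exI[of _ "c / 2"]) auto
qed

text \<open>At a fixed late generation the component is bounded below; afterwards the linear
  approximation keeps the ratio of consecutive components above 1/2, so positivity
  propagates.\<close>

lemma dot_x_pos: "\<forall>\<^sub>F p in seq2. 0 < dot v (x (fst p) (snd p))"
proof -
  have "((\<lambda>p. dot v (\<lambda>l. (x (fst p) (Suc (snd p)) l - mv A (x (fst p) (snd p)) l) / dot v (x (fst p) (snd p)))) \<longlongrightarrow> dot v (\<lambda>_. 0)) seq2"
    by (intro tendsto_dot tendsto_const x_linear)
  then have "((\<lambda>p. dot v (\<lambda>l. (x (fst p) (Suc (snd p)) l - mv A (x (fst p) (snd p)) l) / dot v (x (fst p) (snd p)))) \<longlongrightarrow> 0) seq2"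
    by (simp add: dot_def)
  from order_tendstoD(1)[OF this, of "-(1/2)"]
  obtain N where N: "\<And>k i. k \<ge> N \<Longrightarrow> i \<ge> N \<Longrightarrow>
      -(1/2) < dot v (\<lambda>l. (x k (Suc i) l - mv A (x k i) l) / dot v (x k i))"
    unfolding eventually_seq2 by auto
  obtain c where c: "0 < c" "\<forall>\<^sub>F k in sequentially. c \<le> dot v (x k N)"
    using dot_x_lower by blast
  then obtain N1 where N1: "\<And>k. k \<ge> N1 \<Longrightarrow> c \<le> dot v (x k N)"
    unfolding eventually_sequentially by blast
  have "0 < dot v (x k i)" if k: "k \<ge> N" "k \<ge> N1" and "i \<ge> N" for k i
    using \<open>i \<ge> N\<close>
  proof (induction i rule: dec_induct)
    case base
    show ?case using N1[OF k(2)] c(1) by simp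
  next
    case (step i)
    have "dot v (\<lambda>l. (x k (Suc i) l - mv A (x k i) l) / dot v (x k i))
       = dot v (\<lambda>l. inverse (dot v (x k i)) * (x k (Suc i) l - mv A (x k i) l))"
      by (simp add: divide_inverse mult.commute)
    also have "\<dots> = inverse (dot v (x k i)) * (dot v (x k (Suc i)) - dot v (x k i))"
      by (simp only: dot_scale_right dot_diff_right dot_v_mv_A)
    also have "\<dots> = dot v (x k (Suc i)) / dot v (x k i) - 1"
      using step.IH by (simp add: field_simps)
    finally have "0 < dot v (x k (Suc i)) / dot v (x k i)"
      using N[of k i] k step.hyps by simp
    then show ?case using step.IH by (simp add: zero_less_divide_iff)
  qed
  then show ?thesis
    unfolding eventually_seq2 by (intro exI[of _ "max N N1"]) auto
qed

lemma x_direction: "((\<lambda>p. x (fst p) (snd p) l / dot v (x (fst p) (snd p))) \<longlongrightarrow> u l) seq2"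
  unfolding u_def v_def
proof (rule perron_direction[OF A_primitive A_root])
  show "\<forall>\<^sub>F p in seq2. (\<forall>l. 0 \<le> x (fst p) (snd p) l) \<and> 0 < dot (left_pvec A) (x (fst p) (snd p))"
    using dot_x_pos by eventually_elim (simp add: x_nonneg v_def)
qed (use x_linear in \<open>simp add: v_def\<close>)

lemma w_ratio: "((\<lambda>p. w (fst p) (snd p) / dot v (x (fst p) (snd p))) \<longlongrightarrow> 1) seq2"
proof -
  have "((\<lambda>p. dot (vs (fst p)) (\<lambda>l. x (fst p) (snd p) l / dot v (x (fst p) (snd p)))) \<longlongrightarrow> dot v u) seq2"
    by (intro tendsto_dot x_direction tendsto_seq2_fst vs_lim)
  then show ?thesis by (simp add: dot_divide w_def vu)
qed

lemma w_pos: "\<forall>\<^sub>F p in seq2. 0 < w (fst p) (snd p)"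
proof -
  have "\<forall>\<^sub>F p in seq2. 0 < w (fst p) (snd p) / dot v (x (fst p) (snd p))"
    by (rule order_tendstoD(1)[OF w_ratio]) simp
  with dot_x_pos show ?thesis
    by eventually_elim (auto simp: zero_less_divide_iff)
qed

lemma w_tendsto_0: "((\<lambda>p. w (fst p) (snd p)) \<longlongrightarrow> 0) seq2"
proof -
  have "((\<lambda>p. w (fst p) (snd p)) \<longlongrightarrow> dot v (\<lambda>l. 1 - 1)) seq2"
    unfolding w_def x_def by (intro tendsto_dot tendsto_diff tendsto_seq2_fst vs_lim hs_lim h_lim)
  then show ?thesis by (simp add: dot_def)
qed

text \<open>The normalised quadratic loss:
  \<open>w k (Suc i) = L k * w k i - q k i * (w k i)\<^sup>2\<close> wherever \<open>w k i\<close>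
  is nonzero.\<close>

definition q where "q k i = (L k * w k i - w k (Suc i)) / (w k i)\<^sup>2"

text \<open>Because \<open>vs\<close> is the exact left eigenvector of the linearisation at the
  fixed point, the linear terms cancel identically and only the second-order remainder is
  left.\<close>

lemma q_lim: "((\<lambda>p. q (fst p) (snd p)) \<longlongrightarrow> Q) seq2"
proof -
  let ?T = "\<lambda>p. dot v (x (fst p) (snd p))"
  have hi: "((\<lambda>g. (mv (dpgf (p (fst g)) (hs (fst g))) (x (fst g) (snd g)) l -
      (pgf (p (fst g)) (hs (fst g)) l - pgf (p (fst g)) (h (fst g) (snd g)) l)) / (?T g)\<^sup>2) \<longlongrightarrow> quad (B l) u / 2) seq2" for l
    using pgf_increment_quadratic_high[where K = fst and X = "\<lambda>p. h (fst p) (snd p)" and Y = "\<lambda>p. hs (fst p)",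
      OF filterlim_fst h_nonneg h_le_hs hs_le_1 h_lim x_direction[unfolded x_def]]
    unfolding x_def .
  have 1: "((\<lambda>g. dot (vs (fst g)) (\<lambda>l. s (fst g) l * ((mv (dpgf (p (fst g)) (hs (fst g))) (x (fst g) (snd g)) l -
      (pgf (p (fst g)) (hs (fst g)) l - pgf (p (fst g)) (h (fst g) (snd g)) l)) / (?T g)\<^sup>2)) /
      (w (fst g) (snd g) / ?T g)\<^sup>2) \<longlongrightarrow> dot v (\<lambda>l. 1 * (quad (B l) u / 2)) / 1\<^sup>2) seq2"
    by (intro tendsto_divide tendsto_power tendsto_dot tendsto_mult hi w_ratio tendsto_seq2_fst s_lim vs_lim) auto
  have Qeq: "dot v (\<lambda>l. 1 * (quad (B l) u / 2)) / 1\<^sup>2 = Q"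
    by (simp add: Q_def dot_def sum_divide_distrib)
  have ev: "\<forall>\<^sub>F g in seq2. dot (vs (fst g)) (\<lambda>l. s (fst g) l * ((mv (dpgf (p (fst g)) (hs (fst g))) (x (fst g) (snd g)) l -
      (pgf (p (fst g)) (hs (fst g)) l - pgf (p (fst g)) (h (fst g) (snd g)) l)) / (?T g)\<^sup>2)) /
      (w (fst g) (snd g) / ?T g)\<^sup>2 = q (fst g) (snd g)"
    using dot_x_pos eventually_seq2_fst[OF As_primitive]
  proof eventually_elim
    case (elim g)
    let ?k = "fst g" and ?i = "snd g"
    have "L ?k * w ?k ?i = dot (mv (tr (As ?k)) (vs ?k)) (x ?k ?i)"
      using left_pvec_eigen[OF elim(2)]
      by (simp add: w_def vs_def L_def dot_def sum_distrib_left mult_ac)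
    also have "\<dots> = dot (vs ?k) (mv (As ?k) (x ?k ?i))" by (simp add: dot_mv)
    also have "mv (As ?k) (x ?k ?i) = (\<lambda>l. s ?k l * mv (dpgf (p ?k) (hs ?k)) (x ?k ?i) l)"
      by (simp add: mv_def As_def fun_eq_iff sum_distrib_left mult_ac)
    finally have Lw: "L ?k * w ?k ?i - w ?k (Suc ?i) =
       dot (vs ?k) (\<lambda>l. s ?k l * mv (dpgf (p ?k) (hs ?k)) (x ?k ?i) l - x ?k (Suc ?i) l)"
      by (simp add: w_def dot_diff_right)
    have "(\<lambda>l. s ?k l * ((mv (dpgf (p ?k) (hs ?k)) (x ?k ?i) l -
      (pgf (p ?k) (hs ?k) l - pgf (p ?k) (h ?k ?i) l)) / (?T g)\<^sup>2)) =
      (\<lambda>l. inverse ((?T g)\<^sup>2) * (s ?k l * mv (dpgf (p ?k) (hs ?k)) (x ?k ?i) l - x ?k (Suc ?i) l))"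
      by (simp add: x_Suc fun_eq_iff field_simps)
    then have "dot (vs ?k) (\<lambda>l. s ?k l * ((mv (dpgf (p ?k) (hs ?k)) (x ?k ?i) l -
      (pgf (p ?k) (hs ?k) l - pgf (p ?k) (h ?k ?i) l)) / (?T g)\<^sup>2)) =
       inverse ((?T g)\<^sup>2) * (L ?k * w ?k ?i - w ?k (Suc ?i))"
      by (simp only: dot_scale_right Lw)
    then show ?case
      using elim(1) by (simp add: q_def power_divide field_simps)
  qed
  show ?thesis using Lim_transform_eventually[OF 1 ev] unfolding Qeq .
qed

text \<open>\<open>w\<close> decreases in the generation, so \<open>L k\<close> is at most
  \<open>1 + q k i * w k i\<close>; for fixed k the last term vanishes as i grows, the iterates
  converging to their fixed point.\<close>

lemma L_le_1: "\<forall>\<^sub>F k in sequentially. L k \<le> 1"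
proof -
  have "\<forall>\<^sub>F p in seq2. q (fst p) (snd p) < Q + 1"
    by (rule order_tendstoD(2)[OF q_lim]) simp
  with w_pos have "\<forall>\<^sub>F p in seq2. 0 < w (fst p) (snd p) \<and> q (fst p) (snd p) < Q + 1"
    by eventually_elim auto
  then obtain N where N: "\<And>k i. k \<ge> N \<Longrightarrow> i \<ge> N \<Longrightarrow> 0 < w k i \<and> q k i < Q + 1"
    unfolding eventually_seq2 by auto
  show ?thesis
    using vs_pos eventually_ge_at_top[of N]
  proof eventually_elim
    case (elim k)
    have lim: "(\<lambda>i. 1 + (Q + 1) * w k i) \<longlonglongrightarrow> 1 + (Q + 1) * dot (vs k) (\<lambda>l. hs k l - hs k l)"
      unfolding w_def x_def by (intro tendsto_intros tendsto_dot h_tendsto_hs)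
    have "L k \<le> 1 + (Q + 1) * w k i" if i: "i \<ge> N" for i
    proof -
      have wp: "0 < w k i" and "q k i < Q + 1" using N[of k i] i elim by auto
      then have "L k * w k i - w k (Suc i) \<le> (Q + 1) * (w k i)\<^sup>2"
        by (simp add: q_def pos_divide_less_eq less_imp_le)
      moreover have "w k (Suc i) \<le> w k i"
        unfolding w_def
      proof (rule dot_mono)
        show "0 \<le> vs k l" for l
          using elim(1) v_pos[of l] by (metis less_imp_le half_gt_zero order_less_trans)
        show "x k (Suc i) l \<le> x k i l" for l using h_Suc_ge by (simp add: x_def)
      qed
      ultimately have "L k * w k i \<le> (1 + (Q + 1) * w k i) * w k i"
        by (simp add: power2_eq_square algebra_simps)
      then show ?thesis using wp by (simp only: mult_le_cancel_right_pos)
    qed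
    then have "L k \<le> 1 + (Q + 1) * dot (vs k) (\<lambda>l. hs k l - hs k l)"
      by (intro LIMSEQ_le_const[OF lim]) blast
    then show "L k \<le> 1" by (simp add: dot_def)
  qed
qed

lemma w_step_ratio: "((\<lambda>p. w (fst p) (Suc (snd p)) / w (fst p) (snd p)) \<longlongrightarrow> 1) seq2"
proof -
  have "((\<lambda>p. L (fst p) - q (fst p) (snd p) * w (fst p) (snd p)) \<longlongrightarrow> 1 - Q * 0) seq2"
    by (intro tendsto_intros tendsto_seq2_fst L_lim q_lim w_tendsto_0)
  then have 1: "((\<lambda>p. L (fst p) - q (fst p) (snd p) * w (fst p) (snd p)) \<longlongrightarrow> 1) seq2" by simp
  have 2: "\<forall>\<^sub>F p in seq2. L (fst p) - q (fst p) (snd p) * w (fst p) (snd p) = w (fst p) (Suc (snd p)) / w (fst p) (snd p)"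
    using w_pos by eventually_elim (simp add: q_def power2_eq_square field_simps)
  show ?thesis by (rule Lim_transform_eventually[OF 1 2])
qed

text \<open>Reciprocals turn the quadratic recursion into a linear one: \<open>1 / w\<close> is
  divided by \<open>L\<close> at each step and gains a term tending to \<open>Q\<close>.\<close>

lemma inverse_w_asymptotics:
  "((\<lambda>p. L (fst p) ^ snd p / (w (fst p) (snd p) * geo (snd p) (L (fst p)))) \<longlongrightarrow> Q) seq2"
proof -
  let ?c = "\<lambda>k i. 1 / w k (Suc i) - 1 / w k i / L k"
  have 1: "((\<lambda>p. q (fst p) (snd p) / (w (fst p) (Suc (snd p)) / w (fst p) (snd p) * L (fst p))) \<longlongrightarrow> Q / (1 * 1)) seq2"
    by (intro tendsto_divide tendsto_mult q_lim w_step_ratio tendsto_seq2_fst L_lim) auto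
  have wS: "\<forall>\<^sub>F p in seq2. 0 < w (fst p) (Suc (snd p))"
    using eventually_seq2_shift[OF w_pos, of 1] by simp
  have 2: "\<forall>\<^sub>F p in seq2. q (fst p) (snd p) / (w (fst p) (Suc (snd p)) / w (fst p) (snd p) * L (fst p)) = ?c (fst p) (snd p)"
    using w_pos wS eventually_seq2_fst[OF L_pos]
    by eventually_elim (simp add: q_def power2_eq_square field_simps)
  have c: "((\<lambda>p. ?c (fst p) (snd p)) \<longlongrightarrow> Q) seq2"
    using Lim_transform_eventually[OF 1 2] by simp
  have LL: "\<forall>\<^sub>F k in sequentially. 0 < L k \<and> L k \<le> 1"
    using L_pos L_le_1 by eventually_elim simp
  have "\<exists>K. \<forall>\<^sub>F k in sequentially. \<bar>1 / w k i\<bar> \<le> K" for i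
  proof -
    obtain c where c: "0 < c" "\<forall>\<^sub>F k in sequentially. c \<le> dot v (x k i)"
      using dot_x_lower by blast
    from vs_pos c(2) have "\<forall>\<^sub>F k in sequentially. \<bar>1 / w k i\<bar> \<le> 2 / c"
    proof eventually_elim
      case (elim k)
      have "dot v (x k i) / 2 \<le> w k i"
        unfolding w_def dot_def sum_divide_distrib
      proof (rule sum_mono)
        fix l
        have "v l / 2 * x k i l \<le> vs k l * x k i l"
          using elim(1) x_nonneg by (intro mult_right_mono) (auto intro: less_imp_le)
        then show "v l * x k i l / 2 \<le> vs k l * x k i l" by simp
      qed
      then have "c / 2 \<le> w k i" using elim(2) by simp
      then show ?case using c(1) by (simp add: field_simps)
    qed
    then show ?thesis by blast
  qed
  then have "((\<lambda>p. L (fst p) ^ snd p * (1 / w (fst p) (snd p)) / geo (snd p) (L (fst p))) \<longlongrightarrow> Q) seq2"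
    by (intro geometric_average[OF L_lim LL c]) auto
  then show ?thesis by simp
qed

lemma geo_pos: "\<forall>\<^sub>F p in seq2. 0 < geo (snd p) (L (fst p))"
  using filterlim_geo_at_top[OF L_lim L_pos] unfolding filterlim_at_top_dense by blast

text \<open>The decrement of w is (1 - L) w + q w^2, in which neither term dominates uniformly as L
  tends to 1. The identity (1 - L) geo = 1 - L^i merges them into one expression.\<close>

lemma dot_increment_asymptotics:
  "((\<lambda>p. dot (vs (fst p)) (d (fst p) (snd p)) * (geo (snd p) (L (fst p)))\<^sup>2 / L (fst p) ^ snd p) \<longlongrightarrow> 1 / Q) seq2"
proof -
  let ?W = "\<lambda>p. w (fst p) (snd p) * geo (snd p) (L (fst p)) / L (fst p) ^ snd p"
  have "((\<lambda>p. inverse (L (fst p) ^ snd p / (w (fst p) (snd p) * geo (snd p) (L (fst p))))) \<longlongrightarrow> inverse Q) seq2"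
    by (intro tendsto_inverse inverse_w_asymptotics) (use Q_pos in simp)
  then have W: "(?W \<longlongrightarrow> 1 / Q) seq2" by (simp add: divide_inverse mult_ac)
  \<comment> \<open>The power of \<open>L\<close> is at most 1, so the error is controlled whether
    that power tends to 1, to 0, or to neither.\<close>
  have z: "((\<lambda>p. L (fst p) ^ snd p * (q (fst p) (snd p) * ?W p - 1)) \<longlongrightarrow> 0) seq2"
  proof (rule Lim_null_comparison)
    have "((\<lambda>p. \<bar>q (fst p) (snd p) * ?W p - 1\<bar>) \<longlongrightarrow> \<bar>Q * (1 / Q) - 1\<bar>) seq2"
      by (intro tendsto_intros q_lim W)
    then show "((\<lambda>p. \<bar>q (fst p) (snd p) * ?W p - 1\<bar>) \<longlongrightarrow> 0) seq2" using Q_pos by simp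
    show "\<forall>\<^sub>F p in seq2. norm (L (fst p) ^ snd p * (q (fst p) (snd p) * ?W p - 1)) \<le> \<bar>q (fst p) (snd p) * ?W p - 1\<bar>"
      using eventually_seq2_fst[OF L_pos] eventually_seq2_fst[OF L_le_1]
    proof eventually_elim
      case (elim p)
      have "\<bar>L (fst p) ^ snd p\<bar> \<le> 1" using elim by (simp add: power_le_one)
      then show ?case unfolding real_norm_def abs_mult using mult_right_mono[of "\<bar>L (fst p) ^ snd p\<bar>" 1] by simp
    qed
  qed
  have "((\<lambda>p. ?W p * (1 + L (fst p) ^ snd p * (q (fst p) (snd p) * ?W p - 1))) \<longlongrightarrow> 1 / Q * (1 + 0)) seq2"
    by (intro tendsto_mult tendsto_add tendsto_const W z)
  then have 1: "((\<lambda>p. ?W p * (1 + L (fst p) ^ snd p * (q (fst p) (snd p) * ?W p - 1))) \<longlongrightarrow> 1 / Q) seq2" by simp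
  have 2: "\<forall>\<^sub>F p in seq2. ?W p * (1 + L (fst p) ^ snd p * (q (fst p) (snd p) * ?W p - 1)) =
     dot (vs (fst p)) (d (fst p) (snd p)) * (geo (snd p) (L (fst p)))\<^sup>2 / L (fst p) ^ snd p"
    using w_pos eventually_seq2_fst[OF L_pos]
  proof eventually_elim
    case (elim p)
    define k i G l ww qq where "k = fst p" and "i = snd p" and "G = geo i (L k)" and "l = L k ^ i"
      and "ww = w k i" and "qq = q k i"
    have l: "0 < l" using elim by (simp add: l_def k_def)
    have "d k i = (\<lambda>l. x k i l - x k (Suc i) l)" by (simp add: d_def x_def)
    then have "dot (vs k) (d k i) = ww - w k (Suc i)" by (simp add: w_def ww_def dot_diff_right)
    also have "w k (Suc i) = L k * ww - qq * ww\<^sup>2"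
      using elim by (simp add: qq_def q_def ww_def k_def i_def)
    also have "ww - (L k * ww - qq * ww\<^sup>2) = (1 - L k) * ww + qq * ww\<^sup>2"
      by (simp add: algebra_simps)
    finally have dd: "dot (vs k) (d k i) = (1 - L k) * ww + qq * ww\<^sup>2" .
    have G: "(1 - L k) * G = 1 - l" by (simp add: G_def l_def geo_telescope)
    have "dot (vs k) (d k i) * G\<^sup>2 / l = ww * G / l * ((1 - L k) * G + qq * ww * G)"
      using l by (simp add: dd power2_eq_square field_simps)
    also have "\<dots> = ww * G / l * (1 + l * (qq * (ww * G / l) - 1))"
      unfolding G using l by (simp add: field_simps)
    finally show ?case unfolding G_def l_def ww_def qq_def k_def i_def by (rule sym)
  qed
  show ?thesis by (rule Lim_transform_eventually[OF 1 2])
qed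

text \<open>Positivity of the increment is read off from the scalar asymptotics; it is the missing
  input for applying \<open>perron_direction\<close> to \<open>d\<close>.\<close>

lemma dot_d_pos: "\<forall>\<^sub>F p in seq2. 0 < dot v (d (fst p) (snd p))"
proof -
  have "\<forall>\<^sub>F p in seq2. 0 < dot (vs (fst p)) (d (fst p) (snd p)) * (geo (snd p) (L (fst p)))\<^sup>2 / L (fst p) ^ snd p"
    by (rule order_tendstoD(1)[OF dot_increment_asymptotics]) (use Q_pos in simp)
  then show ?thesis
  proof eventually_elim
    case (elim p)
    then have "dot (vs (fst p)) (d (fst p) (snd p)) \<noteq> 0" by auto
    have "\<exists>l. d (fst p) (snd p) l \<noteq> 0"
      by (rule ccontr) (use \<open>dot (vs (fst p)) (d (fst p) (snd p)) \<noteq> 0\<close> in \<open>simp add: dot_def\<close>)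
    then obtain l where "d (fst p) (snd p) l \<noteq> 0" by blast
    then show ?case by (intro dot_pos[of v _ l] v_pos d_nonneg)
  qed
qed

lemma d_direction: "((\<lambda>p. d (fst p) (snd p) l / dot v (d (fst p) (snd p))) \<longlongrightarrow> u l) seq2"
  unfolding u_def v_def
proof (rule perron_direction[OF A_primitive A_root])
  show "\<forall>\<^sub>F p in seq2. (\<forall>l. 0 \<le> d (fst p) (snd p) l) \<and> 0 < dot (left_pvec A) (d (fst p) (snd p))"
    using dot_d_pos by eventually_elim (simp add: d_nonneg v_def)
qed (use d_linear in \<open>simp add: v_def\<close>)

lemma increment_asymptotics:
  "((\<lambda>p. d (fst p) (snd p) l * (geo (snd p) (L (fst p)))\<^sup>2 / L (fst p) ^ snd p) \<longlongrightarrow> u l / Q) seq2"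
proof -
  let ?T = "\<lambda>p. dot v (d (fst p) (snd p))"
  have "((\<lambda>p. dot (vs (fst p)) (\<lambda>l. d (fst p) (snd p) l / ?T p)) \<longlongrightarrow> dot v u) seq2"
    by (intro tendsto_dot d_direction tendsto_seq2_fst vs_lim)
  then have r: "((\<lambda>p. dot (vs (fst p)) (d (fst p) (snd p)) / ?T p) \<longlongrightarrow> 1) seq2" by (simp add: dot_divide vu)
  have 1: "((\<lambda>p. d (fst p) (snd p) l / ?T p / (dot (vs (fst p)) (d (fst p) (snd p)) / ?T p) *
      (dot (vs (fst p)) (d (fst p) (snd p)) * (geo (snd p) (L (fst p)))\<^sup>2 / L (fst p) ^ snd p)) \<longlongrightarrow> u l / 1 * (1 / Q)) seq2"
    by (intro tendsto_mult tendsto_divide r d_direction dot_increment_asymptotics) auto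
  have 2: "\<forall>\<^sub>F p in seq2. d (fst p) (snd p) l / ?T p / (dot (vs (fst p)) (d (fst p) (snd p)) / ?T p) *
      (dot (vs (fst p)) (d (fst p) (snd p)) * (geo (snd p) (L (fst p)))\<^sup>2 / L (fst p) ^ snd p) =
      d (fst p) (snd p) l * (geo (snd p) (L (fst p)))\<^sup>2 / L (fst p) ^ snd p"
    using dot_d_pos order_tendstoD(1)[OF r zero_less_one]
  proof eventually_elim
    case (elim p)
    then show ?case by (auto simp: zero_less_divide_iff)
  qed
  show ?thesis using Lim_transform_eventually[OF 1 2] by simp
qed

end

section \<open>Perron roots at perturbed fixed points\<close>

context near_critical
begin

text \<open>Fixed points carry no generation index; they are treated as double sequences constant in
  the second argument, so that the contraction argument applies.\<close>

lemma fixed_direction: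
  assumes e: "\<And>k l. 0 \<le> e k l" "\<forall>\<^sub>F k in sequentially. 0 < dot v (e k)"
    and lin: "\<And>l. (\<lambda>k. (e k l - mv A (e k) l) / dot v (e k)) \<longlonglongrightarrow> 0"
  shows "(\<lambda>k. e k l / dot v (e k)) \<longlonglongrightarrow> u l"
proof -
  have "((\<lambda>p. e (fst p) l / dot v (e (fst p))) \<longlongrightarrow> u l) seq2"
    unfolding u_def v_def
  proof (rule perron_direction[OF A_primitive A_root, of "\<lambda>k i. e k"])
    show "\<forall>\<^sub>F p in seq2. (\<forall>l. 0 \<le> e (fst p) l) \<and> 0 < dot (left_pvec A) (e (fst p))"
      using eventually_seq2_fst[OF e(2)] by eventually_elim (simp add: e(1) v_def)
    show "((\<lambda>p. (e (fst p) l - mv A (e (fst p)) l) / dot (left_pvec A) (e (fst p))) \<longlongrightarrow> 0) seq2" for l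
      using tendsto_seq2_fst[OF lin[of l]] by (simp add: v_def)
  qed
  from filterlim_compose[OF this filterlim_seq2_graph[OF filterlim_ident]]
  show ?thesis by simp
qed

text \<open>Pairing the left vector v2 of \<open>M2\<close> with the right vector u1 of
  \<open>M1\<close> gives an exact identity: the root difference times v2'u1 equals v2'(M1 - M2)
  u1.\<close>

lemma perron_root_perturbation:
  assumes M1: "\<And>i j. (\<lambda>k. M1 k i j) \<longlonglongrightarrow> A i j" "\<And>k i j. 0 \<le> M1 k i j"
    and M2: "\<And>i j. (\<lambda>k. M2 k i j) \<longlonglongrightarrow> A i j" "\<And>k i j. 0 \<le> M2 k i j"
    and D: "\<And>i j. (\<lambda>k. (M1 k i j - M2 k i j) / e k) \<longlonglongrightarrow> D i j"
  shows "(\<lambda>k. (perron_root (M1 k) - perron_root (M2 k)) / e k) \<longlonglongrightarrow> dot v (mv D u)"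
proof -
  let ?u = "\<lambda>k. right_pvec (M1 k)" and ?v = "\<lambda>k. left_pvec (M2 k)"
  have ul: "(\<lambda>k. ?u k l) \<longlonglongrightarrow> u l" for l
    unfolding u_def by (rule tendsto_right_pvec[OF M1(1) A_primitive M1(2)])
  have vl: "(\<lambda>k. ?v k l) \<longlonglongrightarrow> v l" for l
    unfolding v_def by (rule tendsto_left_pvec[OF M2(1) A_primitive M2(2)])
  have uv: "(\<lambda>k. dot (?v k) (?u k)) \<longlonglongrightarrow> 1"
    using tendsto_dot[of ?v v sequentially ?u u] vl ul vu by simp
  have 1: "(\<lambda>k. dot (?v k) (mv (\<lambda>i j. (M1 k i j - M2 k i j) / e k) (?u k)) / dot (?v k) (?u k)) \<longlonglongrightarrow> dot v (mv D u) / 1"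
    by (intro tendsto_divide tendsto_dot tendsto_mv vl ul D uv) auto
  have 2: "\<forall>\<^sub>F k in sequentially. dot (?v k) (mv (\<lambda>i j. (M1 k i j - M2 k i j) / e k) (?u k)) / dot (?v k) (?u k)
     = (perron_root (M1 k) - perron_root (M2 k)) / e k"
    using eventually_primitive[OF M1(1) A_primitive M1(2)] eventually_primitive[OF M2(1) A_primitive M2(2)]
      order_tendstoD(1)[OF uv zero_less_one]
  proof eventually_elim
    case (elim k)
    have "mv (\<lambda>i j. (M1 k i j - M2 k i j) / e k) (?u k) = (\<lambda>i. (mv (M1 k) (?u k) i - mv (M2 k) (?u k) i) / e k)"
      by (simp add: mv_def fun_eq_iff sum_subtractf sum_divide_distrib left_diff_distrib diff_divide_distrib)
    then have "dot (?v k) (mv (\<lambda>i j. (M1 k i j - M2 k i j) / e k) (?u k)) =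
       (dot (?v k) (mv (M1 k) (?u k)) - dot (?v k) (mv (M2 k) (?u k))) / e k"
      by (simp add: dot_divide dot_diff_right)
    also have "dot (?v k) (mv (M1 k) (?u k)) = perron_root (M1 k) * dot (?v k) (?u k)"
      by (simp add: right_pvec_eigen[OF elim(1)] dot_scale_right)
    also have "dot (?v k) (mv (M2 k) (?u k)) = perron_root (M2 k) * dot (?v k) (?u k)"
      by (simp add: dot_mv left_pvec_eigen[OF elim(2)])
         (simp add: dot_commute[of _ "?u k"] dot_scale_right)
    finally show ?case using elim(3) by (cases "e k = 0") (simp_all add: field_simps)
  qed
  show ?thesis using Lim_transform_eventually[OF 1 2] by simp
qed

lemma dot_mv_B: "dot v (mv (\<lambda>i j. \<Sum>m\<in>UNIV. B i j m * u m) u) = 2 * Q"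
proof -
  have "mv (\<lambda>i j. \<Sum>m\<in>UNIV. B i j m * u m) u = (\<lambda>l. quad (B l) u)"
    by (simp add: fun_eq_iff mv_def quad_def sum_distrib_right sum_distrib_left mult_ac)
  then show ?thesis by (simp add: Q_def)
qed

lemma mean_mat_nonneg: "0 \<le> mean_mat (p k) i j"
  unfolding mean_mat_def by (intro dpgf_nonneg[OF moment]) auto

lemma left_pvec_mean_lim: "(\<lambda>k. left_pvec (mean_mat (p k)) l) \<longlonglongrightarrow> v l"
  unfolding v_def by (rule tendsto_left_pvec[OF mean_lim A_primitive mean_mat_nonneg])

lemma right_pvec_mean_lim: "(\<lambda>k. right_pvec (mean_mat (p k)) l) \<longlonglongrightarrow> u l"
  unfolding u_def by (rule tendsto_right_pvec[OF mean_lim A_primitive mean_mat_nonneg])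

lemma Qconst_lim: "(\<lambda>k. Qconst (p k)) \<longlonglongrightarrow> Q"
proof -
  have "Qconst (p k) = dot (left_pvec (mean_mat (p k))) (\<lambda>l. quad (bcoef (p k) l) (right_pvec (mean_mat (p k)))) / 2" for k
    by (simp add: Qconst_def Let_def dot_def quad_def)
  moreover have "(\<lambda>k. dot (left_pvec (mean_mat (p k))) (\<lambda>l. quad (bcoef (p k) l) (right_pvec (mean_mat (p k)))) / 2) \<longlonglongrightarrow> Q"
    unfolding Q_def
    by (intro tendsto_divide tendsto_dot tendsto_quad left_pvec_mean_lim right_pvec_mean_lim bcoef_lim tendsto_const) auto
  ultimately show ?thesis by (simp only:)
qed

interpretation one: near_critical_s p C A B "\<lambda>k l. 1"
  by unfold_locales auto

text \<open>With t the component of 1 - \<mu> along v, moving the base point from 1 to \<mu> gives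
  \<rho> - L = 2 Q t, while the fixed point equation gives \<rho> - 1 = Q t, both to leading order.
  Subtracting, 1 - L = Q t as well.\<close>

lemma extinction_root_supercritical:
  assumes ne: "\<And>k. one.hs k \<noteq> (\<lambda>_. 1)"
  shows "(\<lambda>k. (1 - one.L k) / \<bar>1 - rho (p k)\<bar>) \<longlonglongrightarrow> 1"
proof -
  define e where "e k = (\<lambda>l. 1 - one.hs k l)" for k
  define t where "t k = dot v (e k)" for k
  have e0: "0 \<le> e k l" for k l using one.hs_le_1 by (simp add: e_def)
  have tpos: "0 < t k" for k
  proof -
    obtain l where "one.hs k l \<noteq> 1" using ne[of k] by auto
    then show ?thesis unfolding t_def by (intro dot_pos[of v _ l] v_pos e0) (simp add: e_def)
  qed
  note inst = filterlim_ident one.hs_nonneg one.hs_le_1 order_refl one.hs_lim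
  have e_eq: "e k l = pgf (p k) (\<lambda>_. 1) l - pgf (p k) (one.hs k) l" for k l
    using one.hs_fixpoint[of k l] by (simp add: e_def)
  have lin: "(\<lambda>k. (e k l - mv A (e k) l) / t k) \<longlonglongrightarrow> 0" for l
    using pgf_increment_linear[where K = "\<lambda>k. k" and X = one.hs and Y = "\<lambda>_ _. 1", OF inst, of l]
    unfolding t_def e_eq[symmetric] unfolding e_def .
  have dir: "(\<lambda>k. e k l / t k) \<longlonglongrightarrow> u l" for l
    unfolding t_def by (rule fixed_direction[OF e0]) (use tpos lin in \<open>auto simp: t_def\<close>)
  have "(\<lambda>k. (perron_root (mean_mat (p k)) - perron_root (one.As k)) / t k)
      \<longlonglongrightarrow> dot v (mv (\<lambda>i j. \<Sum>m\<in>UNIV. B i j m * u m) u)"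
  proof (rule perron_root_perturbation[OF mean_lim mean_mat_nonneg one.As_lim one.As_nonneg])
    fix i j
    show "(\<lambda>k. (mean_mat (p k) i j - one.As k i j) / t k) \<longlonglongrightarrow> (\<Sum>m\<in>UNIV. B i j m * u m)"
      using dpgf_increment[where K = "\<lambda>k. k" and X = one.hs and Y = "\<lambda>_ _. 1", OF inst dir[unfolded t_def e_def], of i j]
      by (simp add: one.As_def mean_mat_def t_def e_def)
  qed
  then have d1: "(\<lambda>k. (rho (p k) - one.L k) / t k) \<longlonglongrightarrow> 2 * Q"
    unfolding dot_mv_B by (simp add: rho_def one.L_def)
  have quad: "(\<lambda>k. (mv (mean_mat (p k)) (e k) l - e k l) / (t k)\<^sup>2) \<longlonglongrightarrow> quad (B l) u / 2" for l
    using pgf_increment_quadratic_high[where K = "\<lambda>k. k" and X = one.hs and Y = "\<lambda>_ _. 1", OF inst dir[unfolded t_def e_def], of l]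
    unfolding t_def e_eq[symmetric] mean_mat_def unfolding e_def .
  let ?v = "\<lambda>k. left_pvec (mean_mat (p k))"
  have E: "(\<lambda>k. dot (?v k) (\<lambda>l. e k l / t k)) \<longlonglongrightarrow> 1"
    by (subst vu[symmetric]) (intro tendsto_dot left_pvec_mean_lim dir)
  have 1: "(\<lambda>k. dot (?v k) (\<lambda>l. (mv (mean_mat (p k)) (e k) l - e k l) / (t k)\<^sup>2) / dot (?v k) (\<lambda>l. e k l / t k))
      \<longlonglongrightarrow> dot v (\<lambda>l. quad (B l) u / 2) / 1"
    by (intro tendsto_divide tendsto_dot left_pvec_mean_lim quad E) auto
  have 2: "\<forall>\<^sub>F k in sequentially. dot (?v k) (\<lambda>l. (mv (mean_mat (p k)) (e k) l - e k l) / (t k)\<^sup>2) / dot (?v k) (\<lambda>l. e k l / t k)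
      = (rho (p k) - 1) / t k"
    using eventually_primitive[OF mean_lim A_primitive mean_mat_nonneg] order_tendstoD(1)[OF E zero_less_one]
  proof eventually_elim
    case (elim k)
    have "dot (?v k) (mv (mean_mat (p k)) (e k)) = rho (p k) * dot (?v k) (e k)"
      by (simp add: dot_mv left_pvec_eigen[OF elim(1)])
         (simp add: rho_def dot_commute[of _ "e k"] dot_scale_right)
    then show ?case
      using elim(2) tpos[of k] by (simp add: dot_divide dot_diff_right power2_eq_square field_simps zero_less_mult_iff)
  qed
  have "dot v (\<lambda>l. quad (B l) u / 2) = Q" by (simp add: dot_divide Q_def)
  then have d2: "(\<lambda>k. (rho (p k) - 1) / t k) \<longlonglongrightarrow> Q"
    using Lim_transform_eventually[OF 1 2] by simp
  have 3: "(\<lambda>k. ((rho (p k) - one.L k) / t k - (rho (p k) - 1) / t k) / ((rho (p k) - 1) / t k)) \<longlonglongrightarrow> (2 * Q - Q) / Q"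
    by (intro tendsto_intros d1 d2) (use Q_pos in simp)
  have 4: "\<forall>\<^sub>F k in sequentially. ((rho (p k) - one.L k) / t k - (rho (p k) - 1) / t k) / ((rho (p k) - 1) / t k)
      = (1 - one.L k) / \<bar>1 - rho (p k)\<bar>"
    using order_tendstoD(1)[OF d2 Q_pos]
  proof eventually_elim
    case (elim k)
    then have "0 < rho (p k) - 1" using tpos[of k] by (simp add: zero_less_divide_iff)
    then show ?case using tpos[of k] by (simp add: field_simps)
  qed
  show ?thesis using Lim_transform_eventually[OF 3 4] Q_pos by simp
qed

text \<open>Below or at criticality the extinction probability is \<open>1\<close> and \<open>\<rho>\<^sub>\<mu> = \<rho>\<close>; otherwise the two
  roots lie asymptotically symmetrically about \<open>1\<close>.\<close>

lemma extinction_root: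
  assumes "(\<forall>k. one.hs k = (\<lambda>_. 1)) \<or> (\<forall>k. one.hs k \<noteq> (\<lambda>_. 1))"
  shows "\<exists>c. c \<longlonglongrightarrow> 1 \<and> (\<forall>\<^sub>F k in sequentially. 1 - one.L k = c k * \<bar>1 - rho (p k)\<bar>)"
  using assms
proof
  assume eq: "\<forall>k. one.hs k = (\<lambda>_. 1)"
  have "one.L k = rho (p k)" for k
  proof -
    have "one.hs k = (\<lambda>_. 1)" using eq by blast
    then have "one.As k = mean_mat (p k)"
      by (intro ext) (simp only: one.As_def mean_mat_def mult_1)
    then show ?thesis by (simp add: one.L_def rho_def)
  qed
  then show ?thesis
    using one.L_le_1 by (intro exI[of _ "\<lambda>_. 1"]) (auto elim!: eventually_mono)
next
  assume ne: "\<forall>k. one.hs k \<noteq> (\<lambda>_. 1)"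
  let ?c = "\<lambda>k. (1 - one.L k) / \<bar>1 - rho (p k)\<bar>"
  have c: "?c \<longlonglongrightarrow> 1" using extinction_root_supercritical ne by blast
  have "\<forall>\<^sub>F k in sequentially. 1 - one.L k = ?c k * \<bar>1 - rho (p k)\<bar>"
    using order_tendstoD(1)[OF c zero_less_one] by eventually_elim (auto simp: zero_less_divide_iff)
  then show ?thesis using c by blast
qed

end

context near_critical_s
begin

interpretation one: near_critical_s p C A B "\<lambda>k l. 1"
  by unfold_locales auto

lemma h_le_one_h: "h k i l \<le> one.h k i l"
proof (induction i arbitrary: l)
  case (Suc i)
  have "pgf (p k) (h k i) l \<le> pgf (p k) (one.h k i) l"
    by (rule pgf_mono[OF moment]) (auto intro: h_nonneg Suc one.h_le_1)
  then have "s k l * pgf (p k) (h k i) l \<le> 1 * pgf (p k) (one.h k i) l"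
    by (intro mult_mono s_le_1 pgf_nonneg[OF moment] h_nonneg) auto
  then show ?case by (simp add: h_Suc one.h_Suc)
qed simp

lemma hs_le_one_hs: "hs k l \<le> one.hs k l"
  by (rule LIMSEQ_le[OF h_tendsto_hs one.h_tendsto_hs]) (auto intro: h_le_one_h)

text \<open>Subtracting the fixed point equations of \<open>hs\<close> and of the extinction probability gives one
  relation for the gap between the two fixed points, perturbing the Perron root a second one;
  eliminating the gap leaves a quadratic relation between the two roots.\<close>

lemma perturbed_root:
  assumes kap: "filterlim \<kappa> at_top sequentially"
    and g: "\<And>l. (\<lambda>k. \<kappa> k * (1 - s k l)) \<longlonglongrightarrow> g l" and T: "0 < dot v g"
  shows "(\<lambda>k. \<kappa> k * ((1 - L k)\<^sup>2 - (1 - one.L k)\<^sup>2)) \<longlonglongrightarrow> 4 * Q * dot v g"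
proof -
  define e where "e k = (\<lambda>l. one.hs k l - hs k l)" for k
  define t where "t k = dot v (e k)" for k
  define \<sigma> where "\<sigma> k = (\<lambda>l. (1 - s k l) * one.hs k l)" for k
  have e0: "0 \<le> e k l" for k l using hs_le_one_hs by (simp add: e_def)
  have kpos: "\<forall>\<^sub>F k in sequentially. 0 < \<kappa> k"
    using kap by (simp add: filterlim_at_top_dense)
  have e_eq: "e k l = s k l * (pgf (p k) (one.hs k) l - pgf (p k) (hs k) l) + \<sigma> k l" for k l
    using one.hs_fixpoint[of k l] hs_fixpoint[of k l] by (simp add: e_def \<sigma>_def algebra_simps)
  have ksig: "(\<lambda>k. \<kappa> k * \<sigma> k l) \<longlonglongrightarrow> g l" for l
    using tendsto_mult[OF g[of l] one.hs_lim[of l]] by (simp add: \<sigma>_def mult_ac)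
  have dot_ksig: "(\<lambda>k. \<kappa> k * dot (y k) (\<sigma> k)) \<longlonglongrightarrow> dot z g" if "\<And>l. (\<lambda>k. y k l) \<longlonglongrightarrow> z l" for y z
  proof -
    have "(\<lambda>k. dot (y k) (\<lambda>l. \<kappa> k * \<sigma> k l)) \<longlonglongrightarrow> dot z g" by (intro tendsto_dot that ksig)
    then show ?thesis by (simp add: dot_scale_right)
  qed
  have sig_nonneg: "0 \<le> \<sigma> k l" for k l
    using s_le_1[of k l] one.hs_nonneg[of k l] by (simp add: \<sigma>_def)
  have vsig: "(\<lambda>k. \<kappa> k * dot v (\<sigma> k)) \<longlonglongrightarrow> dot v g" by (rule dot_ksig) simp
  \<comment> \<open>The gap dominates \<open>\<sigma>\<close>, since the remaining part of
    \<open>e\<close> is nonnegative.\<close>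
  have tpos: "\<forall>\<^sub>F k in sequentially. 0 < t k"
    using order_tendstoD(1)[OF vsig T] kpos
  proof eventually_elim
    case (elim k)
    have "\<sigma> k l \<le> e k l" for l
      unfolding e_eq using pgf_mono[OF moment, of "hs k" "one.hs k" k l] hs_le_one_hs one.hs_le_1 hs_nonneg
      by (simp add: s_nonneg)
    then have "dot v (\<sigma> k) \<le> t k" unfolding t_def by (intro dot_mono v_nonneg)
    moreover have "0 < dot v (\<sigma> k)" using elim by (simp add: zero_less_mult_iff)
    ultimately show ?case by simp
  qed
  note inst = filterlim_ident hs_nonneg hs_le_one_hs one.hs_le_1 hs_lim
  have lin0: "(\<lambda>k. (s k l * (pgf (p k) (one.hs k) l - pgf (p k) (hs k) l) - mv A (e k) l) / t k) \<longlonglongrightarrow> 0" for l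
    using scaled_pgf_increment_linear[where K = "\<lambda>k. k" and X = hs and Y = one.hs, OF inst s_lim, of l l]
    by (simp only: t_def e_def)
  have "(\<lambda>k. - dot v (\<lambda>l. (s k l * (pgf (p k) (one.hs k) l - pgf (p k) (hs k) l) - mv A (e k) l) / t k)) \<longlonglongrightarrow> - dot v (\<lambda>_. 0)"
    by (intro tendsto_intros tendsto_dot lin0)
  moreover have "- dot v (\<lambda>l. (s k l * (pgf (p k) (one.hs k) l - pgf (p k) (hs k) l) - mv A (e k) l) / t k)
     = dot v (\<sigma> k) / t k" for k
  proof -
    have "(\<lambda>l. (s k l * (pgf (p k) (one.hs k) l - pgf (p k) (hs k) l) - mv A (e k) l)) = (\<lambda>l. (e k l - \<sigma> k l) - mv A (e k) l)"
      by (simp add: e_eq fun_eq_iff)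
    then show ?thesis by (simp add: dot_divide) (simp add: dot_diff_right dot_v_mv_A)
  qed
  ultimately have sig_t: "(\<lambda>k. dot v (\<sigma> k) / t k) \<longlonglongrightarrow> 0" by (simp add: dot_def)
  \<comment> \<open>\<open>\<sigma>\<close> has order \<open>1 / \<kappa>\<close> along v but is
    negligible against the gap t, so t has larger order. Hence replacing s by 1 changes the matrices
    only at an order below t.\<close>
  have kt: "(\<lambda>k. 1 / (\<kappa> k * t k)) \<longlonglongrightarrow> 0"
  proof -
    have 1: "(\<lambda>k. dot v (\<sigma> k) / t k / (\<kappa> k * dot v (\<sigma> k))) \<longlonglongrightarrow> 0 / dot v g"
      by (intro tendsto_divide sig_t vsig) (use T in simp)
    have 2: "\<forall>\<^sub>F k in sequentially. dot v (\<sigma> k) / t k / (\<kappa> k * dot v (\<sigma> k)) = 1 / (\<kappa> k * t k)"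
      using order_tendstoD(1)[OF vsig T] by eventually_elim (auto simp: field_simps)
    show ?thesis using Lim_transform_eventually[OF 1 2] by simp
  qed
  have over_t: "(\<lambda>k. z k / t k) \<longlonglongrightarrow> 0" if z: "(\<lambda>k. \<kappa> k * z k) \<longlonglongrightarrow> y" for z :: "nat \<Rightarrow> real" and y
  proof -
    have 1: "(\<lambda>k. \<kappa> k * z k * (1 / (\<kappa> k * t k))) \<longlonglongrightarrow> y * 0" by (intro tendsto_mult z kt)
    have 2: "\<forall>\<^sub>F k in sequentially. \<kappa> k * z k * (1 / (\<kappa> k * t k)) = z k / t k"
      using kpos by eventually_elim simp
    show ?thesis using Lim_transform_eventually[OF 1 2] by simp
  qed
  have lin: "(\<lambda>k. (e k l - mv A (e k) l) / t k) \<longlonglongrightarrow> 0" for l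
  proof -
    have "(\<lambda>k. (s k l * (pgf (p k) (one.hs k) l - pgf (p k) (hs k) l) - mv A (e k) l) / t k + \<sigma> k l / t k) \<longlonglongrightarrow> 0 + 0"
      by (intro tendsto_add lin0 over_t[OF ksig])
    moreover have "(s k l * (pgf (p k) (one.hs k) l - pgf (p k) (hs k) l) - mv A (e k) l) / t k + \<sigma> k l / t k
      = (e k l - mv A (e k) l) / t k" for k
      by (simp add: e_eq[of k l] add_divide_distrib diff_divide_distrib)
    ultimately show ?thesis by simp
  qed
  have dir: "(\<lambda>k. e k l / t k) \<longlonglongrightarrow> u l" for l
    unfolding t_def by (rule fixed_direction[OF e0]) (use tpos lin in \<open>auto simp: t_def\<close>)

  define X where "X k = (one.L k - L k) / t k" for k
  have "(\<lambda>k. (perron_root (one.As k) - perron_root (As k)) / t k)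
      \<longlonglongrightarrow> dot v (mv (\<lambda>i j. \<Sum>m\<in>UNIV. B i j m * u m) u)"
  proof (rule perron_root_perturbation[OF one.As_lim one.As_nonneg As_lim As_nonneg])
    fix i j
    have "(\<lambda>k. (dpgf (p k) (one.hs k) i j - dpgf (p k) (hs k) i j) / t k + (1 - s k i) / t k * dpgf (p k) (hs k) i j)
       \<longlonglongrightarrow> (\<Sum>m\<in>UNIV. B i j m * u m) + 0 * A i j"
      using dpgf_increment[where K = "\<lambda>k. k" and X = hs and Y = one.hs, OF inst dir[unfolded t_def e_def], of i j]
      by (intro tendsto_add tendsto_mult over_t[OF g] dpgf_hs_lim) (simp only: t_def e_def)
    moreover have "(dpgf (p k) (one.hs k) i j - dpgf (p k) (hs k) i j) / t k + (1 - s k i) / t k * dpgf (p k) (hs k) i j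
      = (one.As k i j - As k i j) / t k" for k
      by (cases "t k = 0") (simp_all add: one.As_def As_def field_simps)
    ultimately show "(\<lambda>k. (one.As k i j - As k i j) / t k) \<longlonglongrightarrow> (\<Sum>m\<in>UNIV. B i j m * u m)" by simp
  qed
  then have X: "X \<longlonglongrightarrow> 2 * Q"
    unfolding dot_mv_B X_def by (simp add: L_def one.L_def)

  define R where "R k l = pgf (p k) (one.hs k) l - pgf (p k) (hs k) l - mv (dpgf (p k) (hs k)) (e k) l" for k l
  have R: "(\<lambda>k. R k l / (t k)\<^sup>2) \<longlonglongrightarrow> quad (B l) u / 2" for l
    using pgf_increment_quadratic_low[where K = "\<lambda>k. k" and X = hs and Y = one.hs, OF inst dir[unfolded t_def e_def], of l]
    by (simp only: R_def t_def e_def)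
  define P where "P k = dot (vs k) (\<lambda>l. s k l * (R k l / (t k)\<^sup>2))" for k
  have "P \<longlonglongrightarrow> dot v (\<lambda>l. 1 * (quad (B l) u / 2))"
    unfolding P_def by (intro tendsto_dot vs_lim tendsto_mult s_lim R)
  moreover have "dot v (\<lambda>l. 1 * (quad (B l) u / 2)) = Q" by (simp add: dot_divide Q_def)
  ultimately have P: "P \<longlonglongrightarrow> Q" by simp
  define S where "S k = \<kappa> k * dot (vs k) (\<sigma> k)" for k
  have S: "S \<longlonglongrightarrow> dot v g" unfolding S_def by (rule dot_ksig[OF vs_lim])
  define E where "E k = dot (vs k) (\<lambda>l. e k l / t k)" for k
  have E: "E \<longlonglongrightarrow> 1" unfolding E_def by (subst vu[symmetric]) (intro tendsto_dot vs_lim dir)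
  \<comment> \<open>The two fixed point equations paired with the exact left eigenvector of
    \<open>As\<close>: to leading order (1 - L) t = Q t^2 + v'\<sigma>, multiplied by
    \<open>\<kappa>\<close>.\<close>
  have balance: "\<forall>\<^sub>F k in sequentially. (1 - L k) * t k * \<kappa> k * E k = P k * (\<kappa> k * (t k)\<^sup>2) + S k"
    using As_primitive tpos
  proof eventually_elim
    case (elim k)
    have "L k * dot (vs k) (e k) = dot (mv (tr (As k)) (vs k)) (e k)"
      using left_pvec_eigen[OF elim(1)] by (simp add: vs_def L_def dot_def sum_distrib_left mult_ac)
    also have "\<dots> = dot (vs k) (mv (As k) (e k))" by (simp add: dot_mv)
    finally have "(1 - L k) * dot (vs k) (e k) = dot (vs k) (\<lambda>l. e k l - mv (As k) (e k) l)"
      by (simp add: dot_diff_right algebra_simps)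
    also have "(\<lambda>l. e k l - mv (As k) (e k) l) = (\<lambda>l. (t k)\<^sup>2 * (s k l * (R k l / (t k)\<^sup>2)) + \<sigma> k l)"
    proof
      fix l
      have "mv (As k) (e k) l = s k l * mv (dpgf (p k) (hs k)) (e k) l"
        by (simp add: mv_def As_def sum_distrib_left mult_ac)
      then have "e k l - mv (As k) (e k) l = s k l * R k l + \<sigma> k l"
        by (simp add: e_eq[of k l] R_def algebra_simps)
      then show "e k l - mv (As k) (e k) l = (t k)\<^sup>2 * (s k l * (R k l / (t k)\<^sup>2)) + \<sigma> k l"
        using elim(2) by simp
    qed
    also have "dot (vs k) \<dots> = (t k)\<^sup>2 * P k + dot (vs k) (\<sigma> k)"
      by (simp only: dot_add_right dot_scale_right P_def)
    finally have b: "(1 - L k) * dot (vs k) (e k) = (t k)\<^sup>2 * P k + dot (vs k) (\<sigma> k)" .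
    have "(1 - L k) * t k * \<kappa> k * E k = \<kappa> k * ((1 - L k) * dot (vs k) (e k))"
      using elim(2) by (simp add: E_def dot_divide)
    also have "\<dots> = P k * (\<kappa> k * (t k)\<^sup>2) + S k"
      unfolding b by (simp add: S_def algebra_simps)
    finally show ?case .
  qed

  \<comment> \<open>As \<open>one.L k\<close> is at most 1, X t is at most 1 - L. Inserted into the
    balance, this bounds (X - P / E) \<kappa> t^2 by S / E, and the coefficient X - P / E tends to Q
    > 0.\<close>
  have bounded: "\<forall>\<^sub>F k in sequentially. \<bar>\<kappa> k * (t k)\<^sup>2\<bar> \<le> (dot v g + 1) / (Q / 2)"
  proof -
    have "(\<lambda>k. X k - P k / E k) \<longlonglongrightarrow> 2 * Q - Q / 1" by (intro tendsto_intros X P E) auto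
    then have "\<forall>\<^sub>F k in sequentially. Q / 2 < X k - P k / E k"
      by (rule order_tendstoD(1)) (use Q_pos in simp)
    moreover have "(\<lambda>k. S k / E k) \<longlonglongrightarrow> dot v g / 1" by (intro tendsto_intros S E) auto
    then have "\<forall>\<^sub>F k in sequentially. S k / E k < dot v g + 1"
      by (rule order_tendstoD(2)) simp
    ultimately show ?thesis
      using balance tpos kpos one.L_le_1 order_tendstoD(1)[OF E zero_less_one]
    proof eventually_elim
      case (elim k)
      have pos: "0 < \<kappa> k * (t k)\<^sup>2" using elim by simp
      have "X k * t k = one.L k - L k" using elim by (simp add: X_def)
      also have "\<dots> \<le> 1 - L k" using elim by simp
      finally have "X k * t k * (t k * \<kappa> k) \<le> (1 - L k) * (t k * \<kappa> k)"
        using elim by (intro mult_right_mono) auto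
      also have "\<dots> = P k / E k * (\<kappa> k * (t k)\<^sup>2) + S k / E k"
        using elim(3,7) by (simp add: field_simps)
      finally have "(X k - P k / E k) * (\<kappa> k * (t k)\<^sup>2) \<le> S k / E k"
        by (simp add: power2_eq_square algebra_simps)
      moreover have "Q / 2 * (\<kappa> k * (t k)\<^sup>2) \<le> (X k - P k / E k) * (\<kappa> k * (t k)\<^sup>2)"
        using elim(1) pos by (intro mult_right_mono) auto
      ultimately have "\<kappa> k * (t k)\<^sup>2 * (Q / 2) \<le> dot v g + 1" using elim(2) by (simp add: mult.commute)
      then have "\<kappa> k * (t k)\<^sup>2 \<le> (dot v g + 1) / (Q / 2)"
        using Q_pos by (simp only: pos_le_divide_eq half_gt_zero)
      then show ?case using pos by simp
    qed
  qed
  have small: "(\<lambda>k. \<kappa> k * (t k)\<^sup>2 * (2 * (P k / E k) - X k)) \<longlonglongrightarrow> 0"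
  proof (rule Lim_null_comparison)
    have "(\<lambda>k. (dot v g + 1) / (Q / 2) * \<bar>2 * (P k / E k) - X k\<bar>) \<longlonglongrightarrow> (dot v g + 1) / (Q / 2) * \<bar>2 * (Q / 1) - 2 * Q\<bar>"
      by (intro tendsto_intros P E X) auto
    then show "(\<lambda>k. (dot v g + 1) / (Q / 2) * \<bar>2 * (P k / E k) - X k\<bar>) \<longlonglongrightarrow> 0" by simp
    show "\<forall>\<^sub>F k in sequentially. norm (\<kappa> k * (t k)\<^sup>2 * (2 * (P k / E k) - X k))
       \<le> (dot v g + 1) / (Q / 2) * \<bar>2 * (P k / E k) - X k\<bar>"
      using bounded
    proof eventually_elim
      case (elim k)
      then show ?case
        unfolding real_norm_def abs_mult[of "\<kappa> k * (t k)\<^sup>2"] by (intro mult_right_mono) auto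
    qed
  qed
  \<comment> \<open>Factor a^2 - b^2 = (a - b) (2 a - (a - b)) with a - b = X t. The balance
    replaces a t, and the two t^2 terms cancel in the limit because both have coefficient 2
    Q.\<close>
  have 1: "(\<lambda>k. X k * (\<kappa> k * (t k)\<^sup>2 * (2 * (P k / E k) - X k) + 2 * (S k / E k))) \<longlonglongrightarrow> 2 * Q * (0 + 2 * (dot v g / 1))"
    by (intro tendsto_mult X tendsto_add small tendsto_divide S E tendsto_const) auto
  have 2: "\<forall>\<^sub>F k in sequentially. X k * (\<kappa> k * (t k)\<^sup>2 * (2 * (P k / E k) - X k) + 2 * (S k / E k))
      = \<kappa> k * ((1 - L k)\<^sup>2 - (1 - one.L k)\<^sup>2)"
    using balance tpos order_tendstoD(1)[OF E zero_less_one]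
  proof eventually_elim
    case (elim k)
    define a b where "a = 1 - L k" and "b = 1 - one.L k"
    have Xt: "X k * t k = a - b" using elim by (simp add: X_def a_def b_def)
    have bal: "a * t k * \<kappa> k = P k / E k * (\<kappa> k * (t k)\<^sup>2) + S k / E k"
      using elim by (simp add: field_simps a_def)
    have "X k * (\<kappa> k * (t k)\<^sup>2 * (2 * (P k / E k) - X k) + 2 * (S k / E k))
      = X k * (2 * (P k / E k * (\<kappa> k * (t k)\<^sup>2) + S k / E k) - \<kappa> k * t k * (X k * t k))"
      by (simp add: power2_eq_square algebra_simps)
    also have "\<dots> = X k * t k * \<kappa> k * (2 * a - X k * t k)"
      unfolding bal[symmetric] by (simp add: algebra_simps)
    also have "\<dots> = \<kappa> k * (a\<^sup>2 - b\<^sup>2)"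
      unfolding Xt by (simp add: power2_eq_square algebra_simps)
    finally show ?case by (simp add: a_def b_def)
  qed
  show ?thesis using Lim_transform_eventually[OF 1 2] by (simp add: mult.assoc)
qed

end

section \<open>Generating functions of Galton--Watson paths\<close>

text \<open>Iterated expectation holds for the nonnegative integral; boundedness of \<open>f\<close>
  carries it over to real expectations.\<close>

lemma expectation_bind_pmf:
  fixes f :: "'b \<Rightarrow> real"
  assumes f: "\<And>x. 0 \<le> f x" "\<And>x. f x \<le> 1"
  shows "measure_pmf.expectation (bind_pmf M N) f = measure_pmf.expectation M (\<lambda>x. measure_pmf.expectation (N x) f)"
proof -
  have int: "integrable (measure_pmf P) f" for P
    by (rule measure_pmf.integrable_const_bound[of _ 1]) (use f in auto)
  have b: "0 \<le> measure_pmf.expectation (N x) f" "measure_pmf.expectation (N x) f \<le> 1" for x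
    using f int[of "N x"] measure_pmf.integral_le_const[of "N x" f 1]
    by (auto intro: Bochner_Integration.integral_nonneg)
  have int2: "integrable (measure_pmf M) (\<lambda>x. measure_pmf.expectation (N x) f)"
    by (rule measure_pmf.integrable_const_bound[of _ 1]) (use b in auto)
  have "ennreal (measure_pmf.expectation (bind_pmf M N) f) = (\<integral>\<^sup>+ x. ennreal (f x) \<partial>bind_pmf M N)"
    by (rule nn_integral_eq_integral[OF int, symmetric]) (use f in auto)
  also have "\<dots> = (\<integral>\<^sup>+ x. \<integral>\<^sup>+ y. ennreal (f y) \<partial>N x \<partial>M)" by simp
  also have "\<dots> = (\<integral>\<^sup>+ x. ennreal (measure_pmf.expectation (N x) f) \<partial>M)"
    by (intro nn_integral_cong nn_integral_eq_integral int) (use f in auto)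
  also have "\<dots> = ennreal (measure_pmf.expectation M (\<lambda>x. measure_pmf.expectation (N x) f))"
    by (rule nn_integral_eq_integral[OF int2]) (use b in auto)
  finally show ?thesis
    using b f by (subst (asm) ennreal_inj) (auto intro!: Bochner_Integration.integral_nonneg)
qed

lemma expectation_cond_pmf:
  fixes f :: "'a \<Rightarrow> real"
  assumes f: "\<And>x. 0 \<le> f x" "\<And>x. f x \<le> 1" and ne: "set_pmf M \<inter> S \<noteq> {}"
  shows "measure_pmf.expectation (cond_pmf M S) f =
    measure_pmf.expectation M (\<lambda>x. f x * indicator S x) / measure_pmf.prob M S"
proof -
  have int: "integrable (measure_pmf P) f" for P
    by (rule measure_pmf.integrable_const_bound[of _ 1]) (use f in auto)
  have int2: "integrable (measure_pmf M) (\<lambda>x. f x * indicator S x)"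
    by (rule measure_pmf.integrable_const_bound[of _ 1]) (use f in \<open>auto simp: indicator_def\<close>)
  have pos: "0 < measure_pmf.prob M S"
    using ne by (simp add: measure_pmf_zero_iff zero_less_measure_iff measure_pmf.emeasure_eq_measure)
  have "ennreal (measure_pmf.expectation (cond_pmf M S) f) = (\<integral>\<^sup>+ x. ennreal (f x) \<partial>cond_pmf M S)"
    by (rule nn_integral_eq_integral[OF int, symmetric]) (use f in auto)
  also have "\<dots> = (\<integral>\<^sup>+ x. ennreal (f x) \<partial>uniform_measure (measure_pmf M) S)"
    by (simp add: cond_pmf.rep_eq[OF ne])
  also have "\<dots> = (\<integral>\<^sup>+ x. ennreal (f x) * indicator S x \<partial>M) / emeasure M S"
    by (rule nn_integral_uniform_measure) auto
  also have "(\<integral>\<^sup>+ x. ennreal (f x) * indicator S x \<partial>M) = (\<integral>\<^sup>+ x. ennreal (f x * indicator S x) \<partial>M)"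
    by (intro nn_integral_cong) (simp add: indicator_def)
  also have "\<dots> = ennreal (measure_pmf.expectation M (\<lambda>x. f x * indicator S x))"
    by (rule nn_integral_eq_integral[OF int2]) (use f in auto)
  also have "\<dots> / emeasure M S = ennreal (measure_pmf.expectation M (\<lambda>x. f x * indicator S x) / measure_pmf.prob M S)"
    using pos f by (simp add: measure_pmf.emeasure_eq_measure divide_ennreal Bochner_Integration.integral_nonneg)
  finally show ?thesis
    using pos f by (subst (asm) ennreal_inj)
      (auto intro!: Bochner_Integration.integral_nonneg divide_nonneg_pos)
qed

section \<open>Monomials, independent sums and absorption at zero\<close>

lemma mon_zero_vec [simp]: "mon s (\<lambda>_. 0) = 1"
  by (simp add: mon_def)

lemma mon_add: "mon s (\<lambda>l. a l + b l) = mon s a * mon s b"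
  by (simp add: mon_def power_add prod.distrib)

lemma mon_mult: "mon (\<lambda>l. s l * x l) n = mon s n * mon x n"
  by (simp add: mon_def power_mult_distrib prod.distrib)

lemma mon_sum: "mon s (\<lambda>l. \<Sum>k\<in>K. g k l) = (\<Prod>k\<in>K. mon s (g k))"
  unfolding mon_def by (simp add: power_sum prod.swap[of _ UNIV])

lemma mon_0: "mon (\<lambda>_. 0) n = (if n = (\<lambda>_. 0) then 1 else 0)"
  by (auto simp: mon_def fun_eq_iff zero_power)

lemma mon_unit_vec [simp]: "mon y (unit_vec j) = y j"
proof -
  have "mon y (unit_vec j) = (\<Prod>l\<in>UNIV. if l = j then y l else 1)"
    unfolding mon_def by (intro prod.cong) (auto simp: unit_vec_def)
  then show ?thesis by simp
qed

lemma expectation_iid_sum: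
  assumes x: "\<And>l. 0 \<le> x l" "\<And>l. x l \<le> 1"
  shows "measure_pmf.expectation (iid_sum q m) (mon x) = measure_pmf.expectation q (mon x) ^ m"
proof (induction m)
  case (Suc m)
  have "measure_pmf.expectation (iid_sum q (Suc m)) (mon x) =
     measure_pmf.expectation q (\<lambda>a. measure_pmf.expectation (iid_sum q m) (\<lambda>y. mon x (\<lambda>l. a l + y l)))"
    by (simp add: expectation_bind_pmf mon_nonneg mon_le_1 x)
  also have "\<dots> = measure_pmf.expectation q (\<lambda>a. mon x a * measure_pmf.expectation (iid_sum q m) (mon x))"
    by (simp add: mon_add)
  finally show ?case by (simp add: Suc mult.commute)
qed simp

lemma set_pmf_gw_path: "zs \<in> set_pmf (gw_path p z0 n) \<Longrightarrow> length zs = Suc n"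
  by (induction n arbitrary: zs) auto

lemma last_nth: "length zs = Suc n \<Longrightarrow> last zs = zs ! n"
  by (metis diff_Suc_1 last_conv_nth list.size(3) nat.distinct(1))

lemma gw_step_zero: "gw_step p (\<lambda>_. 0) = return_pmf (\<lambda>_. 0)"
  by (simp add: gw_step_def Pi_pmf_return_pmf)

lemma gw_path_absorbing:
  "zs \<in> set_pmf (gw_path p z0 n) \<Longrightarrow> i < n \<Longrightarrow> zs ! i = (\<lambda>_. 0) \<Longrightarrow> zs ! Suc i = (\<lambda>_. 0)"
proof (induction n arbitrary: zs)
  case (Suc n)
  then obtain ys z where ys: "ys \<in> set_pmf (gw_path p z0 n)" "z \<in> set_pmf (gw_step p (last ys))" "zs = ys @ [z]"
    by auto
  have len: "length ys = Suc n" using set_pmf_gw_path ys by blast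
  show ?case
  proof (cases "i < n")
    case True
    then have "ys ! i = (\<lambda>_. 0)" using Suc.prems(3) len by (simp add: ys(3) nth_append)
    then have "ys ! Suc i = (\<lambda>_. 0)" using Suc.IH[OF ys(1) True] by simp
    then show ?thesis using True len by (simp add: ys(3) nth_append)
  next
    case False
    then have i: "i = n" using Suc.prems by simp
    then have "last ys = (\<lambda>_. 0)" using Suc.prems(3) len by (simp add: ys(3) nth_append last_nth)
    then have "z = (\<lambda>_. 0)" using ys(2) by (simp add: gw_step_zero)
    then show ?thesis using i len by (simp add: ys(3) nth_append)
  qed
qed simp

lemma gw_path_absorbing_le:
  assumes zs: "zs \<in> set_pmf (gw_path p z0 n)" and ij: "i \<le> j" "j \<le> n" and z: "zs ! i = (\<lambda>_. 0)"
  shows "zs ! j = (\<lambda>_. 0)"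
  using ij z
proof (induction j rule: dec_induct)
  case (step j)
  then show ?case using gw_path_absorbing[OF zs, of j] by simp
qed

section \<open>Transforms of Galton-Watson paths as iterates\<close>

context
  fixes C :: real and p :: "('d::finite) offspring"
  assumes C: "moment3_le C p"
begin

lemma expectation_gw_step:
  assumes x: "\<And>l. 0 \<le> x l" "\<And>l. x l \<le> 1"
  shows "measure_pmf.expectation (gw_step p z) (mon x) = mon (pgf p x) z"
proof -
  have "measure_pmf.expectation (gw_step p z) (mon x) =
     measure_pmf.expectation (Pi_pmf UNIV (\<lambda>_. 0) (\<lambda>k. iid_sum (p k) (z k))) (\<lambda>g. \<Prod>k\<in>UNIV. mon x (g k))"
    by (simp add: gw_step_def mon_sum)
  also have "\<dots> = (\<Prod>k\<in>UNIV. measure_pmf.expectation (iid_sum (p k) (z k)) (mon x))"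
    by (rule expectation_prod_Pi_pmf)
       (auto intro!: measure_pmf.integrable_const_bound[of _ 1] simp: mon_nonneg mon_le_1 x)
  also have "\<dots> = mon (pgf p x) z"
    by (simp add: expectation_iid_sum x mon_def[of "pgf p x"] pgf_mon)
  finally show ?thesis .
qed

context
  fixes s :: "'d \<Rightarrow> real"
  assumes s: "\<And>l. 0 \<le> s l" "\<And>l. s l \<le> 1"
begin

definition Gop where "Gop x = (\<lambda>l. s l * pgf p x l)"

lemma Gop_bounds:
  assumes "\<And>l. 0 \<le> x l" "\<And>l. x l \<le> 1"
  shows "0 \<le> Gop x l" "Gop x l \<le> 1"
  unfolding Gop_def using s assms pgf_nonneg[OF C, of x] pgf_le_1[OF C, of x]
  by (auto intro: mult_le_one)

text \<open>The last generation carries a free argument \<open>x\<close>: averaging over the final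
  step turns it into \<open>Gop x\<close>, so the induction runs backwards along the path.\<close>

lemma expectation_gw_path:
  assumes x: "\<And>l. 0 \<le> x l" "\<And>l. x l \<le> 1"
  shows "measure_pmf.expectation (gw_path p z0 n) (\<lambda>zs. (\<Prod>i<n. mon s (zs ! i)) * mon x (zs ! n))
    = mon ((Gop ^^ n) x) z0"
  using x
proof (induction n arbitrary: x)
  case (Suc n)
  let ?F = "\<lambda>zs. (\<Prod>i<Suc n. mon s (zs ! i)) * mon x (zs ! Suc n)"
  have F: "0 \<le> ?F zs" "?F zs \<le> 1" for zs
    using s Suc.prems by (auto intro!: mult_nonneg_nonneg prod_nonneg mult_le_one prod_le_1 simp: mon_nonneg mon_le_1)
  have "measure_pmf.expectation (gw_path p z0 (Suc n)) ?F =
     measure_pmf.expectation (gw_path p z0 n) (\<lambda>zs. measure_pmf.expectation (gw_step p (last zs)) (\<lambda>z. ?F (zs @ [z])))"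
    using F by (simp add: expectation_bind_pmf)
  also have "\<dots> = measure_pmf.expectation (gw_path p z0 n) (\<lambda>zs. (\<Prod>i<n. mon s (zs ! i)) * mon (Gop x) (zs ! n))"
  proof (rule integral_cong_AE)
    show "AE zs in measure_pmf (gw_path p z0 n).
        measure_pmf.expectation (gw_step p (last zs)) (\<lambda>z. ?F (zs @ [z])) =
        (\<Prod>i<n. mon s (zs ! i)) * mon (Gop x) (zs ! n)"
    proof (rule AE_pmfI)
      fix zs assume "zs \<in> set_pmf (gw_path p z0 n)"
      then have len: "length zs = Suc n" by (rule set_pmf_gw_path)
      have "?F (zs @ [z]) = (\<Prod>i<Suc n. mon s (zs ! i)) * mon x z" for z
      proof -
        have "(\<Prod>i<Suc n. mon s ((zs @ [z]) ! i)) = (\<Prod>i<Suc n. mon s (zs ! i))"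
          by (intro prod.cong) (auto simp: nth_append len)
        then show ?thesis using len by (simp add: nth_append)
      qed
      then have "measure_pmf.expectation (gw_step p (last zs)) (\<lambda>z. ?F (zs @ [z])) =
         (\<Prod>i<Suc n. mon s (zs ! i)) * mon (pgf p x) (zs ! n)"
        by (simp add: expectation_gw_step Suc.prems last_nth[OF len])
      then show "measure_pmf.expectation (gw_step p (last zs)) (\<lambda>z. ?F (zs @ [z])) =
         (\<Prod>i<n. mon s (zs ! i)) * mon (Gop x) (zs ! n)"
        by (simp add: Gop_def mon_mult)
    qed
  qed auto
  also have "\<dots> = mon ((Gop ^^ n) (Gop x)) z0"
    by (rule Suc.IH) (use Gop_bounds Suc.prems in auto)
  finally show ?case by (simp add: funpow_swap1)
qed simp

lemma Gop_funpow_zero: "(Gop ^^ n) (\<lambda>_. 0) = hseq p s n"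
  by (induction n) (auto simp: Gop_def)

text \<open>At x = 0 the last monomial is the indicator of extinction, and on that event the omitted
  weight of generation n equals 1.\<close>

lemma expectation_gw_path_extinct:
  "measure_pmf.expectation (gw_path p (unit_vec j) n)
     (\<lambda>zs. (\<Prod>i<n. mon s (zs ! i)) * (if zs ! n = (\<lambda>_. 0) then 1 else 0)) = hseq p s n j"
  using expectation_gw_path[of "\<lambda>_. 0" "unit_vec j" n] by (simp add: mon_0 Gop_funpow_zero)

text \<open>Extinction exactly at n + 1 is extinction by n + 1 minus extinction by n; empty
  generations have weight 1, so both terms are transforms already computed.\<close>

lemma expectation_ext_at:
  "measure_pmf.expectation (gw_path p (unit_vec j) (Suc n))
     (\<lambda>zs. (\<Prod>i\<le>Suc n. mon s (zs ! i)) * indicator (ext_at (Suc n)) zs) = hseq p s (Suc n) j - hseq p s n j"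
proof -
  let ?M = "gw_path p (unit_vec j) (Suc n)"
  let ?F = "\<lambda>m zs. (\<Prod>i<m. mon s (zs ! i)) * (if zs ! m = (\<lambda>_. 0) then 1 else 0)"
  have F: "0 \<le> ?F m zs" "?F m zs \<le> 1" for m zs
    using s by (auto intro!: prod_nonneg prod_le_1 simp: mon_nonneg mon_le_1)
  have int: "integrable (measure_pmf ?M) (?F m)" for m
    by (rule measure_pmf.integrable_const_bound[of _ 1]) (use F[where m = m] in \<open>auto simp del: mult_eq_0_iff\<close>)
  \<comment> \<open>A functional of the generations up to n keeps its mean when the path gets one
    more generation.\<close>
  have "measure_pmf.expectation ?M (?F n) =
     measure_pmf.expectation (gw_path p (unit_vec j) n) (\<lambda>zs. measure_pmf.expectation (gw_step p (last zs)) (\<lambda>z. ?F n (zs @ [z])))"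
    using F[where m = n] by (simp add: expectation_bind_pmf)
  also have "\<dots> = measure_pmf.expectation (gw_path p (unit_vec j) n) (?F n)"
  proof (rule integral_cong_AE)
    show "AE zs in measure_pmf (gw_path p (unit_vec j) n).
        measure_pmf.expectation (gw_step p (last zs)) (\<lambda>z. ?F n (zs @ [z])) = ?F n zs"
    proof (rule AE_pmfI)
      fix zs assume "zs \<in> set_pmf (gw_path p (unit_vec j) n)"
      then have len: "length zs = Suc n" by (rule set_pmf_gw_path)
      have "(\<Prod>i<n. mon s ((zs @ [z]) ! i)) = (\<Prod>i<n. mon s (zs ! i))" for z
        by (intro prod.cong) (auto simp: nth_append len)
      then show "measure_pmf.expectation (gw_step p (last zs)) (\<lambda>z. ?F n (zs @ [z])) = ?F n zs"
        using len by (simp add: nth_append)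
    qed
  qed auto
  also have "\<dots> = hseq p s n j" by (rule expectation_gw_path_extinct)
  finally have n: "measure_pmf.expectation ?M (?F n) = hseq p s n j" .
  have "measure_pmf.expectation ?M (\<lambda>zs. (\<Prod>i\<le>Suc n. mon s (zs ! i)) * indicator (ext_at (Suc n)) zs)
     = measure_pmf.expectation ?M (\<lambda>zs. ?F (Suc n) zs - ?F n zs)"
  proof (rule integral_cong_AE)
    show "AE zs in measure_pmf ?M. (\<Prod>i\<le>Suc n. mon s (zs ! i)) * indicator (ext_at (Suc n)) zs = ?F (Suc n) zs - ?F n zs"
    proof (rule AE_pmfI)
      fix zs assume zs: "zs \<in> set_pmf ?M"
      note abs = gw_path_absorbing_le[OF zs]
      show "(\<Prod>i\<le>Suc n. mon s (zs ! i)) * indicator (ext_at (Suc n)) zs = ?F (Suc n) zs - ?F n zs"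
      proof (cases "zs ! n = (\<lambda>_. 0)")
        case True
        then have "zs ! Suc n = (\<lambda>_. 0)" using abs[of n "Suc n"] by simp
        moreover have "zs \<notin> ext_at (Suc n)" using True by (auto simp: ext_at_def)
        ultimately show ?thesis using True by simp
      next
        case False
        then have "zs ! l \<noteq> (\<lambda>_. 0)" if "l < Suc n" for l
          using abs[of l n] that by auto
        then have "zs \<in> ext_at (Suc n) \<longleftrightarrow> zs ! Suc n = (\<lambda>_. 0)" by (auto simp: ext_at_def)
        moreover have "(\<Prod>i\<le>Suc n. mon s (zs ! i)) = (\<Prod>i<Suc n. mon s (zs ! i)) * mon s (zs ! Suc n)"
          by (simp only: prod.atMost_Suc lessThan_Suc_atMost)
        ultimately show ?thesis using False by (simp del: prod.lessThan_Suc prod.atMost_Suc)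
      qed
    qed
  qed auto
  also have "\<dots> = measure_pmf.expectation ?M (?F (Suc n)) - measure_pmf.expectation ?M (?F n)"
    by (rule Bochner_Integration.integral_diff[OF int int])
  also have "\<dots> = hseq p s (Suc n) j - hseq p s n j"
    by (simp only: n expectation_gw_path_extinct)
  finally show ?thesis .
qed

end

lemma ext_prob_hstar: "ext_prob p = hstar p (\<lambda>_. 1)"
proof
  fix k
  have "measure_pmf.prob (gw_path p (unit_vec k) n) {zs. zs ! n = (\<lambda>_. 0)} = hseq p (\<lambda>_. 1) n k" for n
  proof -
    have "measure_pmf.prob (gw_path p (unit_vec k) n) {zs. zs ! n = (\<lambda>_. 0)} =
      measure_pmf.expectation (gw_path p (unit_vec k) n) (indicator {zs. zs ! n = (\<lambda>_. 0)})" by simp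
    also have "\<dots> = measure_pmf.expectation (gw_path p (unit_vec k) n)
       (\<lambda>zs. (\<Prod>i<n. mon (\<lambda>_. 1) (zs ! i)) * (if zs ! n = (\<lambda>_. 0) then 1 else 0))"
      by (intro Bochner_Integration.integral_cong) (auto simp: indicator_def)
    also have "\<dots> = hseq p (\<lambda>_. 1) n k" by (rule expectation_gw_path_extinct) auto
    finally show ?thesis .
  qed
  then show "ext_prob p k = hstar p (\<lambda>_. 1) k"
    by (simp add: ext_prob_def hstar_def)
qed

text \<open>Positivity of the denominator also guarantees that the conditioning event is not null,
  without which \<open>cond_pmf\<close> is unspecified.\<close>

lemma Phi_hseq:
  assumes nonneg: "\<And>l. 0 \<le> t l / m l"
    and pos: "0 < hseq p (\<lambda>_. 1) (Suc n) j - hseq p (\<lambda>_. 1) n j"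
  defines "s \<equiv> \<lambda>l. exp (- (t l / m l))"
  shows "Phi p t m (Suc n) j =
    (hseq p s (Suc n) j - hseq p s n j) / (hseq p (\<lambda>_. 1) (Suc n) j - hseq p (\<lambda>_. 1) n j)"
proof -
  let ?M = "gw_path p (unit_vec j) (Suc n)"
  let ?f = "\<lambda>zs. exp (- (\<Sum>l\<in>UNIV. t l * real (\<Sum>i\<le>Suc n. (zs ! i) l) / m l))"
  have s: "0 \<le> s l" "s l \<le> 1" for l using nonneg[of l] by (auto simp: s_def)
  have f_mon: "?f zs = (\<Prod>i\<le>Suc n. mon s (zs ! i))" for zs :: "('d \<Rightarrow> nat) list"
  proof -
    have "?f zs = (\<Prod>l\<in>UNIV. exp (- (t l / m l)) ^ (\<Sum>i\<le>Suc n. (zs ! i) l))"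
      by (simp only: exp_of_nat_mult[symmetric] exp_sum[OF finite, symmetric] sum_negf[symmetric])
         (simp add: mult_ac)
    also have "\<dots> = mon s (\<lambda>l. \<Sum>i\<le>Suc n. (zs ! i) l)" by (simp only: mon_def s_def)
    also have "\<dots> = (\<Prod>i\<le>Suc n. mon s (zs ! i))" by (rule mon_sum)
    finally show ?thesis .
  qed
  have f01: "0 \<le> ?f zs" "?f zs \<le> 1" for zs :: "('d \<Rightarrow> nat) list"
    unfolding f_mon using s by (auto intro!: prod_nonneg prod_le_1 simp: mon_nonneg mon_le_1 simp del: prod.atMost_Suc)
  have prob: "measure_pmf.prob ?M (ext_at (Suc n)) = hseq p (\<lambda>_. 1) (Suc n) j - hseq p (\<lambda>_. 1) n j"
    using expectation_ext_at[of "\<lambda>_. 1" j n] by simp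
  have "set_pmf ?M \<inter> ext_at (Suc n) \<noteq> {}"
    using pos prob measure_pmf_zero_iff[of ?M "ext_at (Suc n)"] by auto
  then have "Phi p t m (Suc n) j = measure_pmf.expectation ?M (\<lambda>zs. ?f zs * indicator (ext_at (Suc n)) zs) /
       measure_pmf.prob ?M (ext_at (Suc n))"
    unfolding Phi_def by (intro expectation_cond_pmf f01)
  also have "measure_pmf.expectation ?M (\<lambda>zs. ?f zs * indicator (ext_at (Suc n)) zs) = hseq p s (Suc n) j - hseq p s n j"
    unfolding f_mon by (rule expectation_ext_at[OF s])
  finally show ?thesis by (simp only: prob)
qed

end

section \<open>Limits of the conditioned transform\<close>

text \<open>The bounds 1 - 1/x \<le> ln x \<le> x - 1 squeeze \<open>i * ln x\<close>; the two outer
  bounds differ by a factor x, which tends to 1.\<close>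

lemma
  fixes x :: "nat \<Rightarrow> real" and i :: "nat \<Rightarrow> nat"
  assumes x: "x \<longlonglongrightarrow> 1" "\<forall>\<^sub>F k in sequentially. 0 < x k"
    and c: "(\<lambda>k. real (i k) * (1 - x k)) \<longlonglongrightarrow> c"
  shows tendsto_mult_ln: "(\<lambda>k. real (i k) * ln (x k)) \<longlonglongrightarrow> - c"
    and tendsto_exponential_power: "(\<lambda>k. x k ^ i k) \<longlonglongrightarrow> exp (- c)"
proof -
  have up: "(\<lambda>k. - (real (i k) * (1 - x k))) \<longlonglongrightarrow> - c" by (intro tendsto_intros c)
  have "(\<lambda>k. - (real (i k) * (1 - x k) / x k)) \<longlonglongrightarrow> - (c / 1)" by (intro tendsto_intros c x) auto
  then have lo: "(\<lambda>k. - (real (i k) * (1 - x k) / x k)) \<longlonglongrightarrow> - c" by simp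
  show ln: "(\<lambda>k. real (i k) * ln (x k)) \<longlonglongrightarrow> - c"
  proof (rule tendsto_sandwich[OF _ _ lo up])
    show "\<forall>\<^sub>F k in sequentially. real (i k) * ln (x k) \<le> - (real (i k) * (1 - x k))"
      using x(2)
    proof eventually_elim
      case (elim k)
      have "real (i k) * ln (x k) \<le> real (i k) * (x k - 1)"
        by (intro mult_left_mono ln_le_minus_one elim) auto
      then show ?case by (simp add: algebra_simps)
    qed
    show "\<forall>\<^sub>F k in sequentially. - (real (i k) * (1 - x k) / x k) \<le> real (i k) * ln (x k)"
      using x(2)
    proof eventually_elim
      case (elim k)
      have "- ln (x k) \<le> 1 / x k - 1"
        using ln_le_minus_one[of "1 / x k"] elim by (simp add: ln_div)
      then have "real (i k) * (- ln (x k)) \<le> real (i k) * (1 / x k - 1)"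
        by (intro mult_left_mono) auto
      moreover have "1 / x k - 1 = (1 - x k) / x k" using elim by (simp add: field_simps)
      ultimately show ?case by simp
    qed
  qed
  have 1: "(\<lambda>k. exp (real (i k) * ln (x k))) \<longlonglongrightarrow> exp (- c)" by (intro tendsto_intros ln)
  have 2: "\<forall>\<^sub>F k in sequentially. exp (real (i k) * ln (x k)) = x k ^ i k"
    using x(2) by eventually_elim (simp add: exp_of_nat_mult)
  show "(\<lambda>k. x k ^ i k) \<longlonglongrightarrow> exp (- c)" by (rule Lim_transform_eventually[OF 1 2])
qed

text \<open>The step into generation n is the increment with index n - 1, so asymptotics evaluated
  there have to be compared with n.\<close>

lemma tendsto_pred_ratio:
  assumes n: "filterlim n at_top sequentially"
  shows "(\<lambda>k. real (n k - 1) / real (n k)) \<longlonglongrightarrow> 1"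
proof -
  have 1: "(\<lambda>k. 1 - 1 / real (n k)) \<longlonglongrightarrow> 1 - 0"
    by (intro tendsto_intros tendsto_divide_0[OF tendsto_const] filterlim_at_top_imp_at_infinity
        filterlim_compose[OF filterlim_real_sequentially n])
  have "\<forall>\<^sub>F k in sequentially. 1 \<le> n k"
    using n unfolding filterlim_at_top by blast
  then have 2: "\<forall>\<^sub>F k in sequentially. 1 - 1 / real (n k) = real (n k - 1) / real (n k)"
    by eventually_elim (simp add: field_simps of_nat_diff)
  show ?thesis using Lim_transform_eventually[OF 1 2] by simp
qed

section \<open>Powers and geometric sums when n (1 - x) converges\<close>

context
  fixes n :: "nat \<Rightarrow> nat" and x :: "nat \<Rightarrow> real" and c :: real
  assumes n: "filterlim n at_top sequentially"
    and x: "x \<longlonglongrightarrow> 1" "\<forall>\<^sub>F k in sequentially. 0 < x k" "\<forall>\<^sub>F k in sequentially. x k \<le> 1"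
    and c: "(\<lambda>k. real (n k) * (1 - x k)) \<longlonglongrightarrow> c"
begin

lemma eventually_n_pos: "\<forall>\<^sub>F k in sequentially. 1 \<le> n k"
  using n unfolding filterlim_at_top by blast

lemma tendsto_pred: "(\<lambda>k. real (n k - 1) * (1 - x k)) \<longlonglongrightarrow> c"
proof -
  have 1: "(\<lambda>k. real (n k) * (1 - x k) - (1 - x k)) \<longlonglongrightarrow> c - (1 - 1)" by (intro tendsto_intros c x)
  have 2: "\<forall>\<^sub>F k in sequentially. real (n k) * (1 - x k) - (1 - x k) = real (n k - 1) * (1 - x k)"
    using eventually_n_pos by eventually_elim (simp add: of_nat_diff algebra_simps)
  show ?thesis using Lim_transform_eventually[OF 1 2] by simp
qed

lemma tendsto_power_pred: "(\<lambda>k. x k ^ (n k - 1)) \<longlonglongrightarrow> exp (- c)"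
  by (rule tendsto_exponential_power[OF x(1,2) tendsto_pred])

lemma tendsto_geo_pos:
  assumes "0 < c"
  shows "(\<lambda>k. geo (n k - 1) (x k) / real (n k)) \<longlonglongrightarrow> (1 - exp (- c)) / c"
proof -
  have 1: "(\<lambda>k. (1 - x k ^ (n k - 1)) / (real (n k) * (1 - x k))) \<longlonglongrightarrow> (1 - exp (- c)) / c"
    by (intro tendsto_intros tendsto_power_pred c) (use assms in auto)
  have 2: "\<forall>\<^sub>F k in sequentially. (1 - x k ^ (n k - 1)) / (real (n k) * (1 - x k)) = geo (n k - 1) (x k) / real (n k)"
    using order_tendstoD(1)[OF c assms]
  proof eventually_elim
    case (elim k)
    then have "1 - x k \<noteq> 0" by auto
    then show ?case unfolding geo_telescope[symmetric] by simp
  qed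
  show ?thesis by (rule Lim_transform_eventually[OF 1 2])
qed

text \<open>Since 1 - x may vanish, the quotient formula is replaced by bounding each summand
  between the smallest power and 1.\<close>

lemma tendsto_geo_zero:
  assumes "c = 0"
  shows "(\<lambda>k. geo (n k - 1) (x k) / real (n k)) \<longlonglongrightarrow> 1"
proof -
  have lo: "(\<lambda>k. x k ^ (n k - 1) * (real (n k - 1) / real (n k))) \<longlonglongrightarrow> 1"
    using tendsto_mult[OF tendsto_power_pred tendsto_pred_ratio[OF n]] assms by simp
  show ?thesis
  proof (rule tendsto_sandwich[OF _ _ lo tendsto_pred_ratio[OF n]])
    show "\<forall>\<^sub>F k in sequentially. geo (n k - 1) (x k) / real (n k) \<le> real (n k - 1) / real (n k)"
      using x(2,3) by eventually_elim (auto intro!: divide_right_mono geo_le)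
    show "\<forall>\<^sub>F k in sequentially. x k ^ (n k - 1) * (real (n k - 1) / real (n k)) \<le> geo (n k - 1) (x k) / real (n k)"
      using x(2,3)
    proof eventually_elim
      case (elim k)
      have "(\<Sum>i<n k - 1. x k ^ (n k - 1)) \<le> geo (n k - 1) (x k)"
        unfolding geo_def using elim by (intro sum_mono power_decreasing) auto
      then have "x k ^ (n k - 1) * real (n k - 1) / real (n k) \<le> geo (n k - 1) (x k) / real (n k)"
        by (intro divide_right_mono) (auto simp: mult.commute)
      then show ?case by simp
    qed
  qed
qed

end

lemma exp_neg_bounds:
  fixes y :: real
  assumes "0 \<le> y"
  shows "y - y\<^sup>2 \<le> 1 - exp (- y)" "1 - exp (- y) \<le> y"
proof -
  show "1 - exp (- y) \<le> y" using exp_ge_add_one_self[of "- y"] by simp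
  \<comment> \<open>The product equals 1 + y^3.\<close>
  have "1 \<le> (1 + y) * (1 - y + y\<^sup>2)"
    using assms by (simp add: power2_eq_square algebra_simps)
  then have "1 / (1 + y) \<le> 1 - y + y\<^sup>2"
    using assms by (simp add: pos_divide_le_eq mult.commute)
  moreover have "exp (- y) \<le> 1 / (1 + y)"
    using exp_ge_add_one_self[of y] assms by (simp add: exp_minus inverse_eq_divide frac_le)
  ultimately show "y - y\<^sup>2 \<le> 1 - exp (- y)" by simp
qed

context near_critical
begin

interpretation one: near_critical_s p C A B "\<lambda>k l. 1"
  by unfold_locales auto

lemma rho_mu_eq: "rho_mu (p k) = one.L k"
  by (simp add: rho_mu_def one.L_def one.As_def[abs_def] one.hs_def ext_prob_hstar[OF moment])

lemma rho_mu_lim: "(\<lambda>k. rho_mu (p k)) \<longlonglongrightarrow> 1"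
  and rho_mu_pos: "\<forall>\<^sub>F k in sequentially. 0 < rho_mu (p k)"
  and rho_mu_le_1: "\<forall>\<^sub>F k in sequentially. rho_mu (p k) \<le> 1"
  unfolding rho_mu_eq by (rule one.L_lim one.L_pos one.L_le_1)+

lemma rho_mu_scale:
  assumes alt: "(\<forall>k. hstar (p k) (\<lambda>_. 1) = (\<lambda>_. 1)) \<or> (\<forall>k. hstar (p k) (\<lambda>_. 1) \<noteq> (\<lambda>_. 1))"
  shows "(\<lambda>k. y k * \<bar>1 - rho (p k)\<bar>) \<longlonglongrightarrow> c \<Longrightarrow> (\<lambda>k. y k * (1 - rho_mu (p k))) \<longlonglongrightarrow> c"
    and "filterlim (\<lambda>k. y k * \<bar>1 - rho (p k)\<bar>) at_top sequentially \<Longrightarrow>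
      filterlim (\<lambda>k. y k * (1 - rho_mu (p k))) at_top sequentially"
proof -
  obtain r where r: "r \<longlonglongrightarrow> 1" and eq: "\<forall>\<^sub>F k in sequentially. 1 - rho_mu (p k) = r k * \<bar>1 - rho (p k)\<bar>"
    using extinction_root alt unfolding one.hs_def rho_mu_eq[symmetric] by blast
  have eq': "\<forall>\<^sub>F k in sequentially. r k * (y k * \<bar>1 - rho (p k)\<bar>) = y k * (1 - rho_mu (p k))"
    using eq by eventually_elim simp
  show "(\<lambda>k. y k * (1 - rho_mu (p k))) \<longlonglongrightarrow> c" if "(\<lambda>k. y k * \<bar>1 - rho (p k)\<bar>) \<longlonglongrightarrow> c"
    using Lim_transform_eventually[OF tendsto_mult[OF r that] eq'] by simp
  show "filterlim (\<lambda>k. y k * (1 - rho_mu (p k))) at_top sequentially"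
    if "filterlim (\<lambda>k. y k * \<bar>1 - rho (p k)\<bar>) at_top sequentially"
    by (rule filterlim_mono_eventually[OF filterlim_tendsto_pos_mult_at_top[OF r zero_less_one that] order_refl order_refl eq'])
qed

section \<open>The conditioned transform at a given scale\<close>

context
  fixes n :: "nat \<Rightarrow> nat" and t :: "'d \<Rightarrow> real" and T :: real
  assumes n: "filterlim n at_top sequentially"
    and t: "\<And>l. 0 \<le> t l" and T: "0 < (\<Sum>l\<in>UNIV. t l)"
  defines "T \<equiv> \<Sum>l\<in>UNIV. t l"
begin

lemma T_pos: "0 < T" using T by (simp add: T_def)

text \<open>Numerator and denominator are increments of the weighted and of the unweighted
  iteration. Their common factor, the entry of u at \<open>j\<close> over \<open>Q\<close>, cancels,
  so the type drops out and only two Perron roots remain to be compared.\<close>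

lemma Phi_ratio:
  assumes kap: "filterlim \<kappa> at_top sequentially"
  obtains l where "l \<longlonglongrightarrow> 1" "\<forall>\<^sub>F k in sequentially. 0 < l k" "\<forall>\<^sub>F k in sequentially. l k \<le> (1::real)"
    "(\<lambda>k. \<kappa> k * ((1 - l k)\<^sup>2 - (1 - rho_mu (p k))\<^sup>2)) \<longlonglongrightarrow> 4 * Q * T"
    "(\<lambda>k. Phi (p k) t (\<lambda>i. \<kappa> k * left_pvec (mean_mat (p k)) i) (n k) j *
        (geo (n k - 1) (l k) / geo (n k - 1) (rho_mu (p k)))\<^sup>2 / (l k / rho_mu (p k)) ^ (n k - 1)) \<longlonglongrightarrow> 1"
proof -
  define m where "m k i = \<kappa> k * left_pvec (mean_mat (p k)) i" for k i
  \<comment> \<open>Truncation by \<open>max 0\<close> keeps s in (0, 1] for every k, as the locale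
    demands; the scale m is known to be positive only eventually.\<close>
  define s where "s k i = exp (- max 0 (t i / m k i))" for k i
  have kpos: "\<forall>\<^sub>F k in sequentially. 0 < \<kappa> k"
    using kap by (simp add: filterlim_at_top_dense)
  have kinv: "(\<lambda>k. 1 / \<kappa> k) \<longlonglongrightarrow> 0"
    by (intro tendsto_divide_0[OF tendsto_const] filterlim_at_top_imp_at_infinity kap)
  have vpos: "\<forall>\<^sub>F k in sequentially. \<forall>i. 0 < left_pvec (mean_mat (p k)) i"
    by (intro eventually_all_finite order_tendstoD(1)[OF left_pvec_mean_lim] v_pos)
  have tm: "\<forall>\<^sub>F k in sequentially. \<forall>i. 0 \<le> t i / m k i"
    using kpos vpos by eventually_elim (auto simp: m_def intro!: divide_nonneg_nonneg mult_nonneg_nonneg t intro: less_imp_le)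
  have vne: "v i \<noteq> 0" for i using v_pos[of i] by simp
  have tv: "(\<lambda>k. t i / left_pvec (mean_mat (p k)) i) \<longlonglongrightarrow> t i / v i" for i
    by (intro tendsto_intros left_pvec_mean_lim vne)
  have ktm: "(\<lambda>k. \<kappa> k * (t i / m k i)) \<longlonglongrightarrow> t i / v i" for i
  proof (rule Lim_transform_eventually[OF tv])
    show "\<forall>\<^sub>F k in sequentially. t i / left_pvec (mean_mat (p k)) i = \<kappa> k * (t i / m k i)"
      using kpos by eventually_elim (simp add: m_def)
  qed
  have tm0: "(\<lambda>k. t i / m k i) \<longlonglongrightarrow> 0" for i
    using tendsto_mult[OF tv[of i] kinv] by (simp add: m_def mult.commute)
  have s_eq: "\<forall>\<^sub>F k in sequentially. \<forall>i. s k i = exp (- (t i / m k i))"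
    using tm by eventually_elim (simp add: s_def)
  have s1: "(\<lambda>k. s k i) \<longlonglongrightarrow> 1" for i
  proof -
    have "(\<lambda>k. s k i) \<longlonglongrightarrow> exp (- max 0 0)"
      unfolding s_def by (intro tendsto_exp tendsto_minus tendsto_max tendsto_const tm0)
    then show ?thesis by simp
  qed
  interpret S: near_critical_s p C A B s
    by unfold_locales (auto simp: s_def intro: s1[unfolded s_def])
  have ks: "(\<lambda>k. \<kappa> k * (1 - s k i)) \<longlonglongrightarrow> t i / v i" for i
  proof (rule tendsto_sandwich[OF _ _ _ ktm[of i]])
    have "(\<lambda>k. \<kappa> k * (t i / m k i) - \<kappa> k * (t i / m k i) * (t i / m k i)) \<longlonglongrightarrow> t i / v i - t i / v i * 0"
      by (intro tendsto_diff tendsto_mult[OF ktm tm0] ktm)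
    then show "(\<lambda>k. \<kappa> k * (t i / m k i - (t i / m k i)\<^sup>2)) \<longlonglongrightarrow> t i / v i"
      by (simp add: power2_eq_square algebra_simps)
    show "\<forall>\<^sub>F k in sequentially. \<kappa> k * (t i / m k i - (t i / m k i)\<^sup>2) \<le> \<kappa> k * (1 - s k i)"
      using s_eq tm kpos by eventually_elim (auto intro!: mult_left_mono exp_neg_bounds)
    show "\<forall>\<^sub>F k in sequentially. \<kappa> k * (1 - s k i) \<le> \<kappa> k * (t i / m k i)"
      using s_eq tm kpos by eventually_elim (auto intro!: mult_left_mono exp_neg_bounds simp del: times_divide_eq_right)
  qed
  \<comment> \<open>A scale proportional to the left eigenvector makes the component of 1 - s along
    v depend on t only through the sum \<open>T\<close>.\<close>
  have vT: "dot v (\<lambda>i. t i / v i) = T"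
    unfolding dot_def T_def by (intro sum.cong) (auto simp: vne)
  have root: "(\<lambda>k. \<kappa> k * ((1 - S.L k)\<^sup>2 - (1 - rho_mu (p k))\<^sup>2)) \<longlonglongrightarrow> 4 * Q * T"
    using S.perturbed_root[OF kap ks] T_pos by (simp add: vT rho_mu_eq)
  have n1: "filterlim (\<lambda>k. n k - 1) at_top sequentially"
    by (rule filterlim_compose[OF filterlim_minus_const_nat_at_top n])
  let ?i = "\<lambda>k. n k - 1"
  have incS: "(\<lambda>k. S.d k (?i k) j * (geo (?i k) (S.L k))\<^sup>2 / S.L k ^ ?i k) \<longlonglongrightarrow> u j / Q"
    using filterlim_compose[OF S.increment_asymptotics filterlim_seq2_graph[OF n1], of j] by simp
  have inc1: "(\<lambda>k. one.d k (?i k) j * (geo (?i k) (one.L k))\<^sup>2 / one.L k ^ ?i k) \<longlonglongrightarrow> u j / Q"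
    using filterlim_compose[OF one.increment_asymptotics filterlim_seq2_graph[OF n1], of j] by simp
  have uQ: "0 < u j / Q" using u_pos Q_pos by simp
  have 1: "(\<lambda>k. (S.d k (?i k) j * (geo (?i k) (S.L k))\<^sup>2 / S.L k ^ ?i k) /
      (one.d k (?i k) j * (geo (?i k) (one.L k))\<^sup>2 / one.L k ^ ?i k)) \<longlonglongrightarrow> (u j / Q) / (u j / Q)"
    by (rule tendsto_divide[OF incS inc1]) (use uQ in auto)
  have n_pos: "\<forall>\<^sub>F k in sequentially. 1 \<le> n k" using n unfolding filterlim_at_top by blast
  have 2: "\<forall>\<^sub>F k in sequentially. (S.d k (?i k) j * (geo (?i k) (S.L k))\<^sup>2 / S.L k ^ ?i k) /
      (one.d k (?i k) j * (geo (?i k) (one.L k))\<^sup>2 / one.L k ^ ?i k) =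
      Phi (p k) t (\<lambda>i. \<kappa> k * left_pvec (mean_mat (p k)) i) (n k) j *
        (geo (?i k) (S.L k) / geo (?i k) (rho_mu (p k)))\<^sup>2 / (S.L k / rho_mu (p k)) ^ ?i k"
    using order_tendstoD(1)[OF inc1 uQ] tm s_eq n_pos S.L_pos one.L_pos
  proof eventually_elim
    case (elim k)
    have d1: "0 < one.d k (?i k) j"
    proof -
      have "one.d k (?i k) j \<noteq> 0" using elim(1) by auto
      then show ?thesis using one.d_nonneg[of k "?i k" j] by simp
    qed
    have sk: "s k = (\<lambda>i. exp (- (t i / m k i)))" using elim(3) by auto
    have "Phi (p k) t (m k) (Suc (?i k)) j =
      (hseq (p k) (s k) (Suc (?i k)) j - hseq (p k) (s k) (?i k) j) /
      (hseq (p k) (\<lambda>_. 1) (Suc (?i k)) j - hseq (p k) (\<lambda>_. 1) (?i k) j)"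
      unfolding sk by (rule Phi_hseq[OF moment]) (use elim(2) d1 in \<open>auto simp: one.d_def one.h_def\<close>)
    then have "Phi (p k) t (m k) (n k) j = S.d k (?i k) j / one.d k (?i k) j"
      using elim(4) by (simp add: S.d_def one.d_def S.h_def one.h_def del: hseq.simps)
    then have Phi: "Phi (p k) t (\<lambda>i. \<kappa> k * left_pvec (mean_mat (p k)) i) (n k) j = S.d k (?i k) j / one.d k (?i k) j"
      by (simp add: m_def[abs_def])
    show ?case
      unfolding Phi rho_mu_eq using elim(5,6) d1
      by (simp add: power_divide field_simps)
  qed
  have "(u j / Q) / (u j / Q) = 1" using uQ by auto
  then have "(\<lambda>k. Phi (p k) t (\<lambda>i. \<kappa> k * left_pvec (mean_mat (p k)) i) (n k) j *
        (geo (?i k) (S.L k) / geo (?i k) (rho_mu (p k)))\<^sup>2 / (S.L k / rho_mu (p k)) ^ ?i k) \<longlonglongrightarrow> 1"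
    using Lim_transform_eventually[OF 1 2] by simp
  then show ?thesis
    using that[of S.L] S.L_lim S.L_pos S.L_le_1 root by blast
qed

text \<open>The two regimes with \<open>m\<^sub>n\<close> of order \<open>n\<^sup>2\<close> differ only in the constants.\<close>

lemma Phi_limit_quadratic_scale:
  assumes c: "(\<lambda>k. real (n k) * (1 - rho_mu (p k))) \<longlonglongrightarrow> c"
    and kap: "(\<lambda>k. \<kappa> k / (real (n k))\<^sup>2) \<longlonglongrightarrow> K" "0 < K"
    and G: "(\<lambda>k. geo (n k - 1) (rho_mu (p k)) / real (n k)) \<longlonglongrightarrow> G"
  defines "b \<equiv> sqrt (c\<^sup>2 + 4 * Q * T / K)"
  shows "(\<lambda>k. Phi (p k) t (\<lambda>i. \<kappa> k * left_pvec (mean_mat (p k)) i) (n k) j)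
    \<longlonglongrightarrow> exp (- b) / exp (- c) * (G / ((1 - exp (- b)) / b))\<^sup>2"
proof -
  have rn: "filterlim (\<lambda>k. real (n k)) at_top sequentially"
    by (rule filterlim_compose[OF filterlim_real_sequentially n])
  have n_pos: "\<forall>\<^sub>F k in sequentially. 1 \<le> n k" using n unfolding filterlim_at_top by blast
  have kap_top: "filterlim \<kappa> at_top sequentially"
  proof -
    have "filterlim (\<lambda>k. \<kappa> k / (real (n k))\<^sup>2 * (real (n k))\<^sup>2) at_top sequentially"
      by (rule filterlim_tendsto_pos_mult_at_top[OF kap filterlim_pow_at_top[OF _ rn]]) simp
    moreover have "\<forall>\<^sub>F k in sequentially. \<kappa> k / (real (n k))\<^sup>2 * (real (n k))\<^sup>2 = \<kappa> k"
      using n_pos by eventually_elim simp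
    ultimately show ?thesis by (rule filterlim_mono_eventually[OF _ order_refl order_refl])
  qed
  obtain l where l: "l \<longlonglongrightarrow> 1" "\<forall>\<^sub>F k in sequentially. 0 < l k" "\<forall>\<^sub>F k in sequentially. l k \<le> 1"
    and root: "(\<lambda>k. \<kappa> k * ((1 - l k)\<^sup>2 - (1 - rho_mu (p k))\<^sup>2)) \<longlonglongrightarrow> 4 * Q * T"
    and Phi: "(\<lambda>k. Phi (p k) t (\<lambda>i. \<kappa> k * left_pvec (mean_mat (p k)) i) (n k) j *
        (geo (n k - 1) (l k) / geo (n k - 1) (rho_mu (p k)))\<^sup>2 / (l k / rho_mu (p k)) ^ (n k - 1)) \<longlonglongrightarrow> 1"
    using Phi_ratio[OF kap_top] by blast
  have bpos: "0 < b"
    unfolding b_def using Q_pos T_pos kap(2) by (intro real_sqrt_gt_zero add_nonneg_pos) auto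
  \<comment> \<open>This is the square of n (1 - l), arranged so that the known limits apply
    termwise.\<close>
  have "(\<lambda>k. (real (n k) * (1 - rho_mu (p k)))\<^sup>2 +
      \<kappa> k * ((1 - l k)\<^sup>2 - (1 - rho_mu (p k))\<^sup>2) / (\<kappa> k / (real (n k))\<^sup>2)) \<longlonglongrightarrow> c\<^sup>2 + 4 * Q * T / K"
    by (intro tendsto_intros c root kap) (use kap in simp)
  then have 1: "(\<lambda>k. sqrt ((real (n k) * (1 - rho_mu (p k)))\<^sup>2 +
      \<kappa> k * ((1 - l k)\<^sup>2 - (1 - rho_mu (p k))\<^sup>2) / (\<kappa> k / (real (n k))\<^sup>2))) \<longlonglongrightarrow> b"
    unfolding b_def by (intro tendsto_real_sqrt)
  have 2: "\<forall>\<^sub>F k in sequentially. sqrt ((real (n k) * (1 - rho_mu (p k)))\<^sup>2 +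
      \<kappa> k * ((1 - l k)\<^sup>2 - (1 - rho_mu (p k))\<^sup>2) / (\<kappa> k / (real (n k))\<^sup>2)) = real (n k) * (1 - l k)"
    using l(3) order_tendstoD(1)[OF kap] n_pos
  proof eventually_elim
    case (elim k)
    then have "\<kappa> k \<noteq> 0" by auto
    then have "(real (n k) * (1 - rho_mu (p k)))\<^sup>2 +
      \<kappa> k * ((1 - l k)\<^sup>2 - (1 - rho_mu (p k))\<^sup>2) / (\<kappa> k / (real (n k))\<^sup>2) = (real (n k) * (1 - l k))\<^sup>2"
    proof -
      have eq: "\<kappa> k * E / (\<kappa> k / (real (n k))\<^sup>2) = (real (n k))\<^sup>2 * E" for E
        using elim(3) \<open>\<kappa> k \<noteq> 0\<close> by simp
      show ?thesis unfolding eq by algebra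
    qed
    then show ?case using elim(1) by simp
  qed
  have lb: "(\<lambda>k. real (n k) * (1 - l k)) \<longlonglongrightarrow> b" by (rule Lim_transform_eventually[OF 1 2])
  have Gl: "(\<lambda>k. geo (n k - 1) (l k) / real (n k)) \<longlonglongrightarrow> (1 - exp (- b)) / b"
    by (rule tendsto_geo_pos[OF n l lb bpos])
  have lp: "(\<lambda>k. l k ^ (n k - 1)) \<longlonglongrightarrow> exp (- b)"
    by (rule tendsto_power_pred[OF n l lb])
  have ap: "(\<lambda>k. rho_mu (p k) ^ (n k - 1)) \<longlonglongrightarrow> exp (- c)"
    by (rule tendsto_power_pred[OF n rho_mu_lim rho_mu_pos rho_mu_le_1 c])
  have Gb: "0 < (1 - exp (- b)) / b" using bpos by simp
  have 3: "(\<lambda>k. Phi (p k) t (\<lambda>i. \<kappa> k * left_pvec (mean_mat (p k)) i) (n k) j *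
        (geo (n k - 1) (l k) / geo (n k - 1) (rho_mu (p k)))\<^sup>2 / (l k / rho_mu (p k)) ^ (n k - 1) *
        (l k ^ (n k - 1) / rho_mu (p k) ^ (n k - 1) *
         ((geo (n k - 1) (rho_mu (p k)) / real (n k)) / (geo (n k - 1) (l k) / real (n k)))\<^sup>2))
     \<longlonglongrightarrow> 1 * (exp (- b) / exp (- c) * (G / ((1 - exp (- b)) / b))\<^sup>2)"
    by (intro tendsto_intros Phi Gl lp ap G) (use Gb in auto)
  \<comment> \<open>From n = 2 on, \<open>geo (n - 1)\<close> has at least one term and is positive,
    so the quotients can be cancelled.\<close>
  have n2: "\<forall>\<^sub>F k in sequentially. 2 \<le> n k" using n unfolding filterlim_at_top by blast
  have geo_pos: "0 < geo (i - 1) y" if "2 \<le> i" "0 < y" for i and y :: real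
    unfolding geo_def using that by (intro sum_pos) (auto simp: lessThan_empty_iff)
  have 4: "\<forall>\<^sub>F k in sequentially. Phi (p k) t (\<lambda>i. \<kappa> k * left_pvec (mean_mat (p k)) i) (n k) j *
        (geo (n k - 1) (l k) / geo (n k - 1) (rho_mu (p k)))\<^sup>2 / (l k / rho_mu (p k)) ^ (n k - 1) *
        (l k ^ (n k - 1) / rho_mu (p k) ^ (n k - 1) *
         ((geo (n k - 1) (rho_mu (p k)) / real (n k)) / (geo (n k - 1) (l k) / real (n k)))\<^sup>2) =
      Phi (p k) t (\<lambda>i. \<kappa> k * left_pvec (mean_mat (p k)) i) (n k) j"
    using n2 l(2) rho_mu_pos
  proof eventually_elim
    case (elim k)
    have g: "geo (n k - 1) (l k) \<noteq> 0" "geo (n k - 1) (rho_mu (p k)) \<noteq> 0"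
      using geo_pos[OF elim(1)] elim(2,3) by (metis less_irrefl)+
    have cancel: "P * (x / y)\<^sup>2 / z * (z * ((y / N) / (x / N))\<^sup>2) = P"
      if "x \<noteq> 0" "y \<noteq> 0" "z \<noteq> 0" "N \<noteq> 0" for P x y z N :: real
      using that by (simp add: power_divide field_simps)
    show ?case
      unfolding power_divide[of "l k" "rho_mu (p k)", symmetric]
      by (rule cancel) (use g elim in auto)
  qed
  show ?thesis using Lim_transform_eventually[OF 3 4] by simp
qed

text \<open>Put a = \<open>rho_mu\<close> and \<eta> = a - l. The difference of squares makes n
  \<eta> (2 + \<eta> / (1 - a)) tend to 2 T; as n (1 - a) diverges, \<eta> is negligible against 1 -
  a, so n \<eta> tends to T. Both geometric sums saturate at 1 / (1 - a), and only (l / a)^(n - 1)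
  survives.\<close>

lemma Phi_limit_linear_scale:
  assumes c: "filterlim (\<lambda>k. real (n k) * (1 - rho_mu (p k))) at_top sequentially"
  shows "(\<lambda>k. Phi (p k) t (\<lambda>i. 2 * Qconst (p k) * real (n k) / (1 - rho_mu (p k)) * left_pvec (mean_mat (p k)) i) (n k) j)
    \<longlonglongrightarrow> exp (- T)"
proof -
  define \<kappa> where "\<kappa> k = 2 * Qconst (p k) * real (n k) / (1 - rho_mu (p k))" for k
  define a where "a k = rho_mu (p k)" for k
  have a: "a \<longlonglongrightarrow> 1" "\<forall>\<^sub>F k in sequentially. 0 < a k" "\<forall>\<^sub>F k in sequentially. a k \<le> 1"
    unfolding a_def by (rule rho_mu_lim rho_mu_pos rho_mu_le_1)+
  have rn: "filterlim (\<lambda>k. real (n k)) at_top sequentially"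
    by (rule filterlim_compose[OF filterlim_real_sequentially n])
  have n_pos: "\<forall>\<^sub>F k in sequentially. 1 \<le> n k" using n unfolding filterlim_at_top by blast
  have na_pos: "\<forall>\<^sub>F k in sequentially. 0 < real (n k) * (1 - a k)"
    using c unfolding a_def filterlim_at_top_dense by blast
  have dpos: "\<forall>\<^sub>F k in sequentially. 0 < 1 - a k"
    using na_pos by eventually_elim (auto simp: zero_less_mult_iff)
  have Qk: "\<forall>\<^sub>F k in sequentially. Q / 2 < Qconst (p k)"
    by (rule order_tendstoD(1)[OF Qconst_lim]) (use Q_pos in simp)
  have kap_top: "filterlim \<kappa> at_top sequentially"
  proof (rule filterlim_at_top_mono)
    show "filterlim (\<lambda>k. Q * real (n k)) at_top sequentially"
      by (rule filterlim_tendsto_pos_mult_at_top[OF tendsto_const Q_pos rn])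
    show "\<forall>\<^sub>F k in sequentially. Q * real (n k) \<le> \<kappa> k"
      using dpos a(2) Qk
    proof eventually_elim
      case (elim k)
      have "Q * real (n k) * (1 - a k) \<le> Q * real (n k) * 1"
        using elim Q_pos by (intro mult_left_mono) auto
      also have "\<dots> \<le> 2 * Qconst (p k) * real (n k)"
        using elim(3) by (simp add: mult_right_mono)
      finally show ?case using elim(1) by (simp add: \<kappa>_def a_def pos_le_divide_eq)
    qed
  qed
  obtain l where l: "l \<longlonglongrightarrow> 1" "\<forall>\<^sub>F k in sequentially. 0 < l k" "\<forall>\<^sub>F k in sequentially. l k \<le> 1"
    and root: "(\<lambda>k. \<kappa> k * ((1 - l k)\<^sup>2 - (1 - a k)\<^sup>2)) \<longlonglongrightarrow> 4 * Q * T"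
    and Phi: "(\<lambda>k. Phi (p k) t (\<lambda>i. \<kappa> k * left_pvec (mean_mat (p k)) i) (n k) j *
        (geo (n k - 1) (l k) / geo (n k - 1) (a k))\<^sup>2 / (l k / a k) ^ (n k - 1)) \<longlonglongrightarrow> 1"
    using Phi_ratio[OF kap_top] unfolding a_def by blast
  define \<eta> where "\<eta> k = a k - l k" for k
  define z where "z k = real (n k) * \<eta> k * (2 + \<eta> k / (1 - a k))" for k
  have z: "z \<longlonglongrightarrow> 2 * T"
  proof -
    have 1: "(\<lambda>k. \<kappa> k * ((1 - l k)\<^sup>2 - (1 - a k)\<^sup>2) / (2 * Qconst (p k))) \<longlonglongrightarrow> 4 * Q * T / (2 * Q)"
      by (intro tendsto_intros root Qconst_lim) (use Q_pos in simp)
    have 2: "\<forall>\<^sub>F k in sequentially. \<kappa> k * ((1 - l k)\<^sup>2 - (1 - a k)\<^sup>2) / (2 * Qconst (p k)) = z k"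
      using dpos Qk
    proof eventually_elim
      case (elim k)
      have Qp: "0 < Qconst (p k)" using elim Q_pos by linarith
      have "(1 - l k)\<^sup>2 - (1 - a k)\<^sup>2 = \<eta> k * (2 * (1 - a k) + \<eta> k)"
        by (simp add: \<eta>_def power2_eq_square algebra_simps)
      moreover have "\<kappa> k = 2 * Qconst (p k) * (real (n k) / (1 - a k))" by (simp add: \<kappa>_def a_def)
      ultimately have "\<kappa> k * ((1 - l k)\<^sup>2 - (1 - a k)\<^sup>2) / (2 * Qconst (p k)) =
         real (n k) / (1 - a k) * (\<eta> k * (2 * (1 - a k) + \<eta> k))"
        using Qp by simp
      also have "\<dots> = z k" using elim(1) by (simp add: z_def field_simps)
      finally show ?case .
    qed
    show ?thesis using Lim_transform_eventually[OF 1 2] Q_pos by simp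
  qed
  \<comment> \<open>The last factor of z equals ((1 - a) + (1 - l)) / (1 - a), which is nonnegative,
    so positivity of z passes to \<open>\<eta>\<close>.\<close>
  have eta_pos: "\<forall>\<^sub>F k in sequentially. 0 < \<eta> k"
  proof -
    have "\<forall>\<^sub>F k in sequentially. 0 < z k"
      by (rule order_tendstoD(1)[OF z]) (use T_pos in simp)
    then show ?thesis using dpos l(3)
    proof eventually_elim
      case (elim k)
      have "2 + \<eta> k / (1 - a k) = ((1 - a k) + (1 - l k)) / (1 - a k)"
        using elim(2) by (simp add: \<eta>_def field_simps)
      also have "\<dots> \<ge> 0" using elim by (intro divide_nonneg_pos) auto
      finally have "0 < real (n k) * \<eta> k" using elim(1) by (auto simp: z_def zero_less_mult_iff)
      then show ?case by (simp add: zero_less_mult_iff)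
    qed
  qed
  have ratio0: "(\<lambda>k. \<eta> k / (1 - a k)) \<longlonglongrightarrow> 0"
  proof (rule tendsto_sandwich[OF _ _ tendsto_const])
    show "(\<lambda>k. z k / 2 / (real (n k) * (1 - a k))) \<longlonglongrightarrow> 0"
      by (rule tendsto_divide_0[OF tendsto_divide[OF z tendsto_const, of 2]])
         (use filterlim_at_top_imp_at_infinity[OF c] in \<open>auto simp: a_def\<close>)
    show "\<forall>\<^sub>F k in sequentially. 0 \<le> \<eta> k / (1 - a k)"
      using eta_pos dpos by eventually_elim simp
    show "\<forall>\<^sub>F k in sequentially. \<eta> k / (1 - a k) \<le> z k / 2 / (real (n k) * (1 - a k))"
      using eta_pos dpos n_pos
    proof eventually_elim
      case (elim k)
      have "real (n k) * \<eta> k * 2 \<le> z k"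
        unfolding z_def using elim by (intro mult_left_mono) auto
      then have "real (n k) * \<eta> k / (real (n k) * (1 - a k)) \<le> z k / 2 / (real (n k) * (1 - a k))"
        using elim by (intro divide_right_mono) auto
      then show ?case using elim by simp
    qed
  qed
  have neta: "(\<lambda>k. real (n k) * \<eta> k) \<longlonglongrightarrow> T"
  proof -
    have 1: "(\<lambda>k. z k / (2 + \<eta> k / (1 - a k))) \<longlonglongrightarrow> 2 * T / (2 + 0)"
      by (intro tendsto_intros z ratio0) auto
    have 2: "\<forall>\<^sub>F k in sequentially. z k / (2 + \<eta> k / (1 - a k)) = real (n k) * \<eta> k"
      using eta_pos dpos
    proof eventually_elim
      case (elim k)
      then have "0 < 2 + \<eta> k / (1 - a k)" by (simp add: add_pos_pos)
      then show ?case by (simp add: z_def)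
    qed
    show ?thesis using Lim_transform_eventually[OF 1 2] by simp
  qed
  have la: "(\<lambda>k. (l k / a k) ^ (n k - 1)) \<longlonglongrightarrow> exp (- T)"
  proof (rule tendsto_power_pred[OF n])
    show "(\<lambda>k. l k / a k) \<longlonglongrightarrow> 1" using tendsto_divide[OF l(1) a(1)] by simp
    show "\<forall>\<^sub>F k in sequentially. 0 < l k / a k" using l(2) a(2) by eventually_elim simp
    show "\<forall>\<^sub>F k in sequentially. l k / a k \<le> 1" using eta_pos a(2) by eventually_elim (simp add: \<eta>_def)
    have 1: "(\<lambda>k. real (n k) * \<eta> k / a k) \<longlonglongrightarrow> T / 1" by (intro tendsto_intros neta a) auto
    have 2: "\<forall>\<^sub>F k in sequentially. real (n k) * \<eta> k / a k = real (n k) * (1 - l k / a k)"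
      using a(2) by eventually_elim (simp add: \<eta>_def field_simps)
    show "(\<lambda>k. real (n k) * (1 - l k / a k)) \<longlonglongrightarrow> T" using Lim_transform_eventually[OF 1 2] by simp
  qed
  have a_pow: "(\<lambda>k. a k ^ (n k - 1)) \<longlonglongrightarrow> 0"
  proof (rule tendsto_sandwich[OF _ _ tendsto_const])
    have "filterlim (\<lambda>k. real (n k - 1) / real (n k) * (real (n k) * (1 - a k))) at_top sequentially"
      using filterlim_tendsto_pos_mult_at_top[OF tendsto_pred_ratio[OF n] _ c] by (simp add: a_def)
    then have "((\<lambda>k. exp (- (real (n k - 1) / real (n k) * (real (n k) * (1 - a k))))) \<longlongrightarrow> 0) sequentially"
      by (intro filterlim_compose[OF exp_at_bot] filterlim_uminus_at_bot_at_top[THEN filterlim_compose])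
    then show "(\<lambda>k. exp (- (real (n k - 1) / real (n k) * (real (n k) * (1 - a k))))) \<longlonglongrightarrow> 0" .
    show "\<forall>\<^sub>F k in sequentially. 0 \<le> a k ^ (n k - 1)" using a(2) by eventually_elim simp
    show "\<forall>\<^sub>F k in sequentially. a k ^ (n k - 1) \<le> exp (- (real (n k - 1) / real (n k) * (real (n k) * (1 - a k))))"
      using a(2) n_pos
    proof eventually_elim
      case (elim k)
      have "a k \<le> exp (- (1 - a k))" using exp_ge_add_one_self[of "- (1 - a k)"] by simp
      then have "a k ^ (n k - 1) \<le> exp (- (1 - a k)) ^ (n k - 1)"
        using elim by (intro power_mono) auto
      also have "\<dots> = exp (real (n k - 1) * (- (1 - a k)))" by (simp only: exp_of_nat_mult)
      also have "real (n k - 1) * (- (1 - a k)) = - (real (n k - 1) / real (n k) * (real (n k) * (1 - a k)))"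
        using elim(2) by (simp add: field_simps)
      finally show ?case .
    qed
  qed
  have l_pow: "(\<lambda>k. l k ^ (n k - 1)) \<longlonglongrightarrow> 0"
  proof (rule tendsto_sandwich[OF _ _ tendsto_const a_pow])
    show "\<forall>\<^sub>F k in sequentially. 0 \<le> l k ^ (n k - 1)" using l(2) by eventually_elim simp
    show "\<forall>\<^sub>F k in sequentially. l k ^ (n k - 1) \<le> a k ^ (n k - 1)"
      using l(2) eta_pos by eventually_elim (auto intro!: power_mono simp: \<eta>_def)
  qed
  have geo_ratio: "(\<lambda>k. geo (n k - 1) (l k) / geo (n k - 1) (a k)) \<longlonglongrightarrow> 1"
  proof -
    have 1: "(\<lambda>k. (1 - l k ^ (n k - 1)) / (1 - a k ^ (n k - 1)) / (1 + \<eta> k / (1 - a k))) \<longlonglongrightarrow> (1 - 0) / (1 - 0) / (1 + 0)"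
      by (intro tendsto_intros l_pow a_pow ratio0) auto
    have 2: "\<forall>\<^sub>F k in sequentially. (1 - l k ^ (n k - 1)) / (1 - a k ^ (n k - 1)) / (1 + \<eta> k / (1 - a k))
       = geo (n k - 1) (l k) / geo (n k - 1) (a k)"
      using dpos eta_pos
    proof eventually_elim
      case (elim k)
      have "1 + \<eta> k / (1 - a k) = (1 - l k) / (1 - a k)"
        using elim by (simp add: \<eta>_def field_simps)
      moreover have "0 < 1 - l k" using elim by (simp add: \<eta>_def)
      ultimately show ?case
        unfolding geo_telescope[symmetric] using elim by simp
    qed
    show ?thesis using Lim_transform_eventually[OF 1 2] by simp
  qed
  have 3: "(\<lambda>k. Phi (p k) t (\<lambda>i. \<kappa> k * left_pvec (mean_mat (p k)) i) (n k) j *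
        (geo (n k - 1) (l k) / geo (n k - 1) (a k))\<^sup>2 / (l k / a k) ^ (n k - 1) *
        ((l k / a k) ^ (n k - 1) / (geo (n k - 1) (l k) / geo (n k - 1) (a k))\<^sup>2)) \<longlonglongrightarrow> 1 * (exp (- T) / 1\<^sup>2)"
    by (intro tendsto_mult tendsto_divide tendsto_power Phi la geo_ratio) auto
  have 4: "\<forall>\<^sub>F k in sequentially. Phi (p k) t (\<lambda>i. \<kappa> k * left_pvec (mean_mat (p k)) i) (n k) j *
        (geo (n k - 1) (l k) / geo (n k - 1) (a k))\<^sup>2 / (l k / a k) ^ (n k - 1) *
        ((l k / a k) ^ (n k - 1) / (geo (n k - 1) (l k) / geo (n k - 1) (a k))\<^sup>2)
      = Phi (p k) t (\<lambda>i. \<kappa> k * left_pvec (mean_mat (p k)) i) (n k) j"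
    using order_tendstoD(1)[OF geo_ratio zero_less_one] l(2) a(2)
  proof eventually_elim
    case (elim k)
    have "P * x / y * (y / x) = P" if "x \<noteq> 0" "y \<noteq> 0" for P x y :: real using that by simp
    then show ?case using elim by (metis divide_pos_pos less_irrefl power_not_zero)
  qed
  show ?thesis using Lim_transform_eventually[OF 3 4] by (simp add: \<kappa>_def)
qed

end

end

text \<open>\<open>bcoef\<close> is an \<open>enn2real\<close> and would hide an infinite moment.
  The third moment bound excludes this, so the lower bound on second derivatives can be passed to
  the limit.\<close>

lemma fmom2_bcoef:
  assumes C: "moment3_le C p"
  shows "fmom2 p k l m = ennreal (bcoef p k l m)"
proof -
  have "fmom2 p k l m = (\<integral>\<^sup>+ n. ennreal (ddmon (\<lambda>_. 1) n l m) \<partial>measure_pmf (p k))"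
    unfolding fmom2_def
    by (intro nn_integral_cong) (simp add: ddmon_def dmon_def drop1_def ennreal_of_nat_eq_real_of_nat)
  also have "\<dots> = ennreal (bcoef p k l m)"
    unfolding bcoef_ddmon
    by (rule nn_integral_eq_integral[OF integrable_ddmon[OF C]]) (auto simp: ddmon_nonneg)
  finally show ?thesis .
qed

text \<open>Means and second derivatives are finitely many bounded numbers, so Bolzano-Weierstrass
  applies; a further subsequence decides whether extinction is certain for all members or for none.
  The entry bounds for exponent \<open>U\<close> survive in the limit and give primitivity.\<close>

lemma near_critical_subsequence:
  fixes f :: "nat \<Rightarrow> ('d::finite) offspring"
  assumes abc: "0 < a" "0 < b" "0 < c" and U: "1 \<le> U"
    and K: "\<And>k. in_K a b c U (f k)" and rho: "(\<lambda>k. rho (f k)) \<longlonglongrightarrow> 1"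
  obtains q A B where "strict_mono q" "near_critical (\<lambda>k. f (q k)) (8 + 5 * c) A B"
    "(\<forall>k. hstar (f (q k)) (\<lambda>_. 1) = (\<lambda>_. 1)) \<or> (\<forall>k. hstar (f (q k)) (\<lambda>_. 1) \<noteq> (\<lambda>_. 1))"
proof -
  define C where "C = 8 + 5 * c"
  have mom: "moment3_le C (f k)" for k
    unfolding C_def by (rule in_K_moment3[OF K abc(3)])
  \<comment> \<open>A sum type packs both arrays into one finite index set, so that a single
    extraction serves both.\<close>
  define X where "X n = case_sum (\<lambda>(i, j). mean_mat (f n) i j) (\<lambda>(l, i, j). bcoef (f n) l i j)" for n
  have mean_nonneg: "0 \<le> mean_mat (f k) i j" for k i j
    unfolding mean_mat_def by (intro dpgf_nonneg[OF mom]) auto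
  have "\<bar>X n i\<bar> \<le> C" for n i
    using mean_nonneg[of n] mean_mat_le[OF mom[of n]] bcoef_nonneg[OF mom[of n]] bcoef_le[OF mom[of n]]
    by (auto simp: X_def split: sum.split)
  then obtain r L where r: "strict_mono r" and L: "\<And>i. (\<lambda>n. X (r n) i) \<longlonglongrightarrow> L i"
    using bounded_fun_convergent_subseq[of X C] by blast
  let ?P = "\<lambda>k. hstar (f (r k)) (\<lambda>_. 1) = (\<lambda>_. 1)"
  have "infinite {k. ?P k} \<or> infinite {k. \<not> ?P k}"
  proof -
    have "{k. ?P k} \<union> {k. \<not> ?P k} = (UNIV :: nat set)" by auto
    then show ?thesis by (metis finite_Un infinite_UNIV_nat)
  qed
  then have "\<exists>r2 :: nat \<Rightarrow> nat. strict_mono r2 \<and> ((\<forall>k. ?P (r2 k)) \<or> (\<forall>k. \<not> ?P (r2 k)))"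
  proof
    assume "infinite {k. ?P k}"
    from infinite_enumerate[OF this] show ?thesis by (simp only: mem_Collect_eq) blast
  next
    assume "infinite {k. \<not> ?P k}"
    from infinite_enumerate[OF this] show ?thesis by (simp only: mem_Collect_eq) blast
  qed
  then obtain r2 :: "nat \<Rightarrow> nat" where r2: "strict_mono r2" "(\<forall>k. ?P (r2 k)) \<or> (\<forall>k. \<not> ?P (r2 k))"
    by blast
  define q where "q k = r (r2 k)" for k
  have q: "strict_mono q" using r r2(1) by (simp add: q_def strict_mono_def)
  define A where "A i j = L (Inl (i, j))" for i j
  define B where "B l i j = L (Inr (l, i, j))" for l i j
  have Xq: "(\<lambda>k. X (q k) i) \<longlonglongrightarrow> L i" for i
    using LIMSEQ_subseq_LIMSEQ[OF L r2(1)] by (simp add: q_def o_def)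
  have A: "(\<lambda>k. mean_mat (f (q k)) i j) \<longlonglongrightarrow> A i j" for i j
    using Xq[of "Inl (i, j)"] by (simp add: X_def A_def)
  have B: "(\<lambda>k. bcoef (f (q k)) l i j) \<longlonglongrightarrow> B l i j" for l i j
    using Xq[of "Inr (l, i, j)"] by (simp add: X_def B_def)
  have prim: "primitive A"
    unfolding primitive_def
  proof (intro conjI allI exI[of _ "U - 1"])
    show "0 \<le> A i j" for i j
      by (rule LIMSEQ_le_const[OF A]) (auto intro: mean_nonneg)
    have "a \<le> mat_pow A U i j" for i j
      by (rule LIMSEQ_le_const[OF tendsto_mat_pow[OF A]]) (use K in \<open>auto simp: in_K_def\<close>)
    moreover have "Suc (U - 1) = U" using U by simp
    ultimately show "0 < mat_pow A (Suc (U - 1)) i j" for i j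
      using abc(1) by (metis order_less_le_trans)
  qed
  have root: "perron_root A = 1"
  proof (rule LIMSEQ_unique)
    show "(\<lambda>k. perron_root (mean_mat (f (q k)))) \<longlonglongrightarrow> perron_root A"
      by (rule tendsto_perron_root[OF A prim mean_nonneg])
    show "(\<lambda>k. perron_root (mean_mat (f (q k)))) \<longlonglongrightarrow> 1"
      using LIMSEQ_subseq_LIMSEQ[OF rho q] by (simp add: rho_def o_def)
  qed
  have "\<exists>l i j. B l i j \<noteq> 0"
  proof (rule ccontr)
    assume "\<not> ?thesis"
    then have B0: "B l i j = 0" for l i j by blast
    have "b \<le> (\<Sum>l\<in>UNIV. \<Sum>i\<in>UNIV. \<Sum>j\<in>UNIV. B l i j)"
    proof (rule LIMSEQ_le_const)
      show "(\<lambda>k. \<Sum>l\<in>UNIV. \<Sum>i\<in>UNIV. \<Sum>j\<in>UNIV. bcoef (f (q k)) l i j)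
          \<longlonglongrightarrow> (\<Sum>l\<in>UNIV. \<Sum>i\<in>UNIV. \<Sum>j\<in>UNIV. B l i j)"
        by (intro tendsto_intros B)
      have "b \<le> (\<Sum>l\<in>UNIV. \<Sum>i\<in>UNIV. \<Sum>j\<in>UNIV. bcoef (f k) l i j)" for k
      proof -
        have "ennreal b \<le> (\<Sum>l\<in>UNIV. \<Sum>i\<in>UNIV. \<Sum>j\<in>UNIV. fmom2 (f k) l i j)"
          using K[of k] by (simp add: in_K_def)
        also have "\<dots> = ennreal (\<Sum>l\<in>UNIV. \<Sum>i\<in>UNIV. \<Sum>j\<in>UNIV. bcoef (f k) l i j)"
          by (simp add: fmom2_bcoef[OF mom] sum_ennreal bcoef_nonneg[OF mom] sum_nonneg)
        finally show ?thesis
          by (subst (asm) ennreal_le_iff) (auto intro!: sum_nonneg bcoef_nonneg[OF mom])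
      qed
      then show "\<exists>N. \<forall>k\<ge>N. b \<le> (\<Sum>l\<in>UNIV. \<Sum>i\<in>UNIV. \<Sum>j\<in>UNIV. bcoef (f (q k)) l i j)" by blast
    qed
    then show False using abc(2) by (simp add: B0)
  qed
  then have "near_critical (\<lambda>k. f (q k)) C A B"
    by unfold_locales (use mom A B prim root in auto)
  then show ?thesis
    using that[of q A B] q r2(2) by (simp add: C_def q_def)
qed

text \<open>The function \<open>hfun\<close> is only a normalisation, cancelling against its occurrence in \<open>dfun\<close>:
  continuity and positivity at \<open>ln r\<close> are all that matters (it blows up at \<open>0\<close>).\<close>

lemma tendsto_hfun:
  assumes "(x \<longlongrightarrow> y) F" "y \<noteq> 0"
  shows "((\<lambda>k. hfun (x k)) \<longlongrightarrow> hfun y) F"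
  unfolding hfun_def by (intro tendsto_intros assms) (use assms(2) in auto)

lemma hfun_ln_pos:
  assumes "0 < r" "r < 1"
  shows "0 < hfun (ln r)"
proof -
  have "ln r * (1 + r) < 0" using assms by (intro mult_neg_pos) auto
  then have "ln r * (1 + exp (ln r)) - 2 * (1 - exp (ln r)) < 0" using assms by simp
  moreover have "(exp (ln r) - 1) ^ 3 < 0" using assms by (simp add: power_less_zero_eq)
  ultimately show ?thesis unfolding hfun_def by (rule divide_neg_neg)
qed

theorem theorem4:
  fixes a b c :: real and U :: nat
    and t :: "'d::finite \<Rightarrow> real"
    and nk :: "nat \<Rightarrow> nat" and fk :: "nat \<Rightarrow> 'd offspring"
    and j :: 'd and r :: real
  assumes abc: "a > 0" "b > 0" "c > 0" and U: "U \<ge> 1"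
    and H: "\<forall>(ns :: nat \<Rightarrow> nat) (fs :: nat \<Rightarrow> 'd offspring) (ss :: nat \<Rightarrow> 'd \<Rightarrow> real).
              filterlim ns at_top sequentially \<longrightarrow> (\<forall>k. in_K a b c U (fs k)) \<longrightarrow>
              (\<lambda>k. rho (fs k)) \<longlonglongrightarrow> 1 \<longrightarrow> (\<forall>k. ss k \<in> cube) \<longrightarrow>
              (\<forall>l. (\<lambda>k. ss k l) \<longlonglongrightarrow> 1) \<longrightarrow>
              (\<lambda>k. \<Sum>i\<in>UNIV. v_hstar (fs k) (ss k) i *
                      (hstar (fs k) (ss k) i - hseq (fs k) (ss k) (ns k) i)) \<longlonglongrightarrow> 0"
    and t_nonneg: "\<forall>l. t l \<ge> 0"
    and nk: "filterlim nk at_top sequentially"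
    and fK: "\<forall>k. in_K a b c U (fk k)"
    and rho1: "(\<lambda>k. rho (fk k)) \<longlonglongrightarrow> 1"
  defines "T \<equiv> \<Sum>l\<in>UNIV. t l"
  shows
    "((\<forall>k. rho (fk k) \<noteq> 1) \<and> 0 < r \<and> r < 1 \<and>
        (\<lambda>k. real (nk k) * \<bar>1 - rho (fk k)\<bar>) \<longlonglongrightarrow> - ln r \<longrightarrow>
      (\<lambda>k. Phi (fk k) t
             (\<lambda>l. 2 * Qconst (fk k) * (1 - rho_mu (fk k) ^ nk k)^2
                    * hfun (real (nk k) * ln (rho_mu (fk k))) / (1 - rho_mu (fk k))^2
                    * left_pvec (mean_mat (fk k)) l)
             (nk k) j)
        \<longlonglongrightarrow> (1 - r)^2 * r powr (dfun T r) * (dfun T r)^2 / (r * (1 - r powr (dfun T r))^2))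
   \<and> ((\<lambda>k. real (nk k) * \<bar>1 - rho (fk k)\<bar>) \<longlonglongrightarrow> 0 \<longrightarrow>
      (\<lambda>k. Phi (fk k) t (\<lambda>l. Qconst (fk k) * real (nk k)^2 / 3 * left_pvec (mean_mat (fk k)) l)
             (nk k) j)
        \<longlonglongrightarrow> (if T = 0 then 1 else 3 * T / (sinh (sqrt (3 * T)))^2))
   \<and> ((\<forall>k. rho (fk k) \<noteq> 1) \<and> filterlim (\<lambda>k. real (nk k) * \<bar>1 - rho (fk k)\<bar>) at_top sequentially \<longrightarrow>
      (\<lambda>k. Phi (fk k) t
             (\<lambda>l. 2 * Qconst (fk k) * real (nk k) / (1 - rho_mu (fk k)) * left_pvec (mean_mat (fk k)) l)
             (nk k) j)
        \<longlonglongrightarrow> exp (- T))"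
proof (cases "T = 0")
  \<comment> \<open>With all weights 0 the transform is constantly 1, and
    \<open>dfun 0 r = 1\<close> makes the first limit 1 as well. It is treated apart because the
    root comparison divides by the component of the weights along v.\<close>
  case True
  then have "t = (\<lambda>_. 0)"
    using t_nonneg by (auto simp: T_def sum_nonneg_eq_0_iff)
  then have "Phi p t m n j = 1" for p m n by (simp add: Phi_def)
  then show ?thesis using True by (auto simp: dfun_def)
next
  case False
  then have T: "0 < T" "0 < (\<Sum>l\<in>UNIV. t l)"
    using t_nonneg by (simp_all add: T_def order_less_le sum_nonneg)
  have tn: "\<And>l. 0 \<le> t l" using t_nonneg by blast
  \<comment> \<open>Every subsequence has a further one along which the limit data exist, and the
    limit obtained there does not depend on them.\<close>
  have sub: "F \<longlonglongrightarrow> \<Lambda>"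
    if step: "\<And>q A B. strict_mono q \<Longrightarrow> near_critical (\<lambda>k. fk (q k)) (8 + 5 * c) A B \<Longrightarrow>
       (\<forall>k. hstar (fk (q k)) (\<lambda>_. 1) = (\<lambda>_. 1)) \<or> (\<forall>k. hstar (fk (q k)) (\<lambda>_. 1) \<noteq> (\<lambda>_. 1)) \<Longrightarrow>
       (\<lambda>k. F (q k)) \<longlonglongrightarrow> \<Lambda>" for F :: "nat \<Rightarrow> real" and \<Lambda>
  proof (rule tendsto_if_subseq)
    fix q1 :: "nat \<Rightarrow> nat" assume q1: "strict_mono q1"
    have "(\<lambda>k. rho (fk (q1 k))) \<longlonglongrightarrow> 1"
      using LIMSEQ_subseq_LIMSEQ[OF rho1 q1] by (simp add: o_def)
    then obtain q2 A B where q2: "strict_mono q2" "near_critical (\<lambda>k. fk (q1 (q2 k))) (8 + 5 * c) A B"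
      "(\<forall>k. hstar (fk (q1 (q2 k))) (\<lambda>_. 1) = (\<lambda>_. 1)) \<or> (\<forall>k. hstar (fk (q1 (q2 k))) (\<lambda>_. 1) \<noteq> (\<lambda>_. 1))"
      using near_critical_subsequence[OF abc U, of "\<lambda>k. fk (q1 k)"] fK by blast
    moreover have "strict_mono (\<lambda>k. q1 (q2 k))" using q1 q2(1) by (simp add: strict_mono_def)
    ultimately have "(\<lambda>k. F (q1 (q2 k))) \<longlonglongrightarrow> \<Lambda>" using step[of "\<lambda>k. q1 (q2 k)" A B] by blast
    then show "\<exists>q. strict_mono q \<and> (\<lambda>k. F (q1 (q k))) \<longlonglongrightarrow> \<Lambda>" using q2(1) by blast
  qed
  have subseq: "filterlim (\<lambda>k. X (q k)) F sequentially" if "filterlim X F sequentially" "strict_mono q"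
    for X :: "nat \<Rightarrow> 'x" and F and q :: "nat \<Rightarrow> nat"
    using that(1) by (rule filterlim_compose) (rule filterlim_subseq[OF that(2)])
  show ?thesis
  proof (intro conjI impI)
    assume as: "(\<forall>k. rho (fk k) \<noteq> 1) \<and> 0 < r \<and> r < 1 \<and>
        (\<lambda>k. real (nk k) * \<bar>1 - rho (fk k)\<bar>) \<longlonglongrightarrow> - ln r"
    then have r: "0 < r" "r < 1" by auto
    define y where "y = - ln r"
    have y: "0 < y" "exp (- y) = r" using r by (simp_all add: y_def)
    define D where "D = dfun T r"
    have h: "0 < hfun (ln r)" by (rule hfun_ln_pos[OF r])
    have D: "0 < D" unfolding D_def dfun_def using T h r
      by (intro real_sqrt_gt_zero add_pos_nonneg) auto
    show "(\<lambda>k. Phi (fk k) t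
             (\<lambda>l. 2 * Qconst (fk k) * (1 - rho_mu (fk k) ^ nk k)^2
                    * hfun (real (nk k) * ln (rho_mu (fk k))) / (1 - rho_mu (fk k))^2
                    * left_pvec (mean_mat (fk k)) l)
             (nk k) j)
        \<longlonglongrightarrow> (1 - r)^2 * r powr (dfun T r) * (dfun T r)^2 / (r * (1 - r powr (dfun T r))^2)"
    proof (rule sub)
      fix q A B assume q: "strict_mono q" and nc: "near_critical (\<lambda>k. fk (q k)) (8 + 5 * c) A B"
        and alt: "(\<forall>k. hstar (fk (q k)) (\<lambda>_. 1) = (\<lambda>_. 1)) \<or> (\<forall>k. hstar (fk (q k)) (\<lambda>_. 1) \<noteq> (\<lambda>_. 1))"
      interpret near_critical "\<lambda>k. fk (q k)" "8 + 5 * c" A B by (rule nc)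
      let ?n = "\<lambda>k. nk (q k)" and ?\<rho> = "\<lambda>k. rho_mu (fk (q k))"
      have n: "filterlim ?n at_top sequentially" by (rule subseq[OF nk q])
      have "(\<lambda>k. real (?n k) * \<bar>1 - rho (fk (q k))\<bar>) \<longlonglongrightarrow> y"
        using subseq[OF _ q, of "\<lambda>k. real (nk k) * \<bar>1 - rho (fk k)\<bar>"] as by (simp add: y_def)
      then have lim: "(\<lambda>k. real (?n k) * (1 - ?\<rho> k)) \<longlonglongrightarrow> y" by (rule rho_mu_scale(1)[OF alt])
      let ?\<kappa> = "\<lambda>k. 2 * Qconst (fk (q k)) * (1 - ?\<rho> k ^ ?n k)^2 * hfun (real (?n k) * ln (?\<rho> k)) / (1 - ?\<rho> k)^2"
      \<comment> \<open>The limit of \<kappa> / n^2: the factor n (1 - \<open>rho_mu\<close>) tends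
        to y, and the n-th power of \<open>rho_mu\<close> to r.\<close>
      define K where "K = 2 * Q * (1 - r)^2 * hfun (ln r) / y\<^sup>2"
      have K: "0 < K" unfolding K_def using Q_pos r y h by simp
      have pw: "(\<lambda>k. ?\<rho> k ^ ?n k) \<longlonglongrightarrow> r"
        using tendsto_exponential_power[OF rho_mu_lim rho_mu_pos lim] y by simp
      have "(\<lambda>k. real (?n k) * ln (?\<rho> k)) \<longlonglongrightarrow> ln r"
        using tendsto_mult_ln[OF rho_mu_lim rho_mu_pos lim] by (simp add: y_def)
      then have hl: "(\<lambda>k. hfun (real (?n k) * ln (?\<rho> k))) \<longlonglongrightarrow> hfun (ln r)"
        by (rule tendsto_hfun) (use r in simp)
      have "(\<lambda>k. 2 * Qconst (fk (q k)) * (1 - ?\<rho> k ^ ?n k)^2 * hfun (real (?n k) * ln (?\<rho> k)) /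
          (real (?n k) * (1 - ?\<rho> k))^2) \<longlonglongrightarrow> K"
        unfolding K_def by (intro tendsto_intros Qconst_lim pw hl lim) (use y in simp)
      then have kap: "(\<lambda>k. ?\<kappa> k / (real (?n k))\<^sup>2) \<longlonglongrightarrow> K"
        by (simp add: power_mult_distrib mult.commute)
      have "(\<lambda>k. Phi (fk (q k)) t (\<lambda>i. ?\<kappa> k * left_pvec (mean_mat (fk (q k))) i) (?n k) j)
        \<longlonglongrightarrow> exp (- sqrt (y\<^sup>2 + 4 * Q * T / K)) / exp (- y) *
          ((1 - exp (- y)) / y / ((1 - exp (- sqrt (y\<^sup>2 + 4 * Q * T / K))) / sqrt (y\<^sup>2 + 4 * Q * T / K)))\<^sup>2"
        unfolding T_def
        by (rule Phi_limit_quadratic_scale[OF n tn T(2) lim kap K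
              tendsto_geo_pos[OF n rho_mu_lim rho_mu_pos rho_mu_le_1 lim y(1)]])
      \<comment> \<open>\<open>Q\<close> cancels between the scale and the root difference; this is
        the origin of \<open>dfun\<close>.\<close>
      moreover have "sqrt (y\<^sup>2 + 4 * Q * T / K) = y * D"
      proof -
        have "y\<^sup>2 + 4 * Q * T / K = y\<^sup>2 * (1 + 2 * T / ((1 - r)^2 * hfun (ln r)))"
          using Q_pos y h r by (simp add: K_def field_simps)
        then show ?thesis using y by (simp add: real_sqrt_mult D_def dfun_def)
      qed
      moreover have "exp (- (y * D)) = r powr D" using r by (simp add: y_def powr_def mult.commute)
      moreover have "r powr D / r * ((1 - r) / y / ((1 - r powr D) / (y * D)))\<^sup>2 =
          (1 - r)^2 * r powr D * D^2 / (r * (1 - r powr D)^2)"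
      proof -
        have "(1 - r) / y / ((1 - r powr D) / (y * D)) = (1 - r) * D / (1 - r powr D)" using y by simp
        then show ?thesis by (simp only:) (simp add: power_divide power_mult_distrib mult_ac)
      qed
      ultimately show "(\<lambda>k. Phi (fk (q k)) t (\<lambda>i. ?\<kappa> k * left_pvec (mean_mat (fk (q k))) i) (?n k) j)
        \<longlonglongrightarrow> (1 - r)^2 * r powr (dfun T r) * (dfun T r)^2 / (r * (1 - r powr (dfun T r))^2)"
        by (simp only: y(2) D_def)
    qed
  next
    assume as: "(\<lambda>k. real (nk k) * \<bar>1 - rho (fk k)\<bar>) \<longlonglongrightarrow> 0"
    show "(\<lambda>k. Phi (fk k) t (\<lambda>l. Qconst (fk k) * real (nk k)^2 / 3 * left_pvec (mean_mat (fk k)) l) (nk k) j)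
        \<longlonglongrightarrow> (if T = 0 then 1 else 3 * T / (sinh (sqrt (3 * T)))^2)"
    proof (rule sub)
      fix q A B assume q: "strict_mono q" and nc: "near_critical (\<lambda>k. fk (q k)) (8 + 5 * c) A B"
        and alt: "(\<forall>k. hstar (fk (q k)) (\<lambda>_. 1) = (\<lambda>_. 1)) \<or> (\<forall>k. hstar (fk (q k)) (\<lambda>_. 1) \<noteq> (\<lambda>_. 1))"
      interpret near_critical "\<lambda>k. fk (q k)" "8 + 5 * c" A B by (rule nc)
      let ?n = "\<lambda>k. nk (q k)" and ?\<kappa> = "\<lambda>k. Qconst (fk (q k)) * real (nk (q k))^2 / 3"
      have n: "filterlim ?n at_top sequentially" by (rule subseq[OF nk q])
      have lim: "(\<lambda>k. real (?n k) * (1 - rho_mu (fk (q k)))) \<longlonglongrightarrow> 0"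
        by (rule rho_mu_scale(1)[OF alt subseq[OF as q]])
      have n_pos: "\<forall>\<^sub>F k in sequentially. 1 \<le> ?n k" using n unfolding filterlim_at_top by blast
      have kap: "(\<lambda>k. ?\<kappa> k / (real (?n k))\<^sup>2) \<longlonglongrightarrow> Q / 3"
      proof (rule Lim_transform_eventually)
        show "(\<lambda>k. Qconst (fk (q k)) / 3) \<longlonglongrightarrow> Q / 3" by (intro tendsto_intros Qconst_lim) auto
        show "\<forall>\<^sub>F k in sequentially. Qconst (fk (q k)) / 3 = ?\<kappa> k / (real (?n k))\<^sup>2"
          using n_pos by eventually_elim simp
      qed
      have "(\<lambda>k. Phi (fk (q k)) t (\<lambda>i. ?\<kappa> k * left_pvec (mean_mat (fk (q k))) i) (?n k) j)
        \<longlonglongrightarrow> exp (- sqrt (0\<^sup>2 + 4 * Q * T / (Q / 3))) / exp (- 0) *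
          (1 / ((1 - exp (- sqrt (0\<^sup>2 + 4 * Q * T / (Q / 3)))) / sqrt (0\<^sup>2 + 4 * Q * T / (Q / 3))))\<^sup>2"
        unfolding T_def
        by (rule Phi_limit_quadratic_scale[OF n tn T(2) lim kap divide_pos_pos[OF Q_pos zero_less_numeral]
              tendsto_geo_zero[OF n rho_mu_lim rho_mu_pos rho_mu_le_1 lim refl]])
      \<comment> \<open>Here 4 Q T / (Q / 3) = 12 T. The constant 1/3 in the scale makes the limit 1
        - T to first order, so the limit law has mean 1.\<close>
      moreover have "sqrt (0\<^sup>2 + 4 * Q * T / (Q / 3)) = 2 * sqrt (3 * T)"
      proof -
        have "0\<^sup>2 + 4 * Q * T / (Q / 3) = 2\<^sup>2 * (3 * T)" using Q_pos by simp
        then show ?thesis by (simp only: real_sqrt_mult real_sqrt_abs abs_numeral)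
      qed
      moreover have "exp (- (2 * w)) / exp (- 0) * (1 / ((1 - exp (- (2 * w))) / (2 * w)))\<^sup>2 = w\<^sup>2 / (sinh w)\<^sup>2"
        if w: "0 < w" for w :: real
      proof -
        define x where "x = exp (- w)"
        have x: "0 < x" "x < 1" "exp w = 1 / x" using w by (simp_all add: x_def exp_minus inverse_eq_divide)
        have e2: "exp (- (2 * w)) = x\<^sup>2" by (simp add: x_def power2_eq_square flip: exp_add)
        have ne: "1 - x\<^sup>2 \<noteq> 0" using x by (simp add: power2_eq_1_iff)
        have sh: "sinh w = (1 - x\<^sup>2) / (2 * x)"
          using x by (simp add: sinh_field_def x_def[symmetric] field_simps power2_eq_square)
        have "x\<^sup>2 / 1 * (1 / ((1 - x\<^sup>2) / (2 * w)))\<^sup>2 = w\<^sup>2 / ((1 - x\<^sup>2) / (2 * x))\<^sup>2"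
          using ne x w by (simp add: power_divide power_mult_distrib)
        then show ?thesis unfolding e2 sh by (simp only: minus_zero exp_zero)
      qed
      moreover have "0 < sqrt (3 * T)" "(sqrt (3 * T))\<^sup>2 = 3 * T" using T by simp_all
      ultimately show "(\<lambda>k. Phi (fk (q k)) t (\<lambda>i. ?\<kappa> k * left_pvec (mean_mat (fk (q k))) i) (?n k) j)
        \<longlonglongrightarrow> (if T = 0 then 1 else 3 * T / (sinh (sqrt (3 * T)))^2)"
        using False by (simp only: if_False)
    qed
  next
    assume as: "(\<forall>k. rho (fk k) \<noteq> 1) \<and> filterlim (\<lambda>k. real (nk k) * \<bar>1 - rho (fk k)\<bar>) at_top sequentially"
    show "(\<lambda>k. Phi (fk k) t
             (\<lambda>l. 2 * Qconst (fk k) * real (nk k) / (1 - rho_mu (fk k)) * left_pvec (mean_mat (fk k)) l)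
             (nk k) j) \<longlonglongrightarrow> exp (- T)"
    proof (rule sub)
      fix q A B assume q: "strict_mono q" and nc: "near_critical (\<lambda>k. fk (q k)) (8 + 5 * c) A B"
        and alt: "(\<forall>k. hstar (fk (q k)) (\<lambda>_. 1) = (\<lambda>_. 1)) \<or> (\<forall>k. hstar (fk (q k)) (\<lambda>_. 1) \<noteq> (\<lambda>_. 1))"
      interpret near_critical "\<lambda>k. fk (q k)" "8 + 5 * c" A B by (rule nc)
      have n: "filterlim (\<lambda>k. nk (q k)) at_top sequentially" by (rule subseq[OF nk q])
      have lim: "filterlim (\<lambda>k. real (nk (q k)) * (1 - rho_mu (fk (q k)))) at_top sequentially"
        using rho_mu_scale(2)[OF alt subseq[OF conjunct2[OF as] q]] .
      show "(\<lambda>k. Phi (fk (q k)) t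
             (\<lambda>l. 2 * Qconst (fk (q k)) * real (nk (q k)) / (1 - rho_mu (fk (q k))) * left_pvec (mean_mat (fk (q k))) l)
             (nk (q k)) j) \<longlonglongrightarrow> exp (- T)"
        unfolding T_def by (rule Phi_limit_linear_scale[OF n tn T(2) lim])
    qed
  qed
qed

end
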